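(* Let $G$ be a finite simple graph with $\mathrm{mad}(G)<4$. Then $\chi'_a(G)\leq \Delta(G)+2$.
   Context: A proper edge coloring of a graph is acyclic if there is no bichromatic cycle, i.e. the union of any two color classes induces a forest. The acyclic chromatic index $\chi'_a(G)$ is the least $k$ such that $G$ has an acyclic proper edge coloring with $k$ colors. $\Delta(G)$ is the maximum degree. The maximum average degree is $\mathrm{mad}(G)=\max_{H\subseteq G}\frac{2|E(H)|}{|V(H)|}$, the maximum over all (nonempty) subgraphs $H$. *)

theory Defs
  imports Complex_Main
begin

locale finite_simple_graph =
  fixes V :: "'a set" and E :: "'a set set"
  assumes finite_vertices: "finite V"
    and edges: "e \<in> E \<Longrightarrow> e \<subseteq> V \<and> card e = 2"

definition subgraph :: "'a set \<Rightarrow> 'a set set \<Rightarrow> 'a set \<Rightarrow> 'a set set \<Rightarrow> bool" where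
  "subgraph W F V E \<longleftrightarrow> W \<subseteq> V \<and> F \<subseteq> E \<and> (\<forall>e\<in>F. e \<subseteq> W)"

definition degree :: "'a set set \<Rightarrow> 'a \<Rightarrow> nat" where
  "degree E v = card {e \<in> E. v \<in> e}"

(* In the following two definitions 0 is inserted only to give the graph without vertices,
   for which the maximum would be over the empty set, the value 0. *)

definition max_degree :: "'a set \<Rightarrow> 'a set set \<Rightarrow> nat" where
  "max_degree V E = Max (insert 0 (degree E ` V))"

definition mad :: "'a set \<Rightarrow> 'a set set \<Rightarrow> real" where
  "mad V E = Max (insert 0
     {2 * real (card F) / real (card W) | W F. subgraph W F V E \<and> W \<noteq> {}})"

(* A cycle is given by the list of its vertices, without repeating the first one at the end. *)

definition is_cycle :: "'a set set \<Rightarrow> 'a list \<Rightarrow> bool" where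
  "is_cycle E vs \<longleftrightarrow> 3 \<le> length vs \<and> distinct vs \<and>
     (\<forall>i<length vs. {vs ! i, vs ! (Suc i mod length vs)} \<in> E)"

definition forest :: "'a set set \<Rightarrow> bool" where
  "forest E \<longleftrightarrow> (\<nexists>vs. is_cycle E vs)"

definition proper_edge_coloring :: "'a set set \<Rightarrow> nat \<Rightarrow> ('a set \<Rightarrow> nat) \<Rightarrow> bool" where
  "proper_edge_coloring E k c \<longleftrightarrow> (\<forall>e\<in>E. c e < k) \<and>
     (\<forall>e\<in>E. \<forall>f\<in>E. e \<noteq> f \<longrightarrow> e \<inter> f \<noteq> {} \<longrightarrow> c e \<noteq> c f)"

definition acyclic_edge_coloring :: "'a set set \<Rightarrow> nat \<Rightarrow> ('a set \<Rightarrow> nat) \<Rightarrow> bool" where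
  "acyclic_edge_coloring E k c \<longleftrightarrow> proper_edge_coloring E k c \<and>
     (\<forall>i<k. \<forall>j<k. i \<noteq> j \<longrightarrow> forest {e \<in> E. c e = i \<or> c e = j})"

definition acyclic_chromatic_index :: "'a set set \<Rightarrow> nat" where
  "acyclic_chromatic_index E = (LEAST k. \<exists>c. acyclic_edge_coloring E k c)"

(* The maxima are over finite sets and the least number of colors exists. *)

context finite_simple_graph
begin

lemma finite_edges: "finite E"
  using edges finite_vertices by (meson Pow_iff finite_Pow_iff finite_subset subsetI)

lemma finite_average_degrees:
  "finite {2 * real (card F) / real (card W) | W F. subgraph W F V E \<and> W \<noteq> {}}"
proof (rule finite_subset)
  show "finite ((\<lambda>(W, F). 2 * real (card F) / real (card W)) ` (Pow V \<times> Pow E))"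
    using finite_vertices finite_edges by simp
qed (auto simp: subgraph_def)

lemma average_degree_le_mad:
  assumes "subgraph W F V E" "W \<noteq> {}"
  shows "2 * real (card F) / real (card W) \<le> mad V E"
  unfolding mad_def using assms finite_average_degrees by (intro Max_ge) auto

lemma degree_le_max_degree: "v \<in> V \<Longrightarrow> degree E v \<le> max_degree V E"
  unfolding max_degree_def using finite_vertices by (intro Max_ge) auto

lemma ex_acyclic_edge_coloring: "\<exists>k c. acyclic_edge_coloring E k c"
proof -
  obtain c :: "'a set \<Rightarrow> nat" where c: "bij_betw c E {0..<card E}"
    using ex_bij_betw_finite_nat[OF finite_edges] by blast
  have inj: "\<And>e f. e \<in> E \<Longrightarrow> f \<in> E \<Longrightarrow> c e = c f \<Longrightarrow> e = f"
    using c by (auto simp: bij_betw_def inj_on_def)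
  have lt: "\<And>e. e \<in> E \<Longrightarrow> c e < card E"
    using c by (auto simp: bij_betw_def)
  have "forest {e \<in> E. c e = i \<or> c e = j}" for i j
    unfolding forest_def
  proof
    assume "\<exists>vs. is_cycle {e \<in> E. c e = i \<or> c e = j} vs"
    then obtain vs where len: "3 \<le> length vs" and d: "distinct vs"
      and e: "\<And>m. m < length vs \<Longrightarrow>
        {vs ! m, vs ! (Suc m mod length vs)} \<in> {e \<in> E. c e = i \<or> c e = j}"
      by (auto simp: is_cycle_def)
    let ?a = "{vs ! 0, vs ! 1}" and ?b = "{vs ! 1, vs ! 2}"
      and ?z = "{vs ! 2, vs ! (3 mod length vs)}"
    have "vs \<noteq> []" using len by auto
    then have "?a \<in> {e \<in> E. c e = i \<or> c e = j}" "?b \<in> {e \<in> E. c e = i \<or> c e = j}"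
      "?z \<in> {e \<in> E. c e = i \<or> c e = j}"
      using e[of 0] e[of 1] e[of 2] len by (simp_all add: numeral_2_eq_2 numeral_3_eq_3)
    then have *: "?a = ?b \<or> ?b = ?z \<or> ?a = ?z"
      using inj by (smt (verit) mem_Collect_eq)
    have neq: "vs ! p \<noteq> vs ! q" if "p < length vs" "q < length vs" "p \<noteq> q" for p q
      using d that by (simp add: nth_eq_iff_index_eq)
    have 0: "vs ! 0 \<noteq> vs ! 1" "vs ! 0 \<noteq> vs ! 2" "vs ! 1 \<noteq> vs ! 2"
      by (rule neq; use len in linarith)+
    have "vs ! 1 \<noteq> vs ! (3 mod length vs)"
      using len by (intro neq) (cases "length vs = 3"; auto)+
    with * 0 show False by (auto simp: doubleton_eq_iff)
  qed
  then have "acyclic_edge_coloring E (card E) c"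
    using inj lt by (auto simp: acyclic_edge_coloring_def proper_edge_coloring_def)
  then show ?thesis by blast
qed

lemma acyclic_chromatic_index_attained:
  "\<exists>c. acyclic_edge_coloring E (acyclic_chromatic_index E) c"
  unfolding acyclic_chromatic_index_def by (rule LeastI_ex) (rule ex_acyclic_edge_coloring)

end

end

theory Submission
  imports Defs
begin

text \<open>
  Let \<open>M\<close> be a bound on the degrees, and consider an edge-minimal graph without an acyclic edge
  coloring with \<open>M + 2\<close> colors. Remove a vertex \<open>v\<close> of degree two or three and color the rest \<open>H\<close>. Every
  assignment of distinct colors to the edges at \<open>v\<close>, unused at the other ends, must close a
  bichromatic cycle, so for two of these colors \<open>p\<close>, \<open>q\<close> the chain of \<open>H\<close> alternating between \<open>p\<close> and
  \<open>q\<close> joins the corresponding neighbors of \<open>v\<close>. A component of two color classes is a path with only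
  two ends, hence a chain that joins two vertices avoids every third vertex at which one of its
  colors is missing. Recoloring edges and exchanging colors around the neighbors of \<open>v\<close> then shows:
  a vertex \<open>v\<close> with a neighbor of degree two has at least four neighbors of degree at least four, or
  three of them and two neighbors of degree three; neighbors of vertices of degree three have degree
  at least four; if one of them has degree four, then the other two have degree at least five and at
  least two (if their degree is five: three) neighbors of degree at least four; a vertex of degree
  five has at most three neighbors of degree three.

  Now give each vertex the charge degree minus four. Vertices of degree two get 1 from each neighbor.
  Vertices of degree three get 1/3 from each neighbor, or, if one neighbor has degree four, 1/2 from
  the other two. No charge is negative in the end, so the average degree is at least four.
\<close>

section \<open>Components of two color classes\<close>

text \<open>Acyclicity is tested at one vertex at a time: a coloring of the graph without
  \<open>v\<close> extends exactly if the colors at \<open>v\<close> are proper and no chain joins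
  two neighbors of \<open>v\<close> in the colors of their edges to \<open>v\<close>. While
  \<open>v\<close> is uncolored, a neighbor of \<open>v\<close> sees at most \<open>M - 1\<close> of
  the \<open>M + 2\<close> colors, so it misses at least three. Chains that must exist force
  vertices to see whole sets of missing colors, and the degree bound \<open>M\<close> then
  determines these sets exactly. This rigidity makes recolorings safe, since no chain starts at a
  vertex that misses both of its colors. The numbers in the list come from the discharging. A vertex
  with B neighbors of degree at least four and n3 of degree three that gives 1 to each neighbor of
  degree two and 1/2 to each of degree three keeps B + n3/2 - 4, whence four, or three and two. The
  hardest case has a neighbor of degree two, B = 3 and n3 at most 1: there all neighbors of degree
  two are uncolored, two of three forced colors are exchanged, and the neighbors are colored again
  as far as possible.\<close>

definition del :: "'a set set \<Rightarrow> 'a \<Rightarrow> 'a set set" where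
  "del E v = {e \<in> E. v \<notin> e}"

definition seen :: "'a set set \<Rightarrow> ('a set \<Rightarrow> nat) \<Rightarrow> 'a \<Rightarrow> nat set" where
  "seen E c v = c ` {e \<in> E. v \<in> e}"

definition bic :: "'a set set \<Rightarrow> ('a set \<Rightarrow> nat) \<Rightarrow> nat \<Rightarrow> nat \<Rightarrow> 'a set set" where
  "bic E c i j = {e \<in> E. c e = i \<or> c e = j}"

definition linked :: "'a set set \<Rightarrow> 'a \<Rightarrow> 'a \<Rightarrow> bool" where
  "linked F x y \<longleftrightarrow> (x, y) \<in> {(u, v). {u, v} \<in> F}\<^sup>*"

lemma linked_refl [simp]: "linked F x x"
  by (simp add: linked_def)

lemma linked_edge: "{x, y} \<in> F \<Longrightarrow> linked F x y"
  by (auto simp: linked_def)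

lemma linked_trans: "linked F x y \<Longrightarrow> linked F y z \<Longrightarrow> linked F x z"
  by (auto simp: linked_def)

lemma linked_sym: "linked F x y \<Longrightarrow> linked F y x"
proof -
  have "sym {(u, v). {u, v} \<in> F}"
    by (auto simp: sym_def insert_commute)
  then show "linked F x y \<Longrightarrow> linked F y x"
    unfolding linked_def by (meson symD sym_rtrancl)
qed

lemma linked_mono: "linked F x y \<Longrightarrow> F \<subseteq> F' \<Longrightarrow> linked F' x y"
  unfolding linked_def by (rule rtrancl_mono[THEN subsetD]) auto

lemma del_subset: "del E v \<subseteq> E"
  by (auto simp: del_def)

lemma finite_del: "finite E \<Longrightarrow> finite (del E v)"
  by (simp add: del_def)

lemma bic_commute: "bic E c i j = bic E c j i"
  by (auto simp: bic_def)

lemma del_bic: "del (bic E c i j) v = bic (del E v) c i j"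
  by (auto simp: bic_def del_def)

lemma bic_mono: "E \<subseteq> E' \<Longrightarrow> bic E c i j \<subseteq> bic E' c i j"
  by (auto simp: bic_def)

text \<open>The path is restarted whenever it returns to \<open>x\<close>, so the part after the
  last visit lies in \<open>del F x\<close>. This allows inductions that delete the start of a
  path.\<close>

lemma linked_peel:
  assumes "linked F x y" "x \<noteq> y"
  obtains x' where "{x, x'} \<in> F" "x' \<noteq> x" "linked (del F x) x' y"
proof -
  have "(x, y) \<in> {(u, v). {u, v} \<in> F}\<^sup>*"
    using assms by (simp add: linked_def)
  then have "x = y \<or> (\<exists>x'. {x, x'} \<in> F \<and> x' \<noteq> x \<and> linked (del F x) x' y)"
  proof (induction rule: rtrancl_induct)
    case (step y z)
    show ?case
    proof (cases "z = x \<or> y = x")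
      case True
      then show ?thesis using step by auto
    next
      case False
      then obtain x' where x': "{x, x'} \<in> F" "x' \<noteq> x" "linked (del F x) x' y"
        using step.IH by auto
      have "{y, z} \<in> del F x" using False step by (auto simp: del_def)
      then show ?thesis using x' linked_trans linked_edge by metis
    qed
  qed auto
  then show ?thesis using assms that by auto
qed

lemma degree_mono: "finite F' \<Longrightarrow> F \<subseteq> F' \<Longrightarrow> degree F x \<le> degree F' x"
  unfolding degree_def by (intro card_mono) auto

lemma degree_del_less:
  assumes "finite F" "{x, y} \<in> F"
  shows "degree (del F x) y < degree F y"
proof -
  have "{x, y} \<in> {e \<in> F. y \<in> e}" "{x, y} \<notin> {e \<in> del F x. y \<in> e}"
    using assms by (auto simp: del_def)
  moreover have "{e \<in> del F x. y \<in> e} \<subseteq> {e \<in> F. y \<in> e}"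
    by (auto simp: del_def)
  ultimately have "{e \<in> del F x. y \<in> e} \<subset> {e \<in> F. y \<in> e}"
    by blast
  then show ?thesis
    unfolding degree_def using assms by (intro psubset_card_mono) auto
qed

lemma card_del_less:
  assumes "finite F" "{x, y} \<in> F"
  shows "card (del F x) < card F"
proof -
  have "{x, y} \<notin> del F x" by (simp add: del_def)
  then have "del F x \<subset> F" using assms(2) del_subset[of F x] by (metis psubsetI)
  then show ?thesis using assms by (intro psubset_card_mono) auto
qed

lemma not_linked_degree_0:
  assumes "finite F" "degree F x = 0" "x \<noteq> y"
  shows "\<not> linked F x y"
proof
  assume "linked F x y"
  with assms obtain x' where "{x, x'} \<in> F" by (auto elim: linked_peel)
  moreover have "{e \<in> F. x \<in> e} = {}"
    using assms by (simp add: degree_def)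
  ultimately show False by auto
qed

text \<open>Components of a graph of maximum degree two are paths or cycles, so they have at most two ends.\<close>

lemma three_ends:
  assumes "finite F" "\<And>u. degree F u \<le> 2"
    and "linked F x y" "linked F x z" "x \<noteq> y" "x \<noteq> z" "y \<noteq> z"
    and "degree F x \<le> 1" "degree F y \<le> 1" "degree F z \<le> 1"
  shows False
  using assms
proof (induction "card F" arbitrary: F x rule: less_induct)
  case less
  obtain x' where x': "{x, x'} \<in> F" "x' \<noteq> x" "linked (del F x) x' y"
    using less.prems by (auto elim: linked_peel)
  obtain x'' where x'': "{x, x''} \<in> F" "x'' \<noteq> x" "linked (del F x) x'' z"
    using less.prems by (auto elim: linked_peel)
  \<comment> \<open>Degree at most one at \<open>x\<close> makes both links leave by the same edge,
    so \<open>x'\<close> can take over the role of \<open>x\<close> in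
    \<open>del F x\<close>.\<close>
  have "x' = x''"
  proof (rule ccontr)
    assume "x' \<noteq> x''"
    then have "card {{x, x'}, {x, x''}} = 2"
      using x' x'' by (auto simp: doubleton_eq_iff)
    moreover have "card {{x, x'}, {x, x''}} \<le> degree F x"
      unfolding degree_def by (rule card_mono) (use less.prems x' x'' in auto)
    ultimately show False using less.prems by simp
  qed
  note x'' = x''[folded this]
  have fin: "finite (del F x)"
    using less.prems(1) by (rule finite_del)
  have lt: "degree (del F x) x' < degree F x'"
    by (rule degree_del_less) (use less.prems x' in auto)
  have le: "degree (del F x) u \<le> degree F u" for u
    by (rule degree_mono[OF less.prems(1) del_subset])
  \<comment> \<open>Otherwise \<open>y\<close> would have degree 0 in \<open>del F x\<close> and
    still be linked to \<open>z\<close>.\<close>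
  have "x' \<noteq> y"
    using not_linked_degree_0[OF fin, of y z] lt x'' less.prems by auto
  moreover have "x' \<noteq> z"
    using not_linked_degree_0[OF fin, of z y] lt x' less.prems by auto
  moreover have "card (del F x) < card F"
    by (rule card_del_less[OF less.prems(1) x'(1)])
  moreover have "degree (del F x) u \<le> 2" for u
    using le[of u] less.prems(2)[of u] by simp
  moreover have "degree (del F x) x' \<le> 1"
    using lt less.prems(2)[of x'] by simp
  moreover have "degree (del F x) y \<le> 1" "degree (del F x) z \<le> 1"
    using le[of y] le[of z] less.prems by auto
  ultimately show False
    using less.hyps[of "del F x" x'] fin x' x'' less.prems by blast
qed

section \<open>Cycles through a vertex and a local criterion for acyclic colorings\<close>

lemma linked_path:
  assumes "finite F" "linked F x y"
  shows "\<exists>xs. distinct xs \<and> xs \<noteq> [] \<and> hd xs = x \<and> last xs = y \<and> set xs \<subseteq> insert x (\<Union>F) \<and>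
    (\<forall>i. Suc i < length xs \<longrightarrow> {xs ! i, xs ! Suc i} \<in> F)"
  using assms
proof (induction "card F" arbitrary: F x rule: less_induct)
  case less
  show ?case
  proof (cases "x = y")
    case True
    then show ?thesis by (intro exI[of _ "[x]"]) auto
  next
    case False
    then obtain x' where x': "{x, x'} \<in> F" "x' \<noteq> x" "linked (del F x) x' y"
      using less.prems by (auto elim: linked_peel)
    have "card (del F x) < card F"
      by (rule card_del_less[OF less.prems(1) x'(1)])
    moreover have "finite (del F x)"
      using less.prems(1) by (rule finite_del)
    ultimately obtain xs where xs: "distinct xs" "xs \<noteq> []" "hd xs = x'" "last xs = y"
      "set xs \<subseteq> insert x' (\<Union>(del F x))"
      "\<And>i. Suc i < length xs \<Longrightarrow> {xs ! i, xs ! Suc i} \<in> del F x"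
      using less.hyps[of "del F x" x'] x' by auto
    have "x \<notin> \<Union>(del F x)" by (auto simp: del_def)
    then have "x \<notin> set xs" using xs(5) x'(2) by blast
    moreover have "{(x # xs) ! i, (x # xs) ! Suc i} \<in> F" if "Suc i < length (x # xs)" for i
    proof (cases i)
      case 0
      then show ?thesis using xs x' by (cases xs) auto
    next
      case (Suc j)
      then show ?thesis using xs(6)[of j] that by (auto simp: del_def)
    qed
    moreover have "set (x # xs) \<subseteq> insert x (\<Union>F)"
    proof -
      have "insert x' (\<Union>(del F x)) \<subseteq> \<Union>F" using x'(1) by (auto simp: del_def)
      with xs(5) have "set xs \<subseteq> \<Union>F" by (rule subset_trans)
      then show ?thesis by auto
    qed
    ultimately show ?thesis using xs by (intro exI[of _ "x # xs"]) auto
  qed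
qed

lemma cycle_through:
  assumes "finite F" "{v, x} \<in> F" "{v, y} \<in> F" "x \<noteq> y" "v \<noteq> x" "linked (del F v) x y"
  shows "\<exists>vs. is_cycle F vs"
proof -
  have "finite (del F v)" using assms(1) by (rule finite_del)
  from linked_path[OF this assms(6)] obtain xs where xs: "distinct xs" "xs \<noteq> []" "hd xs = x"
    "last xs = y" "set xs \<subseteq> insert x (\<Union>(del F v))"
    "\<And>i. Suc i < length xs \<Longrightarrow> {xs ! i, xs ! Suc i} \<in> del F v"
    by auto
  have "length xs \<noteq> 1" using xs assms(4) by (cases xs) auto
  moreover have "length xs \<noteq> 0" using xs by simp
  ultimately have len: "length xs \<ge> 2" by linarith
  have "v \<notin> \<Union>(del F v)" by (auto simp: del_def)
  then have "v \<notin> set xs" using xs(5) assms(5) by blast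
  moreover have "{(v # xs) ! i, (v # xs) ! (Suc i mod length (v # xs))} \<in> F"
    if "i < length (v # xs)" for i
  proof (cases i)
    case 0
    then show ?thesis using xs assms len by (cases xs) auto
  next
    case (Suc j)
    show ?thesis
    proof (cases "Suc j < length xs")
      case True
      then show ?thesis using Suc xs(6)[of j] by (auto simp: del_def)
    next
      case False
      then have "Suc i = length (v # xs)" "j = length xs - 1" using that Suc by auto
      then show ?thesis using Suc xs assms
        by (simp add: last_conv_nth insert_commute)
    qed
  qed
  ultimately have "is_cycle F (v # xs)"
    using len xs by (auto simp: is_cycle_def)
  then show ?thesis by blast
qed

text \<open>Walking once around the cycle from \<open>v\<close> gives a path between the two cycle
  neighbors of \<open>v\<close> that avoids \<open>v\<close>.\<close>

lemma cycle_linked: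
  assumes "is_cycle F vs" "v \<in> set vs"
  obtains x y where "x \<noteq> y" "{v, x} \<in> F" "{v, y} \<in> F" "x \<noteq> v" "y \<noteq> v" "linked (del F v) x y"
proof -
  define n where "n = length vs"
  have n: "3 \<le> n" and dist: "distinct vs"
    and e: "\<And>i. i < n \<Longrightarrow> {vs ! i, vs ! (Suc i mod n)} \<in> F"
    using assms(1) by (auto simp: is_cycle_def n_def)
  obtain m where m: "m < n" "vs ! m = v"
    using assms(2) by (auto simp: in_set_conv_nth n_def)
  \<comment> \<open>The cycle rotated to start at \<open>v\<close>, so that \<open>u 0\<close> and
    \<open>u n\<close> are both \<open>v\<close>.\<close>
  define u where "u = (\<lambda>i. vs ! ((m + i) mod n))"
  have edge: "{u i, u (Suc i)} \<in> F" for i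
    using e[of "(m + i) mod n"] n by (simp add: u_def mod_Suc_eq)
  have inj: "u i \<noteq> u j" if "i < j" "j < n" for i j
  proof -
    have "(m + i) mod n \<noteq> (m + j) mod n"
    proof
      assume "(m + i) mod n = (m + j) mod n"
      then have "n dvd (m + j) - (m + i)"
        using that by (metis add_le_cancel_left less_imp_le mod_eq_dvd_iff_nat)
      then show False using that by (auto dest: dvd_imp_le)
    qed
    moreover have "(m + i) mod n < length vs" "(m + j) mod n < length vs"
      using n by (simp_all add: n_def[symmetric])
    ultimately show ?thesis using nth_eq_iff_index_eq[OF dist] by (auto simp: u_def)
  qed
  have u0: "u 0 = v" using m by (simp add: u_def)
  have un: "u n = v" using m by (simp add: u_def)
  have link: "linked (del F v) (u 1) (u (Suc i))" if "Suc i < n" for i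
    using that
  proof (induction i)
    case (Suc i)
    have "{u (Suc i), u (Suc (Suc i))} \<in> del F v"
      using edge inj[of 0 "Suc i"] inj[of 0 "Suc (Suc i)"] Suc.prems u0
      by (auto simp: del_def)
    then show ?case using Suc linked_trans linked_edge
      by (metis Suc_lessD)
  qed simp
  show ?thesis
  proof (rule that[of "u 1" "u (n - 1)"])
    show "u 1 \<noteq> u (n - 1)" using inj[of 1 "n - 1"] n by auto
    show "{v, u 1} \<in> F" using edge[of 0] u0 by simp
    show "{v, u (n - 1)} \<in> F" using edge[of "n - 1"] un n by (simp add: insert_commute)
    show "u 1 \<noteq> v" using inj[of 0 1] u0 n by auto
    show "u (n - 1) \<noteq> v" using inj[of 0 "n - 1"] u0 n by auto
    show "linked (del F v) (u 1) (u (n - 1))" using link[of "n - 2"] n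
      by (simp add: Suc_diff_Suc numeral_2_eq_2)
  qed
qed

lemma is_cycle_subset: "is_cycle F vs \<Longrightarrow> F \<subseteq> F' \<Longrightarrow> is_cycle F' vs"
  by (auto simp: is_cycle_def)

lemma is_cycle_del:
  assumes "is_cycle F vs" "v \<notin> set vs"
  shows "is_cycle (del F v) vs"
  unfolding is_cycle_def
proof (intro conjI allI impI)
  fix i assume i: "i < length vs"
  then have "{vs ! i, vs ! (Suc i mod length vs)} \<in> F"
    using assms by (auto simp: is_cycle_def)
  moreover have "Suc i mod length vs < length vs" using i by (intro mod_less_divisor) auto
  ultimately show "{vs ! i, vs ! (Suc i mod length vs)} \<in> del F v"
    using assms(2) i nth_mem by (fastforce simp: del_def)
qed (use assms in \<open>auto simp: is_cycle_def\<close>)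

definition graph :: "'a set set \<Rightarrow> bool" where
  "graph E \<longleftrightarrow> finite E \<and> (\<forall>e\<in>E. card e = 2)"

lemma graph_subset: "graph E \<Longrightarrow> F \<subseteq> E \<Longrightarrow> graph F"
  by (auto simp: graph_def finite_subset)

lemma graph_del: "graph E \<Longrightarrow> graph (del E v)"
  by (rule graph_subset[OF _ del_subset])

lemma graph_edge:
  assumes "graph E" "e \<in> E" "v \<in> e"
  obtains x where "e = {v, x}" "x \<noteq> v"
proof -
  have "card e = 2" using assms by (auto simp: graph_def)
  then show ?thesis using that assms(3) by (auto simp: card_2_iff insert_commute)
qed

lemma aec_subset: "acyclic_edge_coloring E k c \<Longrightarrow> F \<subseteq> E \<Longrightarrow> acyclic_edge_coloring F k c"
  unfolding acyclic_edge_coloring_def proper_edge_coloring_def forest_def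
  by (smt (verit) is_cycle_subset Collect_mono mem_Collect_eq subset_eq)

text \<open>A bichromatic cycle either lies in \<open>del E v\<close> or uses two edges
  \<open>v x\<close> and \<open>v y\<close>, whose colors are then the two colors of the cycle; its
  remainder joins \<open>x\<close> and \<open>y\<close> in \<open>del E v\<close>. Later colorings
  are assembled by this criterion.\<close>

lemma aec_vertex_iff:
  assumes g: "graph E"
  shows "acyclic_edge_coloring E k c \<longleftrightarrow>
    acyclic_edge_coloring (del E v) k c \<and>
    (\<forall>x. {v, x} \<in> E \<longrightarrow> c {v, x} < k \<and> c {v, x} \<notin> seen (del E v) c x) \<and>
    (\<forall>x y. {v, x} \<in> E \<longrightarrow> {v, y} \<in> E \<longrightarrow> x \<noteq> y \<longrightarrow> c {v, x} \<noteq> c {v, y} \<and>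
      \<not> linked (bic (del E v) c (c {v, x}) (c {v, y})) x y)" (is "?l \<longleftrightarrow> ?r1 \<and> ?r2 \<and> ?r3")
proof (intro iffI conjI)
  assume l: ?l
  have fin: "finite (bic E c i j)" for i j using g by (auto simp: graph_def bic_def)
  show ?r1 using l by (rule aec_subset[OF _ del_subset])
  have neq0: "\<And>e f. e \<in> E \<Longrightarrow> f \<in> E \<Longrightarrow> e \<noteq> f \<Longrightarrow> e \<inter> f \<noteq> {} \<Longrightarrow> c e \<noteq> c f"
    and bound: "\<And>e. e \<in> E \<Longrightarrow> c e < k"
    and acyc: "\<And>i j. i < k \<Longrightarrow> j < k \<Longrightarrow> i \<noteq> j \<Longrightarrow> forest (bic E c i j)"
    using l by (auto simp: acyclic_edge_coloring_def proper_edge_coloring_def bic_def)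
  have neq: "v \<noteq> x" if "{v, x} \<in> E" for x using g that by (force simp: graph_def)
  show ?r2
  proof (intro allI impI conjI)
    fix x assume x: "{v, x} \<in> E"
    then show "c {v, x} < k" by (rule bound)
    show "c {v, x} \<notin> seen (del E v) c x"
    proof
      assume "c {v, x} \<in> seen (del E v) c x"
      then obtain e where "e \<in> E" "v \<notin> e" "x \<in> e" "c {v, x} = c e"
        by (auto simp: seen_def del_def)
      then show False using neq0[of "{v, x}" e] x by auto
    qed
  qed
  show ?r3
  proof (intro allI impI conjI)
    fix x y assume xy: "{v, x} \<in> E" "{v, y} \<in> E" "x \<noteq> y"
    then show *: "c {v, x} \<noteq> c {v, y}"
      by (intro neq0) (auto simp: doubleton_eq_iff)
    let ?F = "bic E c (c {v, x}) (c {v, y})"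
    show "\<not> linked (bic (del E v) c (c {v, x}) (c {v, y})) x y"
    proof
      assume "linked (bic (del E v) c (c {v, x}) (c {v, y})) x y"
      then have "linked (del ?F v) x y" by (simp add: del_bic)
      then have "\<exists>vs. is_cycle ?F vs"
        by (intro cycle_through[OF fin, of v x _ _ y]) (use xy neq in \<open>auto simp: bic_def\<close>)
      then show False using acyc[OF _ _ *] bound xy by (auto simp: forest_def)
    qed
  qed
next
  assume r: "?r1 \<and> ?r2 \<and> ?r3"
  have bound: "c e < k" if "e \<in> E" for e
  proof (cases "v \<in> e")
    case True
    then show ?thesis using r that graph_edge[OF g that True] by metis
  next
    case False
    then have "e \<in> del E v" using that by (auto simp: del_def)
    then show ?thesis using r by (auto simp: acyclic_edge_coloring_def proper_edge_coloring_def)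
  qed
  have neq1: "c e \<noteq> c f" if ef: "e \<in> E" "f \<in> E" "v \<in> e" "v \<notin> f" "e \<inter> f \<noteq> {}" for e f
  proof -
    obtain x where x: "e = {v, x}" "x \<noteq> v" using graph_edge[OF g] ef by metis
    then have "c f \<in> seen (del E v) c x" using ef by (auto simp: seen_def del_def)
    then show ?thesis using r x ef by auto
  qed
  have neq0: "c e \<noteq> c f" if ef: "e \<in> E" "f \<in> E" "e \<noteq> f" "e \<inter> f \<noteq> {}" for e f
  proof (cases "v \<in> e")
    case ve: True
    show ?thesis
    proof (cases "v \<in> f")
      case True
      obtain x where "e = {v, x}" "x \<noteq> v" using graph_edge[OF g] ef ve by metis
      moreover obtain y where "f = {v, y}" "y \<noteq> v" using graph_edge[OF g] ef True by metis
      ultimately show ?thesis using r ef by auto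
    next
      case False
      then show ?thesis using neq1 ef ve by auto
    qed
  next
    case ve: False
    show ?thesis
    proof (cases "v \<in> f")
      case True
      then show ?thesis using neq1[of f e] ef ve by (auto simp: Int_commute)
    next
      case False
      then have "e \<in> del E v" "f \<in> del E v" using ef ve by (auto simp: del_def)
      then show ?thesis using r ef by (auto simp: acyclic_edge_coloring_def proper_edge_coloring_def)
    qed
  qed
  have "forest (bic E c i j)" if ij: "i < k" "j < k" "i \<noteq> j" for i j
    unfolding forest_def
  proof
    assume "\<exists>vs. is_cycle (bic E c i j) vs"
    then obtain vs where vs: "is_cycle (bic E c i j) vs" by blast
    show False
    proof (cases "v \<in> set vs")
      case True
      then obtain x y where xy: "x \<noteq> y" "{v, x} \<in> bic E c i j" "{v, y} \<in> bic E c i j"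
        "linked (del (bic E c i j) v) x y"
        using cycle_linked[OF vs] by metis
      then have "{v, x} \<in> E" "{v, y} \<in> E" by (auto simp: bic_def)
      with r xy have "c {v, x} \<noteq> c {v, y}" by blast
      then have "bic (del E v) c i j = bic (del E v) c (c {v, x}) (c {v, y})"
        using xy by (auto simp: bic_def)
      then show False using xy r \<open>{v, x} \<in> E\<close> \<open>{v, y} \<in> E\<close> by (simp add: del_bic)
    next
      case False
      then have "is_cycle (bic (del E v) c i j) vs"
        using is_cycle_del[OF vs] by (simp add: del_bic)
      then show False using r ij
        by (auto simp: acyclic_edge_coloring_def forest_def bic_def)
    qed
  qed
  then show ?l using bound neq0
    by (auto simp: acyclic_edge_coloring_def proper_edge_coloring_def bic_def)
qed

section \<open>Chains and recoloring\<close>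

definition chain :: "'a set set \<Rightarrow> ('a set \<Rightarrow> nat) \<Rightarrow> nat \<Rightarrow> nat \<Rightarrow> 'a \<Rightarrow> 'a \<Rightarrow> bool" where
  "chain E c p q x y \<longleftrightarrow> linked (bic E c p q) x y"

lemma chain_sym: "chain E c p q x y \<Longrightarrow> chain E c p q y x"
  by (simp add: chain_def linked_sym)

lemma chain_commute: "chain E c p q x y \<longleftrightarrow> chain E c q p x y"
  by (simp add: chain_def bic_commute)

lemma chain_flip: "chain E c p q x y \<Longrightarrow> chain E c q p y x"
  by (simp add: chain_def bic_commute[of E c q] linked_sym)

lemma chain_trans: "chain E c p q x y \<Longrightarrow> chain E c p q y z \<Longrightarrow> chain E c p q x z"
  unfolding chain_def by (rule linked_trans)

lemma chain_edge: "{x, y} \<in> E \<Longrightarrow> c {x, y} = p \<or> c {x, y} = q \<Longrightarrow> chain E c p q x y"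
  unfolding chain_def by (rule linked_edge) (simp add: bic_def)

lemma chain_mono:
  assumes "chain E c p q x y" "bic E c p q \<subseteq> bic E' c' p q"
  shows "chain E' c' p q x y"
  using assms linked_mono by (auto simp: chain_def)

lemma chain_subset: "chain E c p q x y \<Longrightarrow> E \<subseteq> E' \<Longrightarrow> chain E' c p q x y"
  using chain_mono[of E c p q x y E' c] bic_mono[of E E'] by blast

lemma chain_cong:
  assumes "bic E c p q = bic E' c' p q"
  shows "chain E c p q x y \<longleftrightarrow> chain E' c' p q x y"
  using assms by (simp add: chain_def)

lemma seenI: "{x, y} \<in> E \<Longrightarrow> c {x, y} = p \<Longrightarrow> p \<in> seen E c x"
  by (auto simp: seen_def)

lemma seenE:
  assumes "graph E" "p \<in> seen E c x"
  obtains y where "{x, y} \<in> E" "c {x, y} = p" "y \<noteq> x"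
proof -
  obtain e where e: "e \<in> E" "x \<in> e" "c e = p" using assms(2) by (auto simp: seen_def)
  obtain y where "e = {x, y}" "y \<noteq> x" using graph_edge[OF assms(1) e(1,2)] .
  with e that show ?thesis by metis
qed

lemma seen_mono: "E \<subseteq> E' \<Longrightarrow> seen E c x \<subseteq> seen E' c x"
  by (auto simp: seen_def)

lemma finite_seen: "graph E \<Longrightarrow> finite (seen E c x)"
  by (auto simp: seen_def graph_def)

lemma seen_cong:
  assumes "{e \<in> E. x \<in> e} = {e \<in> E'. x \<in> e}" "\<And>e. e \<in> E \<Longrightarrow> x \<in> e \<Longrightarrow> c e = c' e"
  shows "seen E c x = seen E' c' x"
proof -
  have "c ` {e \<in> E. x \<in> e} = c' ` {e \<in> E. x \<in> e}" using assms(2) by (intro image_cong) auto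
  then show ?thesis using assms(1) by (simp add: seen_def)
qed

lemma chain_seen:
  assumes "chain E c p q x y" "x \<noteq> y"
  shows "p \<notin> seen E c x \<Longrightarrow> q \<in> seen E c x" "q \<notin> seen E c x \<Longrightarrow> p \<in> seen E c x"
proof -
  obtain x' where "{x, x'} \<in> bic E c p q"
    using assms linked_peel unfolding chain_def by metis
  then have "p \<in> seen E c x \<or> q \<in> seen E c x"
    by (auto simp: bic_def intro: seenI)
  then show "p \<notin> seen E c x \<Longrightarrow> q \<in> seen E c x" "q \<notin> seen E c x \<Longrightarrow> p \<in> seen E c x" by auto
qed

lemma chain_isolated: "p \<notin> seen E c x \<Longrightarrow> q \<notin> seen E c x \<Longrightarrow> x \<noteq> y \<Longrightarrow> \<not> chain E c p q x y"
  by (auto dest: chain_seen(1))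

lemma chain_isolated': "p \<notin> seen E c y \<Longrightarrow> q \<notin> seen E c y \<Longrightarrow> x \<noteq> y \<Longrightarrow> \<not> chain E c p q x y"
  using chain_isolated[of p E c y q x] by (auto dest: chain_sym)

text \<open>An edge with an end outside the component of \<open>x\<close> cannot lie on the chain,
  so dropping such edges does not interrupt it.\<close>

lemma chain_restrict:
  assumes "chain E c p q x y" "F \<subseteq> E"
    and "\<And>e. e \<in> E \<Longrightarrow> e \<notin> F \<Longrightarrow> c e = p \<or> c e = q \<Longrightarrow> \<exists>u\<in>e. \<not> chain E c p q x u"
  shows "chain F c p q x y"
proof -
  have "(x, y) \<in> {(u, v). {u, v} \<in> bic E c p q}\<^sup>*"
    using assms(1) by (simp add: chain_def linked_def)
  then show ?thesis
  proof (induction rule: rtrancl_induct)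
    case (step y z)
    have e: "{y, z} \<in> E" "c {y, z} = p \<or> c {y, z} = q"
      using step.hyps(2) by (auto simp: bic_def)
    have y: "chain E c p q x y"
      using step.IH assms(2) by (rule chain_subset)
    moreover have "chain E c p q x z"
      using y chain_edge[OF e(1), of c p q, OF e(2)] by (rule chain_trans)
    ultimately have "{y, z} \<in> F"
      using assms(3)[OF e(1) _ e(2)] by auto
    then show ?case using step.IH e(2) by (blast intro: chain_trans chain_edge)
  qed (simp add: chain_def)
qed

section \<open>Chains in an acyclic coloring and the colors seen along them\<close>

locale coloring =
  fixes E :: "'a set set" and k :: nat and c :: "'a set \<Rightarrow> nat"
  assumes graph: "graph E" and acyclic: "acyclic_edge_coloring E k c"
begin

lemma color_eq:
  assumes "e \<in> E" "f \<in> E" "x \<in> e" "x \<in> f" "c e = c f"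
  shows "e = f"
  using acyclic assms unfolding acyclic_edge_coloring_def proper_edge_coloring_def by blast

lemma inj_on_edges_at: "inj_on c {e \<in> E. x \<in> e}"
  using color_eq by (intro inj_onI) blast

lemma nbr_eq:
  assumes "{x, y} \<in> E" "{x, z} \<in> E" "c {x, y} = c {x, z}"
  shows "y = z"
  using color_eq[OF assms(1,2), of x] assms(3) by (auto simp: doubleton_eq_iff)

lemma no_loop: "{x, x} \<notin> E"
  using graph by (force simp: graph_def)

lemma color_bound: "e \<in> E \<Longrightarrow> c e < k"
  using acyclic by (auto simp: acyclic_edge_coloring_def proper_edge_coloring_def)

lemma seen_bound: "seen E c x \<subseteq> {..<k}"
  by (auto simp: seen_def color_bound)

lemma seen_less: "p \<in> seen E c x \<Longrightarrow> p < k"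
  using seen_bound by auto

lemma card_seen: "card (seen E c x) = degree E x"
  unfolding seen_def degree_def
  by (rule card_image) (rule inj_on_edges_at)

lemma coloring_subset: "F \<subseteq> E \<Longrightarrow> coloring F k c"
  using graph acyclic by unfold_locales (auto intro: graph_subset aec_subset)

lemma coloring_del: "coloring (del E v) k c"
  by (rule coloring_subset[OF del_subset])

lemma seen_del:
  assumes "w \<noteq> z"
  shows "seen (del E w) c z = (if {w, z} \<in> E then seen E c z - {c {w, z}} else seen E c z)"
proof -
  have *: "e = {w, z}" if "e \<in> E" "z \<in> e" "w \<in> e" for e
    using graph_edge[OF graph that(1) that(2)] that(3) assms by blast
  show ?thesis
  proof (cases "{w, z} \<in> E")
    case True
    have "{e \<in> del E w. z \<in> e} = {e \<in> E. z \<in> e} - {{w, z}}"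
      using * by (auto simp: del_def)
    then show ?thesis
      using True inj_on_edges_at by (simp add: seen_def inj_on_image_set_diff[of c "{e \<in> E. z \<in> e}"])
  next
    case False
    then have "{e \<in> del E w. z \<in> e} = {e \<in> E. z \<in> e}" using * by (auto simp: del_def)
    then show ?thesis using False by (simp add: seen_def)
  qed
qed

lemma degree_bic: "degree (bic E c p q) u \<le> 2"
  and degree_bic_missing: "p \<notin> seen E c u \<or> q \<notin> seen E c u \<Longrightarrow> degree (bic E c p q) u \<le> 1"
proof -
  have inj: "inj_on c {e \<in> bic E c p q. u \<in> e}"
    by (rule inj_on_subset[OF inj_on_edges_at]) (auto simp: bic_def)
  have "c ` {e \<in> bic E c p q. u \<in> e} \<subseteq> {p, q} \<inter> seen E c u"
    by (auto simp: bic_def seen_def)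
  then have *: "degree (bic E c p q) u \<le> card ({p, q} \<inter> seen E c u)"
    unfolding degree_def card_image[OF inj, symmetric] by (intro card_mono) auto
  also have "card ({p, q} \<inter> seen E c u) \<le> card {p, q}" by (rule card_mono) auto
  also have "card {p, q} \<le> 2" by (cases "p = q") auto
  finally show "degree (bic E c p q) u \<le> 2" .
  assume "p \<notin> seen E c u \<or> q \<notin> seen E c u"
  then have "{p, q} \<inter> seen E c u \<subseteq> {p} \<or> {p, q} \<inter> seen E c u \<subseteq> {q}" by auto
  then have "card ({p, q} \<inter> seen E c u) \<le> 1"
    using card_mono[of "{p}"] card_mono[of "{q}"] by fastforce
  with * show "degree (bic E c p q) u \<le> 1" by simp
qed

text \<open>This is \<open>three_ends\<close> in terms of colors: a missing color bounds the degree
  in \<open>bic E c p q\<close> by one. Most contradictions below have this form.\<close>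

lemma chain_ends:
  assumes "chain E c p q x y" "chain E c p q x z" "x \<noteq> y" "x \<noteq> z" "y \<noteq> z"
    and "p \<notin> seen E c x \<or> q \<notin> seen E c x" "p \<notin> seen E c y \<or> q \<notin> seen E c y"
    and "p \<notin> seen E c z \<or> q \<notin> seen E c z"
  shows False
proof (rule three_ends[of "bic E c p q" x y z])
  show "finite (bic E c p q)" using graph by (simp add: graph_def bic_def)
qed (use assms degree_bic degree_bic_missing in \<open>simp_all add: chain_def\<close>)

text \<open>As \<open>q\<close> is missing at \<open>w\<close>, the only edge by which the chain can
  reach \<open>w\<close> has color \<open>p\<close>.\<close>

lemma chain_last:
  assumes "chain E c p q x w" "x \<noteq> w" "q \<notin> seen E c w"
  obtains z where "{w, z} \<in> E" "z \<noteq> w" "c {w, z} = p" "chain (del E w) c p q x z"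
proof -
  have "linked (bic E c p q) w x" using assms by (simp add: chain_def linked_sym)
  then obtain z where z: "{w, z} \<in> bic E c p q" "z \<noteq> w" "linked (del (bic E c p q) w) z x"
    using assms linked_peel by metis
  then have "{w, z} \<in> E" "c {w, z} = p" using assms(3) by (auto simp: bic_def intro: seenI)
  then show ?thesis using that[of z] z by (simp add: chain_def del_bic linked_sym)
qed

text \<open>The last edge \<open>w z\<close> has color \<open>p\<close>, which \<open>x\<close>
  misses, so the chain continues beyond \<open>z\<close>, by an edge of color \<open>q\<close>. This
  turns the existence of chains into lower bounds for the colors seen at neighbors of
  \<open>w\<close>.\<close>

lemma chain_nbr:
  assumes "chain E c p q x w" "x \<noteq> w" "q \<notin> seen E c w" "p \<notin> seen E c x"
  obtains z where "{w, z} \<in> E" "z \<noteq> w" "z \<noteq> x" "c {w, z} = p" "q \<in> seen E c z"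
    "chain (del E w) c p q x z"
proof -
  obtain z where z: "{w, z} \<in> E" "z \<noteq> w" "c {w, z} = p" "chain (del E w) c p q x z"
    using chain_last[OF assms(1-3)] by metis
  have "z \<noteq> x" using z assms(4) seenI[of z w E c p] by (auto simp: insert_commute)
  moreover have "p \<notin> seen (del E w) c z" using seen_del[of w z] z by auto
  then have "q \<in> seen (del E w) c z"
    using chain_seen(1)[OF chain_sym[OF z(4)]] \<open>z \<noteq> x\<close> by auto
  then have "q \<in> seen E c z" using seen_mono[OF del_subset] by fast
  ultimately show ?thesis using that z by blast
qed

lemma chain_nbr_at:
  assumes "chain E c p q x w" "x \<noteq> w" "q \<notin> seen E c w" "p \<notin> seen E c x"
    and "{w, z} \<in> E" "c {w, z} = p"
  shows "z \<noteq> x" "q \<in> seen E c z" "chain (del E w) c p q x z"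
proof -
  obtain z' where z': "{w, z'} \<in> E" "z' \<noteq> x" "c {w, z'} = p" "q \<in> seen E c z'"
    "chain (del E w) c p q x z'"
    using chain_nbr[OF assms(1-4)] by metis
  then have "z' = z" using nbr_eq assms(5,6) by metis
  then show "z \<noteq> x" "q \<in> seen E c z" "chain (del E w) c p q x z" using z' by auto
qed

text \<open>If the chain met \<open>z\<close>, then \<open>z\<close> would be its third end.\<close>

lemma chain_del:
  assumes "chain E c p q x y" "x \<noteq> y" "z \<noteq> x" "z \<noteq> y"
    and "p \<notin> seen E c x \<or> q \<notin> seen E c x" "p \<notin> seen E c y \<or> q \<notin> seen E c y"
    and "p \<notin> seen E c z \<or> q \<notin> seen E c z"
  shows "chain (del E z) c p q x y"
proof (rule chain_restrict[OF assms(1) del_subset])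
  have "\<not> chain E c p q x z" using chain_ends[OF assms(1)] assms by metis
  then show "\<exists>u\<in>e. \<not> chain E c p q x u" if "e \<in> E" "e \<notin> del E z" for e
    using that by (auto simp: del_def)
qed

lemma vertex_iff:
  assumes "{v, x} \<in> E"
  shows "c {v, x} \<notin> seen (del E v) c x"
    "{v, y} \<in> E \<Longrightarrow> x \<noteq> y \<Longrightarrow> \<not> chain (del E v) c (c {v, x}) (c {v, y}) x y"
  using acyclic aec_vertex_iff[OF graph, of k c v] assms by (auto simp: chain_def)

lemma seen_recolor:
  assumes "{w, z} \<in> E" "i \<noteq> r" "i = c {w, z} \<or> i \<notin> seen E c w"
  shows "i \<notin> seen E (c({w, z} := r)) w"
proof
  assume "i \<in> seen E (c({w, z} := r)) w"
  then obtain e where e: "e \<in> E" "w \<in> e" "i = (c({w, z} := r)) e"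
    unfolding seen_def image_iff by blast
  then have *: "e \<noteq> {w, z}" "c e = i" using assms(2) by (simp_all split: if_splits)
  from assms(3) show False
  proof
    assume "i = c {w, z}"
    then show False using * color_eq[OF e(1) assms(1) e(2)] by simp
  next
    assume "i \<notin> seen E c w"
    then show False using * e(1,2) unfolding seen_def by blast
  qed
qed

end

section \<open>Painting a vertex, recoloring an edge, exchanging two colors\<close>

definition paint :: "('a set \<Rightarrow> nat) \<Rightarrow> 'a \<Rightarrow> ('a \<Rightarrow> nat) \<Rightarrow> 'a set \<Rightarrow> nat" where
  "paint c v f e = (if v \<in> e then f (THE x. e = {v, x}) else c e)"

lemma paint_at [simp]: "paint c v f {v, x} = f x"
proof -
  have "(THE y. {v, x} = {v, y}) = x" by (rule the_equality) (auto simp: doubleton_eq_iff)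
  then show ?thesis by (simp add: paint_def)
qed

lemma paint_off [simp]: "v \<notin> e \<Longrightarrow> paint c v f e = c e"
  by (simp add: paint_def)

lemma bic_paint: "bic (del E v) (paint c v f) p q = bic (del E v) c p q"
  by (auto simp: bic_def del_def)

lemma seen_paint: "seen (del E v) (paint c v f) x = seen (del E v) c x"
  by (rule seen_cong) (auto simp: del_def)

lemma coloring_cong:
  assumes "coloring E k c" "\<And>e. e \<in> E \<Longrightarrow> c e = c' e"
  shows "coloring E k c'"
proof -
  have "{e \<in> E. c e = i \<or> c e = j} = {e \<in> E. c' e = i \<or> c' e = j}" for i j
    using assms(2) by auto
  then show ?thesis
    using assms by (simp add: coloring_def acyclic_edge_coloring_def proper_edge_coloring_def)
qed

lemma coloring_vertex:
  assumes "graph E" "coloring (del E v) k c"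
    and "\<And>x. {v, x} \<in> E \<Longrightarrow> c {v, x} < k" "\<And>x. {v, x} \<in> E \<Longrightarrow> c {v, x} \<notin> seen (del E v) c x"
    and "\<And>x y. {v, x} \<in> E \<Longrightarrow> {v, y} \<in> E \<Longrightarrow> x \<noteq> y \<Longrightarrow> c {v, x} \<noteq> c {v, y}"
    and "\<And>x y. {v, x} \<in> E \<Longrightarrow> {v, y} \<in> E \<Longrightarrow> x \<noteq> y \<Longrightarrow>
      \<not> chain (del E v) c (c {v, x}) (c {v, y}) x y"
  shows "coloring E k c"
  using assms aec_vertex_iff[OF assms(1), of k c v]
  unfolding coloring_def chain_def by blast

lemma coloring_paint:
  assumes "graph E" "coloring (del E v) k c"
    and "\<And>x. {v, x} \<in> E \<Longrightarrow> f x < k" "\<And>x. {v, x} \<in> E \<Longrightarrow> f x \<notin> seen (del E v) c x"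
    and "\<And>x y. {v, x} \<in> E \<Longrightarrow> {v, y} \<in> E \<Longrightarrow> x \<noteq> y \<Longrightarrow> f x \<noteq> f y"
    and "\<And>x y. {v, x} \<in> E \<Longrightarrow> {v, y} \<in> E \<Longrightarrow> x \<noteq> y \<Longrightarrow> \<not> chain (del E v) c (f x) (f y) x y"
  shows "coloring E k (paint c v f)"
proof (rule coloring_vertex[OF assms(1), of v])
  show "coloring (del E v) k (paint c v f)"
    by (rule coloring_cong[OF assms(2)]) (simp add: del_def)
qed (use assms in \<open>auto simp: seen_paint chain_cong[OF bic_paint]\<close>)

text \<open>Seen from \<open>w\<close> only one edge changes and \<open>del E w\<close> keeps its
  coloring. So a new cycle can only be closed by a chain that joins \<open>z\<close> to another
  neighbor \<open>y\<close> of \<open>w\<close> in \<open>i\<close> and the color of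
  \<open>w y\<close>.\<close>

lemma coloring_recolor:
  assumes "coloring E k c" "{w, z} \<in> E" "i < k" "i \<notin> seen E c w" "i \<notin> seen E c z"
    and "\<And>y. {w, y} \<in> E \<Longrightarrow> y \<noteq> z \<Longrightarrow> \<not> chain (del E w) c i (c {w, y}) z y"
  shows "coloring E k (c({w, z} := i))" (is "coloring E k ?c")
proof -
  interpret coloring E k c by fact
  have off: "?c e = c e" if "w \<notin> e" for e using that by auto
  have seen: "seen (del E w) ?c y = seen (del E w) c y" for y
    by (rule seen_cong) (auto simp: del_def)
  have bic: "bic (del E w) ?c p q = bic (del E w) c p q" for p q
    by (auto simp: bic_def del_def)
  show ?thesis
  proof (rule coloring_vertex[OF graph, of w])
    show "coloring (del E w) k ?c"
      by (rule coloring_cong[OF coloring_del]) (auto simp: del_def)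
    fix x assume x: "{w, x} \<in> E"
    show "?c {w, x} < k" using x assms color_bound by simp
    have "i \<notin> seen (del E w) c z" using assms(5) seen_mono[OF del_subset] by fast
    then show "?c {w, x} \<notin> seen (del E w) ?c x"
      using vertex_iff(1)[OF x] by (auto simp: seen doubleton_eq_iff)
    fix y assume y: "{w, y} \<in> E" "x \<noteq> y"
    have "c {w, x} \<noteq> c {w, y}" "c {w, x} \<noteq> i" "c {w, y} \<noteq> i"
      using x y assms(4) nbr_eq seenI by metis+
    then show "?c {w, x} \<noteq> ?c {w, y}" using y by (auto simp: doubleton_eq_iff)
    have at: "?c {w, u} = (if u = z then i else c {w, u})" for u
      by (simp add: doubleton_eq_iff)
    show "\<not> chain (del E w) ?c (?c {w, x}) (?c {w, y}) x y"
    proof (cases "y = z")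
      case True
      then have *: "\<not> chain (del E w) c i (c {w, x}) z x" using assms(6)[OF x] y by auto
      have "\<not> chain (del E w) c (c {w, x}) i x z"
      proof
        assume "chain (del E w) c (c {w, x}) i x z"
        then have "chain (del E w) c i (c {w, x}) x z" by (subst chain_commute)
        from chain_sym[OF this] * show False by simp
      qed
      then show ?thesis
        unfolding chain_cong[OF bic] at using True y by simp
    next
      case False
      then show ?thesis
        unfolding chain_cong[OF bic] at using vertex_iff(2)[OF x y] assms(6)[OF y(1)] by auto
    qed
  qed
qed

text \<open>No chain in the two exchanged colors joins \<open>z\<close> and \<open>z'\<close>:
  outside \<open>w\<close>, the vertex \<open>z\<close> misses its old color because the coloring is
  proper, and its new color by assumption. Chains to third neighbors of \<open>w\<close> remain to
  be excluded.\<close>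

lemma coloring_swap:
  assumes "coloring E k c" "{w, z} \<in> E" "{w, z'} \<in> E" "z \<noteq> z'"
    and "c {w, z'} \<notin> seen E c z" "c {w, z} \<notin> seen E c z'"
    and "\<And>y. {w, y} \<in> E \<Longrightarrow> y \<noteq> z \<Longrightarrow> y \<noteq> z' \<Longrightarrow> \<not> chain (del E w) c (c {w, z'}) (c {w, y}) z y"
    and "\<And>y. {w, y} \<in> E \<Longrightarrow> y \<noteq> z \<Longrightarrow> y \<noteq> z' \<Longrightarrow> \<not> chain (del E w) c (c {w, z}) (c {w, y}) z' y"
  shows "coloring E k (c({w, z} := c {w, z'}, {w, z'} := c {w, z}))" (is "coloring E k ?c")
proof -
  interpret coloring E k c by fact
  have seen: "seen (del E w) ?c y = seen (del E w) c y" for y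
    by (rule seen_cong) (auto simp: del_def)
  have bic: "bic (del E w) ?c p q = bic (del E w) c p q" for p q
    by (auto simp: bic_def del_def)
  have sub: "seen (del E w) c y \<subseteq> seen E c y" for y by (rule seen_mono[OF del_subset])
  have at: "?c {w, y} = (if y = z then c {w, z'} else if y = z' then c {w, z} else c {w, y})" for y
    using assms(4) by (auto simp: doubleton_eq_iff)
  show ?thesis
  proof (rule coloring_vertex[OF graph, of w])
    show "coloring (del E w) k ?c"
      by (rule coloring_cong[OF coloring_del]) (auto simp: del_def)
    fix x assume x: "{w, x} \<in> E"
    show "?c {w, x} < k" using x assms color_bound by (simp add: at)
    show "?c {w, x} \<notin> seen (del E w) ?c x"
      unfolding at seen using vertex_iff(1)[OF x] assms(5,6) sub by auto
    fix y assume y: "{w, y} \<in> E" "x \<noteq> y"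
    have "c {w, u} = c {w, u'} \<longleftrightarrow> u = u'" if "{w, u} \<in> E" "{w, u'} \<in> E" for u u'
      using that nbr_eq by metis
    then show "?c {w, x} \<noteq> ?c {w, y}" unfolding at using x y assms(2-4) by auto
    have iso: "\<not> chain (del E w) c (c {w, z'}) (c {w, z}) z u" if "u \<noteq> z" for u
      using chain_seen(1)[of "del E w" c "c {w, z'}" "c {w, z}" z u] that assms(5) sub
        vertex_iff(1)[OF assms(2)] by blast
    let ?L = "chain (del E w) c"
    have mirror: "\<not> ?L q p v u" if "\<not> ?L p q u v" for p q u v
      using that by (blast intro: chain_flip)
    have z: "\<not> ?L (c {w, z'}) (c {w, u}) z u" "\<not> ?L (c {w, u}) (c {w, z'}) u z"
      "\<not> ?L (c {w, z}) (c {w, u}) z' u" "\<not> ?L (c {w, u}) (c {w, z}) u z'"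
      if "{w, u} \<in> E" "u \<noteq> z" "u \<noteq> z'" for u
      using assms(7,8)[OF that] mirror by blast+
    have z': "\<not> ?L (c {w, z}) (c {w, z'}) z' z"
      by (rule mirror[OF iso]) (use assms(4) in simp)
    show "\<not> chain (del E w) ?c (?c {w, x}) (?c {w, y}) x y"
      unfolding chain_cong[OF bic] at
      using vertex_iff(2)[OF x y] z[OF x] z[OF y(1)] z' iso[of z'] y(2) assms(4)
      by (auto split: if_splits)
  qed
qed

section \<open>Minimal uncolorable graphs\<close>

lemma degree_eq_nbrs:
  assumes "graph E"
  shows "degree E v = card {x. {v, x} \<in> E}"
proof -
  have "bij_betw (\<lambda>x. {v, x}) {x. {v, x} \<in> E} {e \<in> E. v \<in> e}"
    unfolding bij_betw_def
  proof
    show "inj_on (\<lambda>x. {v, x}) {x. {v, x} \<in> E}" by (auto simp: inj_on_def doubleton_eq_iff)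
    show "(\<lambda>x. {v, x}) ` {x. {v, x} \<in> E} = {e \<in> E. v \<in> e}"
    proof (intro equalityI subsetI)
      fix e assume "e \<in> {e \<in> E. v \<in> e}"
      then have e: "e \<in> E" "v \<in> e" by auto
      obtain x where "e = {v, x}" using graph_edge[OF assms e] .
      with e show "e \<in> (\<lambda>x. {v, x}) ` {x. {v, x} \<in> E}" by simp
    qed auto
  qed
  then show ?thesis by (simp add: degree_def bij_betw_same_card)
qed

lemma finite_Union_edges:
  assumes "graph E"
  shows "finite (\<Union>E)"
proof -
  have "finite e" if "e \<in> E" for e
    using assms that by (intro card_ge_0_finite) (simp add: graph_def)
  then show ?thesis using assms by (simp add: graph_def)
qed

lemma finite_nbrs:
  assumes "graph E"
  shows "finite {x. {v, x} \<in> E}"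
  by (rule finite_subset[OF _ finite_Union_edges[OF assms]]) auto

lemma exists_missing:
  assumes "finite A" "card A < k"
  obtains p where "p < k" "p \<notin> A"
proof -
  have "\<not> {..<k} \<subseteq> A" using card_mono[OF assms(1), of "{..<k}"] assms(2) by auto
  then show ?thesis using that by auto
qed

lemma missing_card:
  assumes "A \<subseteq> {..<k}"
  shows "card ({..<k} - A) + card A = k"
proof -
  have "card A \<le> k" using card_mono[OF _ assms] by simp
  then show ?thesis using card_Diff_subset[OF finite_subset[OF assms] assms] by simp
qed

lemma card_three_elements:
  assumes "card A = 3" "p \<in> A"
  obtains a b where "A = {p, a, b}" "p \<noteq> a" "p \<noteq> b" "a \<noteq> b"
proof -
  have "card (A - {p}) = 2" using assms by simp
  then obtain a b where "A - {p} = {a, b}" "a \<noteq> b" by (auto simp: card_2_iff)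
  with assms(2) that[of a b] show ?thesis by auto
qed

text \<open>\<open>M\<close> only bounds the degrees, so that the number \<open>M + 2\<close> of
  colors is the same for the graph and for all its subgraphs.\<close>

locale critical =
  fixes E :: "'a set set" and M :: nat
  assumes graph: "graph E"
    and degree_le: "degree E x \<le> M"
    and uncolorable: "\<not> coloring E (M + 2) c"
    and subcolorable: "F \<subset> E \<Longrightarrow> \<exists>c. coloring F (M + 2) c"
begin

abbreviation "H v \<equiv> del E v"
abbreviation "col F c \<equiv> coloring F (M + 2) c"
abbreviation "S v c x \<equiv> seen (H v) c x"

lemma edge_neq: "{v, x} \<in> E \<Longrightarrow> v \<noteq> x"
  using graph by (force simp: graph_def)

lemma card_S:
  assumes "col (H v) c" "{v, x} \<in> E"
  shows "Suc (card (S v c x)) = degree E x"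
proof -
  have "{e \<in> E. x \<in> e} = insert {v, x} {e \<in> H v. x \<in> e}"
  proof (intro equalityI subsetI)
    fix e assume "e \<in> {e \<in> E. x \<in> e}"
    then have e: "e \<in> E" "x \<in> e" by auto
    obtain y where "e = {x, y}" using graph_edge[OF graph e] .
    with e edge_neq[OF assms(2)] show "e \<in> insert {v, x} {e \<in> H v. x \<in> e}"
      by (auto simp: del_def)
  qed (use assms(2) edge_neq[OF assms(2)] in \<open>auto simp: del_def\<close>)
  moreover have "{v, x} \<notin> {e \<in> H v. x \<in> e}" by (auto simp: del_def)
  moreover have "finite {e \<in> H v. x \<in> e}" using graph_del[OF graph, of v] by (simp add: graph_def)
  ultimately show ?thesis using coloring.card_seen[OF assms(1)] by (simp add: degree_def)
qed

lemma finite_S: "finite (S v c x)"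
  by (rule finite_seen[OF graph_del[OF graph]])

lemma card_S_less:
  assumes "col (H v) c" "{v, x} \<in> E"
  shows "card (S v c x) < M"
  using card_S[OF assms] degree_le[of x] by simp

lemma card_add_le:
  assumes "A \<union> B \<subseteq> S v c x" "A \<inter> B = {}"
  shows "card A + card B \<le> card (S v c x)"
proof -
  have "finite A" "finite B" using finite_subset[OF _ finite_S] assms(1) by auto
  then have "card A + card B = card (A \<union> B)" using assms(2) by (simp add: card_Un_disjoint)
  also have "\<dots> \<le> card (S v c x)" using assms(1) by (intro card_mono finite_S)
  finally show ?thesis .
qed

lemma S_bound: "col (H v) c \<Longrightarrow> S v c x \<subseteq> {..<M + 2}"
  by (rule coloring.seen_bound)

text \<open>Otherwise \<open>paint\<close> would extend the coloring of \<open>H v\<close> to all of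
  \<open>E\<close>.\<close>

lemma exists_chain:
  assumes "col (H v) c" "\<And>x. {v, x} \<in> E \<Longrightarrow> f x < M + 2" "\<And>x. {v, x} \<in> E \<Longrightarrow> f x \<notin> S v c x"
    and "\<And>x y. {v, x} \<in> E \<Longrightarrow> {v, y} \<in> E \<Longrightarrow> x \<noteq> y \<Longrightarrow> f x \<noteq> f y"
  shows "\<exists>x y. {v, x} \<in> E \<and> {v, y} \<in> E \<and> x \<noteq> y \<and> chain (H v) c (f x) (f y) x y"
  using coloring_paint[OF graph assms] uncolorable by blast

section \<open>Extending a coloring to a vertex of degree three or two\<close>

definition three :: "'a \<Rightarrow> 'a \<Rightarrow> 'a \<Rightarrow> 'a \<Rightarrow> bool" where
  "three v x y z \<longleftrightarrow> {u. {v, u} \<in> E} = {x, y, z} \<and> x \<noteq> y \<and> x \<noteq> z \<and> y \<noteq> z"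

text \<open>\<open>p\<close> and \<open>q\<close> can color \<open>v x\<close> and \<open>v y\<close> while the third edge at \<open>v\<close> stays uncolored.\<close>

definition ok :: "'a \<Rightarrow> ('a set \<Rightarrow> nat) \<Rightarrow> 'a \<Rightarrow> 'a \<Rightarrow> nat \<Rightarrow> nat \<Rightarrow> bool" where
  "ok v c x y p q \<longleftrightarrow> p < M + 2 \<and> q < M + 2 \<and> p \<notin> S v c x \<and> q \<notin> S v c y \<and> p \<noteq> q \<and>
    \<not> chain (H v) c p q x y"

lemma ok_sym: "ok v c x y p q \<Longrightarrow> ok v c y x q p"
  unfolding ok_def by (blast intro: chain_flip)

lemma three_edges:
  assumes "three v x y z"
  shows "{v, x} \<in> E" "{v, y} \<in> E" "{v, z} \<in> E"
  using assms by (auto simp: three_def)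

lemma three_neq:
  assumes "three v x y z"
  shows "v \<noteq> x" "v \<noteq> y" "v \<noteq> z" "x \<noteq> y" "x \<noteq> z" "y \<noteq> z"
  using assms edge_neq[OF three_edges(1)[OF assms]] edge_neq[OF three_edges(2)[OF assms]]
    edge_neq[OF three_edges(3)[OF assms]] by (auto simp: three_def)

lemma three_swap: "three v x y z \<Longrightarrow> three v y x z"
  by (auto simp: three_def)

lemma three_rot: "three v x y z \<Longrightarrow> three v x z y"
  by (auto simp: three_def)

text \<open>Color \<open>v z\<close> with \<open>r\<close>. Some bichromatic cycle must arise, and
  since \<open>p\<close> and \<open>q\<close> close none through \<open>v x\<close> and
  \<open>v y\<close>, it uses \<open>v z\<close> and one of these two edges.\<close>

lemma key3:
  assumes "three v x y z" "col (H v) c" "ok v c x y p q"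
    and "r < M + 2" "r \<notin> S v c z" "r \<noteq> p" "r \<noteq> q"
  shows "chain (H v) c p r x z \<or> chain (H v) c q r y z"
proof -
  define f where "f = (\<lambda>u. if u = x then p else if u = y then q else r)"
  have nb: "{v, u} \<in> E \<longleftrightarrow> u = x \<or> u = y \<or> u = z" for u
    using assms(1) by (auto simp: three_def)
  have d: "x \<noteq> y" "x \<noteq> z" "y \<noteq> z" using three_neq[OF assms(1)] by auto
  have f: "f x = p" "f y = q" "f z = r" using d by (auto simp: f_def)
  have "\<exists>u u'. {v, u} \<in> E \<and> {v, u'} \<in> E \<and> u \<noteq> u' \<and> chain (H v) c (f u) (f u') u u'"
    by (rule exists_chain[OF assms(2)])
      (use assms(3-) d in \<open>auto simp: nb ok_def f\<close>)
  then obtain u u' where u: "u \<noteq> u'" "{v, u} \<in> E" "{v, u'} \<in> E" "chain (H v) c (f u) (f u') u u'"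
    by blast
  moreover have "\<not> chain (H v) c q p y x" "\<not> chain (H v) c p q x y"
    using assms(3) by (auto simp: ok_def dest: chain_flip)
  moreover have "chain (H v) c p r x z" if "chain (H v) c r p z x"
    using that by (rule chain_flip)
  moreover have "chain (H v) c q r y z" if "chain (H v) c r q z y"
    using that by (rule chain_flip)
  ultimately show ?thesis by (auto simp: nb f)
qed

text \<open>By minimality \<open>E\<close> without the edge \<open>v z\<close> has a coloring; its
  colors on \<open>v x\<close> and \<open>v y\<close> form the pair.\<close>

lemma exists_ok:
  assumes "three v x y z"
  obtains c p q where "col (H v) c" "ok v c x y p q"
proof -
  let ?F = "E - {{v, z}}"
  have e: "{v, x} \<in> ?F" "{v, y} \<in> ?F" "?F \<subset> E"
    using three_edges[OF assms] three_neq[OF assms] by (auto simp: doubleton_eq_iff)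
  obtain c where c: "col ?F c" using subcolorable[OF e(3)] by blast
  interpret coloring ?F "M + 2" c by fact
  have [simp]: "del ?F v = H v" by (auto simp: del_def)
  have "ok v c x y (c {v, x}) (c {v, y})"
    unfolding ok_def
    using vertex_iff(1)[OF e(1)] vertex_iff(1)[OF e(2)] vertex_iff(2)[OF e(1,2)]
      color_bound[OF e(1)] color_bound[OF e(2)] nbr_eq[OF e(1,2)] three_neq[OF assms]
    by auto
  then show ?thesis using that[of c] coloring_del[of v] by simp
qed

lemma key2:
  assumes "{u. {v, u} \<in> E} = {x, y}" "x \<noteq> y" "col (H v) c"
    and "p < M + 2" "q < M + 2" "p \<notin> S v c x" "q \<notin> S v c y" "p \<noteq> q"
  shows "chain (H v) c p q x y"
proof -
  define f where "f = (\<lambda>u. if u = x then p else q)"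
  have nb: "{v, u} \<in> E \<longleftrightarrow> u = x \<or> u = y" for u
    using assms(1) by auto
  have f: "f x = p" "f y = q" using assms(2) by (auto simp: f_def)
  have "\<exists>u u'. {v, u} \<in> E \<and> {v, u'} \<in> E \<and> u \<noteq> u' \<and> chain (H v) c (f u) (f u') u u'"
    by (rule exists_chain[OF assms(3)]) (use assms in \<open>auto simp: nb f\<close>)
  then show ?thesis by (auto simp: nb f dest: chain_flip)
qed

lemma degree_ge_2:
  assumes "{v, x} \<in> E"
  shows "2 \<le> degree E v"
proof (rule ccontr)
  assume "\<not> 2 \<le> degree E v"
  then have "card {u. {v, u} \<in> E} \<le> 1" by (simp add: degree_eq_nbrs[OF graph])
  then have nb: "{v, u} \<in> E \<longleftrightarrow> u = x" for u
    using assms card_le_Suc0_iff_eq[OF finite_nbrs[OF graph, of v]] by auto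
  have "H v \<subset> E" using assms by (auto simp: del_def)
  then obtain c where c: "col (H v) c" using subcolorable by blast
  obtain p where p: "p < M + 2" "p \<notin> S v c x"
    by (rule exists_missing[of "S v c x" "M + 2"]) (use finite_S card_S_less[OF c assms] in auto)
  have "\<exists>u u'. {v, u} \<in> E \<and> {v, u'} \<in> E \<and> u \<noteq> u' \<and> chain (H v) c p p u u'"
    by (rule exists_chain[OF c]) (use p nb in auto)
  then show False using nb by auto
qed

lemma degree_seen_le:
  assumes "coloring F (M + 2) c" "F \<subseteq> E"
  shows "card (seen F c x) \<le> degree E x"
  using coloring.card_seen[OF assms(1)] degree_mono[of E F x] assms(2) graph
  by (simp add: graph_def)

lemma card_le_degree:
  assumes "coloring F (M + 2) c" "F \<subseteq> E" "A \<subseteq> seen F c x"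
  shows "card A \<le> degree E x"
proof -
  have "graph F" using assms(1) by (rule coloring.graph)
  then show ?thesis
    using card_mono[OF finite_seen[of F] assms(3)] degree_seen_le[OF assms(1,2), of x] by simp
qed

section \<open>Neighbors of vertices of degree two and three\<close>

abbreviation miss :: "'a \<Rightarrow> ('a set \<Rightarrow> nat) \<Rightarrow> 'a \<Rightarrow> nat set" where
  "miss v c x \<equiv> {..<M + 2} - S v c x"

text \<open>Degree four is where the initial charge stops being negative.\<close>

definition big :: "'a \<Rightarrow> 'a set" where
  "big v = {x. {v, x} \<in> E \<and> 4 \<le> degree E x}"

lemma finite_big: "finite (big v)"
  using finite_nbrs[OF graph, of v] by (simp add: big_def)

text \<open>In \<open>H v\<close> the vertex \<open>x\<close> has lost the edge \<open>v x\<close>,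
  so it sees one color fewer than its degree out of \<open>M + 2\<close>. As degrees are at most
  \<open>M\<close>, at least three colors are missing.\<close>

lemma card_miss:
  assumes "col (H v) c" "{v, x} \<in> E"
  shows "card (miss v c x) + degree E x = M + 3"
  using missing_card[OF S_bound[OF assms(1), of x]] card_S[OF assms] by simp

text \<open>For every color \<open>q\<close> missing at \<open>x\<close> a chain in \<open>p\<close>
  and \<open>q\<close> joins \<open>w\<close> to \<open>x\<close>. Its last edge has color
  \<open>p\<close>, so it is the same edge \<open>x r\<close> for all these \<open>q\<close>, and
  \<open>r\<close> must see each of them.\<close>

lemma two_nbr:
  assumes nb: "{u. {v, u} \<in> E} = {w, x}" and "w \<noteq> x" and c: "col (H v) c"
    and p: "p \<in> miss v c w"
  obtains r where "{x, r} \<in> H v" "c {x, r} = p" "r \<noteq> w" "r \<noteq> v" "insert p (miss v c x) \<subseteq> S v c r"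
proof -
  interpret coloring "H v" "M + 2" c by fact
  have e: "{v, w} \<in> E" "{v, x} \<in> E" using nb by auto
  have ch: "chain (H v) c p q w x" if "q \<in> miss v c x" "q \<noteq> p" for q
    using key2[OF nb \<open>w \<noteq> x\<close> c, of p q] that p by auto
  have "2 \<le> card (miss v c x)" using card_miss[OF c e(2)] degree_le[of x] by simp
  have "p \<in> S v c x"
  proof (rule ccontr)
    assume px: "p \<notin> S v c x"
    have "card {p} < card (miss v c x)" using \<open>2 \<le> card (miss v c x)\<close> by simp
    then have "\<not> miss v c x \<subseteq> {p}" using card_mono[of "{p}" "miss v c x"] by auto
    then obtain q where q: "q \<in> miss v c x" "q \<noteq> p" by auto
    show False using chain_isolated'[of p "H v" c x q w] px q ch[OF q] \<open>w \<noteq> x\<close> by auto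
  qed
  then obtain r where r: "{x, r} \<in> H v" "c {x, r} = p" "r \<noteq> x"
    using seenE[OF graph] by metis
  have rw: "r \<noteq> w" using r p seenI[of w x "H v" c p] by (auto simp: insert_commute)
  have "q \<in> S v c r" if "q \<in> miss v c x" for q
    using chain_nbr_at(2)[OF ch[OF that] \<open>w \<noteq> x\<close> _ _ r(1,2)] that p \<open>p \<in> S v c x\<close> by auto
  moreover have "p \<in> S v c r" using r seenI[of r x "H v" c p] by (simp add: insert_commute)
  moreover have "r \<noteq> v" using r by (auto simp: del_def)
  ultimately show ?thesis using that r rw by blast
qed

lemma two_nbr_big:
  assumes nb: "{u. {v, u} \<in> E} = {w, x}" and "w \<noteq> x" and c: "col (H v) c"
  shows "miss v c w \<subseteq> (\<lambda>r. c {x, r}) ` (big x - {v})"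
proof
  fix p assume p: "p \<in> miss v c w"
  have e: "{v, x} \<in> E" using nb by auto
  obtain r where r: "{x, r} \<in> H v" "c {x, r} = p" "r \<noteq> w" "r \<noteq> v"
    "insert p (miss v c x) \<subseteq> S v c r"
    using two_nbr[OF assms p] .
  have "p \<notin> miss v c x"
    using r(1,2) seenI[of x r "H v" c p] by auto
  then have "Suc (card (miss v c x)) \<le> degree E r"
    using card_le_degree[OF c del_subset r(5)] by simp
  then have "r \<in> big x" using card_miss[OF c e] degree_le[of x] r(1)
    by (auto simp: big_def del_def)
  with r show "p \<in> (\<lambda>r. c {x, r}) ` (big x - {v})" by auto
qed

text \<open>Each of the at least three colors missing at \<open>w\<close> appears on its own edge
  from \<open>x\<close> to a vertex of \<open>big x\<close>.\<close>

lemma card_big_two_nbr: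
  assumes nb: "{u. {v, u} \<in> E} = {w, x}" and "w \<noteq> x"
  shows "3 \<le> card (big x)"
proof -
  have e: "{v, w} \<in> E" "{v, x} \<in> E" using nb by auto
  have "H v \<subset> E" using e by (auto simp: del_def)
  then obtain c where c: "col (H v) c" using subcolorable by blast
  have "3 \<le> card (miss v c w)" using card_miss[OF c e(1)] degree_le[of w] by simp
  also have "card (miss v c w) \<le> card ((\<lambda>r. c {x, r}) ` (big x - {v}))"
    using two_nbr_big[OF assms c] finite_big by (intro card_mono) auto
  also have "\<dots> \<le> card (big x - {v})" using finite_big by (intro card_image_le) auto
  also have "\<dots> \<le> card (big x)" using finite_big by (intro card_mono) auto
  finally show ?thesis .
qed

text \<open>Of the two chains offered by \<open>key3\<close>, the one in \<open>q\<close> and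
  \<open>r\<close> cannot reach \<open>w\<close>, where both colors are missing.\<close>

lemma key_one:
  assumes t: "three v x y w" and c: "col (H v) c" and "ok v c x y p q" "q \<notin> S v c w"
    and "r \<in> miss v c w" "r \<noteq> p" "r \<noteq> q"
  shows "chain (H v) c p r x w" "r \<in> S v c x"
proof -
  show *: "chain (H v) c p r x w"
    using key3[OF t c assms(3), of r] assms(4-)
      chain_isolated'[of q "H v" c w r y] three_neq[OF t] by auto
  show "r \<in> S v c x" using chain_seen(1)[OF *] three_neq[OF t] assms(3) by (auto simp: ok_def)
qed

text \<open>The chain from \<open>x\<close> already ends at \<open>w\<close>, so it cannot also end
  at \<open>y\<close>.\<close>

lemma ok_end:
  assumes t: "three v x y w" and c: "col (H v) c"
    and "chain (H v) c p q x w" "p \<notin> S v c x" "q \<notin> S v c y" "q \<notin> S v c w"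
    and "p < M + 2" "q < M + 2" "p \<noteq> q"
  shows "ok v c x y p q"
  using coloring.chain_ends[OF c assms(3), of y] three_neq[OF t] assms(4-)
  by (auto simp: ok_def)

lemma ok_isolated:
  assumes "three v x y w" "p \<notin> S v c x" "q \<notin> S v c x" "q \<notin> S v c y"
    and "p < M + 2" "q < M + 2" "p \<noteq> q"
  shows "ok v c x y p q"
  using chain_isolated[of p "H v" c x q y] three_neq[OF assms(1)] assms(2-)
  by (auto simp: ok_def)

text \<open>If \<open>y\<close> missed another such color \<open>r\<close>, then \<open>p\<close>
  could be paired with \<open>r\<close>, and \<open>key_one\<close> with \<open>q\<close> and
  \<open>r\<close> exchanged would make \<open>x\<close> see \<open>q\<close>. If \<open>y\<close>
  missed \<open>p\<close>, then \<open>q\<close> on \<open>v x\<close> and \<open>p\<close> on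
  \<open>v y\<close> would be a pair as well, and one chain in \<open>p\<close> and some
  \<open>r\<close> would join \<open>w\<close> to both \<open>x\<close> and
  \<open>y\<close>.\<close>

lemma one_common:
  assumes t: "three v x y w" and c: "col (H v) c" and o: "ok v c x y p q"
    and "p \<in> S v c w" "q \<in> miss v c w" "q \<notin> S v c x" "2 \<le> card (miss v c w)"
  shows "miss v c w - {q} \<subseteq> S v c x \<inter> S v c y" "p \<in> S v c y"
proof -
  interpret coloring "H v" "M + 2" c by fact
  have p: "p < M + 2" "p \<notin> S v c x" "p \<noteq> q" using o by (auto simp: ok_def)
  have ch: "chain (H v) c p r x w" "r \<in> S v c x" if "r \<in> miss v c w" "r \<noteq> q" for r
    using key_one[OF t c o] assms(4-) that by auto
  have "r \<in> S v c y" if r: "r \<in> miss v c w" "r \<noteq> q" for r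
  proof (rule ccontr)
    assume "r \<notin> S v c y"
    then have "ok v c x y p r" using ok_end[OF t c ch(1)[OF r]] p r assms(4) by auto
    then have "q \<in> S v c x" using key_one[OF t c, of p r q] r assms(5) p by auto
    then show False using assms(6) by simp
  qed
  then show "miss v c w - {q} \<subseteq> S v c x \<inter> S v c y" using ch by auto
  show "p \<in> S v c y"
  proof (rule ccontr)
    assume "p \<notin> S v c y"
    then have "ok v c x y q p" using ok_isolated[OF t, of q c p] p assms(5,6) by auto
    then have o': "ok v c y x p q" by (rule ok_sym)
    have "card {q} < card (miss v c w)" using assms(7) by simp
    then have "\<not> miss v c w \<subseteq> {q}" using card_mono[of "{q}" "miss v c w"] by auto
    then obtain r where r: "r \<in> miss v c w" "r \<noteq> q" by auto
    have "chain (H v) c p r y w"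
      using key_one[OF three_swap[OF t] c o', of r] r assms(4,5) p by auto
    with ch(1)[OF r] show False
      using chain_ends[of p r w x y] three_neq[OF t] p r \<open>p \<notin> S v c y\<close>
      by (auto dest: chain_sym)
  qed
qed

text \<open>The aim is a pair of which \<open>w\<close> sees exactly one color. If \<open>w\<close>
  misses both, \<open>key_one\<close> demands a chain that cannot reach \<open>w\<close>. If
  \<open>w\<close> sees both, one of them can be replaced by a color missing at \<open>w\<close> and
  at \<open>x\<close> or \<open>y\<close>. Which one depends on the coloring, hence the two
  symmetric alternatives.\<close>

lemma exists_mixed:
  assumes t: "three v x y w"
    and N: "\<And>c. col (H v) c \<Longrightarrow> 3 \<le> card (miss v c w)"
    and both: "\<And>c. col (H v) c \<Longrightarrow> \<not> (miss v c w \<subseteq> S v c x \<and> miss v c w \<subseteq> S v c y)"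
  obtains c p q where "col (H v) c" "ok v c x y p q" "p \<in> S v c w" "q \<in> miss v c w"
  | c p q where "col (H v) c" "ok v c y x p q" "p \<in> S v c w" "q \<in> miss v c w"
proof -
  obtain c p q where c: "col (H v) c" and o: "ok v c x y p q" using exists_ok[OF t] .
  interpret coloring "H v" "M + 2" c by fact
  have pq: "p < M + 2" "q < M + 2" "p \<noteq> q" "p \<notin> S v c x" "q \<notin> S v c y" using o by (auto simp: ok_def)
  have neq: "x \<noteq> w" "y \<noteq> w" using three_neq[OF t] by auto
  consider "p \<in> S v c w" "q \<notin> S v c w" | "p \<notin> S v c w" "q \<in> S v c w"
    | "p \<notin> S v c w" "q \<notin> S v c w" | "p \<in> S v c w" "q \<in> S v c w" by blast
  then show ?thesis
  proof cases
    case 1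
    then show ?thesis using that(1)[OF c o] pq by auto
  next
    case 2
    then show ?thesis using that(2)[OF c ok_sym[OF o]] pq by auto
  next
    case 3
    have "card {p, q} < card (miss v c w)" using N[OF c] pq by simp
    then have "\<not> miss v c w \<subseteq> {p, q}" using card_mono[of "{p, q}" "miss v c w"] by auto
    then obtain r where r: "r \<in> miss v c w" "r \<noteq> p" "r \<noteq> q" by auto
    then have "chain (H v) c p r x w" using key_one[OF t c o] 3 by auto
    then show ?thesis using chain_isolated'[of p "H v" c w r x] 3 neq r by auto
  next
    case 4
    then obtain r where r: "r \<in> miss v c w" "r \<notin> S v c x \<or> r \<notin> S v c y" using both[OF c] by blast
    have rpq: "r \<noteq> p" "r \<noteq> q" using r 4 by auto
    note k = key3[OF t c o, of r]
    show ?thesis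
    proof (cases "r \<in> S v c x")
      case False
      then have "chain (H v) c q r y w"
        using k r rpq chain_isolated[of p "H v" c x r w] pq neq by auto
      then have "ok v c y x q r" using ok_end[OF three_swap[OF t] c] pq r False rpq by auto
      then show ?thesis using that(2)[OF c] 4 r by blast
    next
      case True
      then have "r \<notin> S v c y" using r by simp
      then have "chain (H v) c p r x w"
        using k r rpq chain_isolated[of q "H v" c y r w] pq neq by auto
      then have "ok v c x y p r" using ok_end[OF t c] pq r \<open>r \<notin> S v c y\<close> rpq by auto
      then show ?thesis using that(1)[OF c] 4 r by blast
    qed
  qed
qed

text \<open>With degree at most three, \<open>w\<close> would miss at least \<open>M\<close> colors,
  while \<open>x\<close> and \<open>y\<close> see at most \<open>M - 1\<close>. A mixed pair then
  makes \<open>y\<close> see \<open>p\<close> and all but one of the colors missing at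
  \<open>w\<close>, which is too many.\<close>

lemma three_nbr_ge_4:
  assumes t: "three v x y w"
  shows "4 \<le> degree E w"
proof (rule ccontr)
  assume "\<not> 4 \<le> degree E w"
  then have deg: "degree E w \<le> 3" by simp
  have e: "{v, x} \<in> E" "{v, y} \<in> E" "{v, w} \<in> E" using three_edges[OF t] by auto
  have "degree E v = 3"
    using t by (simp add: degree_eq_nbrs[OF graph] three_def)
  then have M: "3 \<le> M" using degree_le[of v] by simp
  have one: False if t: "three v x y w" and c: "col (H v) c" and o: "ok v c x y p q"
    and p: "p \<in> S v c w" and q: "q \<notin> S v c w" for x y c p q
  proof -
    let ?N = "miss v c w"
    have e: "{v, x} \<in> E" "{v, y} \<in> E" "{v, w} \<in> E" using three_edges[OF t] by auto
    have N: "M \<le> card ?N" using card_miss[OF c e(3)] deg by simp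
    have q: "q \<in> ?N" using q o by (auto simp: ok_def)
    have ch: "r \<in> S v c x" if "r \<in> ?N" "r \<noteq> q" for r
      using key_one[OF t c o] that p q by auto
    have fin: "finite ?N" by simp
    have qx: "q \<notin> S v c x"
    proof
      assume "q \<in> S v c x"
      then have "?N \<subseteq> S v c x" using ch by auto
      then show False using card_mono[OF finite_S, of ?N v c x] N card_S_less[OF c e(1)] by simp
    qed
    have "2 \<le> card ?N" using N M by simp
    note oc = one_common[OF t c o p q qx this]
    have "insert p (?N - {q}) \<subseteq> S v c y" using oc by auto
    then have "card (insert p (?N - {q})) \<le> card (S v c y)"
      by (intro card_mono finite_S)
    moreover have "card (insert p (?N - {q})) = card ?N"
      using p q card_Suc_Diff1[OF fin, of q] by (simp add: card_insert_if)
    ultimately show False using N card_S_less[OF c e(2)] by simp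
  qed
  show False
  proof (rule exists_mixed[OF t])
    fix c assume c: "col (H v) c"
    have N: "M \<le> card (miss v c w)" using card_miss[OF c e(3)] deg by simp
    then show "3 \<le> card (miss v c w)" using M by simp
    show "\<not> (miss v c w \<subseteq> S v c x \<and> miss v c w \<subseteq> S v c y)"
      using card_mono[OF finite_S, of "miss v c w" v c x] N card_S_less[OF c e(1)] by auto
  next
    fix c p q assume "col (H v) c" "ok v c x y p q" "p \<in> S v c w" "q \<in> miss v c w"
    then show False using one[OF t] by auto
  next
    fix c p q assume "col (H v) c" "ok v c y x p q" "p \<in> S v c w" "q \<in> miss v c w"
    then show False using one[OF three_swap[OF t]] by auto
  qed
qed

section \<open>Vertices of degree three with a neighbor of degree four\<close>

lemma miss_card_4:
  assumes "col (H v) c" "{v, w} \<in> E" "degree E w = 4"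
  shows "Suc (card (miss v c w)) = M" "card (S v c w) = 3" "4 \<le> M"
  using card_miss[OF assms(1,2)] card_S[OF assms(1,2)] assms(3) degree_le[of w] by simp_all

text \<open>The edges \<open>w z\<close> and \<open>w z'\<close> exchange their colors. A chain that entered \<open>w\<close> through \<open>z\<close>
  then ends in \<open>z\<close>, so that it can no longer block the third edge at \<open>v\<close>.\<close>

lemma swap_full:
  assumes t: "three v x y w" and c: "col (H v) c" and d: "degree E w = 4"
    and z: "{w, z} \<in> H v" "{w, z'} \<in> H v" "z \<noteq> z'"
    and full: "miss v c w \<subseteq> S v c z" "miss v c w \<subseteq> S v c z'"
    and "z \<noteq> x" "z \<noteq> y" "z' \<noteq> x" "z' \<noteq> y"
  defines "p \<equiv> c {w, z}" and "p' \<equiv> c {w, z'}"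
  obtains c' where "col (H v) c'"
    "\<And>u. u \<in> {x, y, w} \<Longrightarrow> S v c' u = S v c u"
    "\<And>i j. i \<notin> {p, p'} \<Longrightarrow> j \<notin> {p, p'} \<Longrightarrow> bic (H v) c' i j = bic (H v) c i j"
    "\<And>r. r \<in> miss v c w \<Longrightarrow> p \<notin> S v c x \<Longrightarrow> chain (H v) c p r x w \<Longrightarrow> \<not> chain (H v) c' p r x w"
    "\<And>r. r \<in> miss v c w \<Longrightarrow> p \<notin> S v c x \<Longrightarrow> r \<notin> S v c y \<Longrightarrow> chain (H v) c p r x w \<Longrightarrow>
      \<not> chain (H v) c' p r x y"
proof -
  interpret coloring "H v" "M + 2" c by fact
  have e: "{v, w} \<in> E" using three_edges[OF t] by simp
  let ?N = "miss v c w"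
  note N = miss_card_4[OF c e d]
  \<comment> \<open>These are already \<open>M\<close> colors, as many as the degree bound allows,
    so nothing else is seen at \<open>u\<close>.\<close>
  have full_eq: "S v c u = insert (c {w, u}) ?N" if u: "{w, u} \<in> H v" "?N \<subseteq> S v c u" for u
  proof -
    have "c {w, u} \<in> S v c u" "c {w, u} \<in> S v c w"
      using u seenI[of u w "H v" c] seenI[of w u "H v" c] by (auto simp: insert_commute)
    then have "insert (c {w, u}) ?N \<subseteq> S v c u" "card (insert (c {w, u}) ?N) = M"
      using u N by (auto simp: card_insert_if)
    moreover have "card (S v c u) \<le> M" using degree_seen_le[OF c del_subset, of u] degree_le[of u] by simp
    ultimately show ?thesis using card_subset_eq[OF finite_S] card_mono[OF finite_S] by (metis le_antisym)
  qed
  have Sz: "S v c z = insert p ?N" "S v c z' = insert p' ?N"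
    using full_eq z full by (auto simp: p_def p'_def)
  have pS: "p \<in> S v c w" "p' \<in> S v c w"
    using z seenI[of w z "H v" c] seenI[of w z' "H v" c] by (auto simp: p_def p'_def)
  have pp: "p \<noteq> p'" using nbr_eq[OF z(1,2)] z(3) by (auto simp: p_def p'_def)
  have wz: "w \<noteq> z" "w \<noteq> z'" using z no_loop by auto
  define c' where "c' = c({w, z} := p', {w, z'} := p)"
  have dS: "seen (del (H v) w) c z = ?N" "seen (del (H v) w) c z' = ?N"
    using seen_del[OF wz(1)] seen_del[OF wz(2)] z Sz pS by (auto simp: p_def p'_def)
  \<comment> \<open>Outside \<open>w\<close> the vertices \<open>z\<close> and \<open>z'\<close> see
    only colors missing at \<open>w\<close>, so no chain in two colors of \<open>S v c w\<close>
    starts there.\<close>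
  have iso: "\<not> chain (del (H v) w) c i (c {w, u}) s u"
    if "{w, u} \<in> H v" "s \<noteq> u" "s \<in> {z, z'}" "i \<in> {p, p'}" for u s i
    by (rule chain_isolated) (use that dS pS seenI[of w u "H v" c] in auto)
  have c': "col (H v) c'"
    unfolding c'_def p_def p'_def
    by (rule coloring_swap[OF c z])
      (use Sz pp pS iso in \<open>auto simp flip: p_def p'_def\<close>)
  have neq: "{w, z} \<noteq> {w, z'}" using z(3) by (auto simp: doubleton_eq_iff)
  have S': "S v c' u = S v c u" if "u \<in> {x, y, w}" for u
  proof (cases "u = w")
    case True
    have "c' {w, z} = p'" "c' {w, z'} = p" using neq by (auto simp: c'_def)
    then have "c' ` {e \<in> H v. w \<in> e} = c ` {e \<in> H v. w \<in> e}"
      using z(1,2) unfolding p_def p'_def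
      by (auto simp: c'_def image_iff p_def p'_def)
    then show ?thesis using True by (simp add: seen_def)
  next
    case False
    then show ?thesis
      using that assms(9-12) by (intro seen_cong) (auto simp: c'_def)
  qed
  have bic: "bic (H v) c' i j = bic (H v) c i j" if "i \<notin> {p, p'}" "j \<notin> {p, p'}" for i j
    using that by (auto simp: bic_def c'_def p_def p'_def split: if_splits)
  have bicd: "bic (del (H v) w) c' i j = bic (del (H v) w) c i j" for i j
    by (auto simp: bic_def c'_def del_def)
  interpret c': coloring "H v" "M + 2" c' by fact
  have 4: "\<not> chain (H v) c' p r x w" "r \<notin> S v c y \<Longrightarrow> \<not> chain (H v) c' p r x y"
    if r: "r \<in> ?N" and px: "p \<notin> S v c x" and ch: "chain (H v) c p r x w" for r
  proof -
    have xw: "x \<noteq> w" "x \<noteq> y" using three_neq[OF t] by auto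
    have xz: "chain (del (H v) w) c p r x z"
      using chain_nbr_at(3)[OF ch xw(1) _ px z(1)] r by (auto simp: p_def)
    have pd: "p \<notin> seen (del (H v) w) c x" using px seen_mono[OF del_subset] by fast
    \<comment> \<open>The new chain would reach \<open>w\<close> through \<open>z'\<close>, as the
      old one did through \<open>z\<close>; but outside \<open>w\<close> the vertices
      \<open>x\<close>, \<open>z\<close> and \<open>z'\<close> all miss \<open>p\<close>.\<close>
    show "\<not> chain (H v) c' p r x w"
    proof
      assume ch': "chain (H v) c' p r x w"
      have "c' {w, z'} = p" by (simp add: c'_def)
      then have "chain (del (H v) w) c' p r x z'"
        using c'.chain_nbr_at(3)[OF ch' xw(1) _ _ z(2)] r px S'[of w] S'[of x] by auto
      then have xz': "chain (del (H v) w) c p r x z'" using chain_cong[OF bicd] by blast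
      have "p \<notin> ?N" using pS by auto
      then show False
        using coloring.chain_ends[OF coloring_del xz xz'] assms(9-12) z(3) pd dS by auto
    qed
    assume ry: "r \<notin> S v c y"
    \<comment> \<open>After the exchange \<open>z\<close> misses \<open>p\<close> and is the end of
      the chain from \<open>x\<close>, so \<open>y\<close> is not.\<close>
    show "\<not> chain (H v) c' p r x y"
    proof
      assume ch': "chain (H v) c' p r x y"
      have "chain (del (H v) w) c' p r x z" using xz chain_cong[OF bicd] by blast
      then have xz': "chain (H v) c' p r x z" by (rule chain_subset[OF _ del_subset])
      have "p \<notin> seen (H v) c' z"
      proof
        assume "p \<in> seen (H v) c' z"
        then obtain u where u: "{z, u} \<in> H v" "c' {z, u} = p" using seenE[OF graph] by metis
        have "c {z, u} \<noteq> p \<or> {z, u} = {w, z}"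
          using color_eq[OF u(1) z(1), of z] by (auto simp: p_def)
        then show False using u(2) neq pp z(3) wz
          by (auto simp: c'_def doubleton_eq_iff split: if_splits)
      qed
      then show False
        using c'.chain_ends[OF ch' xz'] xw assms(9-12) px ry S'[of x] S'[of y] by auto
    qed
  qed
  show ?thesis by (rule that[of c', OF c' S' bic 4])
qed

text \<open>Here \<open>x\<close> misses all colors of \<open>S v c w\<close>, so any two of them
  form a pair for \<open>key3\<close>. One color cannot serve both \<open>x\<close> and
  \<open>y\<close>, since its chain would have three ends. With three colors at \<open>w\<close>
  only the two uniform alternatives remain.\<close>

lemma key_dichotomy:
  assumes t: "three v x y w" and c: "col (H v) c" and d: "degree E w = 4"
    and "S v c x = miss v c w" "S v c y = miss v c w" and r: "r \<in> miss v c w"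
  shows "(\<forall>p\<in>S v c w. chain (H v) c p r x w) \<or> (\<forall>p\<in>S v c w. chain (H v) c p r y w)"
proof -
  interpret coloring "H v" "M + 2" c by fact
  have e: "{v, w} \<in> E" using three_edges[OF t] by simp
  have disj: "chain (H v) c p r x w \<or> chain (H v) c q r y w"
    if "p \<in> S v c w" "q \<in> S v c w" "p \<noteq> q" for p q
  proof (rule key3[OF t c])
    show "ok v c x y p q"
      using ok_isolated[OF t, of p c q] that assms(4,5) seen_less by auto
  qed (use that r in auto)
  have excl: "\<not> (chain (H v) c p r x w \<and> chain (H v) c p r y w)" if "p \<in> S v c w" for p
    using chain_ends[of p r w x y] that assms(4,5) three_neq[OF t] r
    by (auto dest: chain_sym)
  have 3: "card (S v c w) = 3" using miss_card_4[OF c e d] by simp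
  then obtain p where p: "p \<in> S v c w" by fastforce
  obtain a b where "S v c w = {p, a, b}" "p \<noteq> a" "p \<noteq> b" "a \<noteq> b"
    using card_three_elements[OF 3 p] .
  then show ?thesis
    using disj[of p a] disj[of a p] disj[of p b] disj[of b p] disj[of a b] disj[of b a]
      excl[of p] excl[of a] excl[of b] by auto
qed

text \<open>Every neighbor of \<open>w\<close> in \<open>H v\<close> lies on a chain for each color
  missing at \<open>w\<close> and thus sees them all, so \<open>swap_full\<close> applies to two of
  the three colors at \<open>w\<close>. The exchange destroys the chain of one color and leaves that
  of the third intact, against the dichotomy.\<close>

lemma not_both_full:
  assumes t: "three v x y w" and c: "col (H v) c" and d: "degree E w = 4"
    and Sx: "S v c x = miss v c w" and Sy: "S v c y = miss v c w"
  shows False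
proof -
  have e: "{v, w} \<in> E" using three_edges[OF t] by simp
  have False if t: "three v x y w"
    and Sx: "S v c x = miss v c w" and Sy: "S v c y = miss v c w" and r: "r \<in> miss v c w"
    and ch: "\<And>p. p \<in> S v c w \<Longrightarrow> chain (H v) c p r x w" for x y r
  proof -
    interpret coloring "H v" "M + 2" c by fact
    have neq: "x \<noteq> w" "y \<noteq> w" using three_neq[OF t] by auto
    have full: "miss v c w \<subseteq> S v c z" "z \<noteq> x" "z \<noteq> y" if z: "{w, z} \<in> H v" for z
    proof -
      have p: "c {w, z} \<in> S v c w" using z seenI[of w z "H v" c] by auto
      show "miss v c w \<subseteq> S v c z"
      proof
        fix s assume s: "s \<in> miss v c w"
        show "s \<in> S v c z"
          using key_dichotomy[OF t c d Sx Sy s] p chain_nbr_at(2)[OF _ neq(1) _ _ z, of "c {w, z}" s]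
            chain_nbr_at(2)[OF _ neq(2) _ _ z, of "c {w, z}" s] s Sx Sy by auto
      qed
      show "z \<noteq> x" "z \<noteq> y" using p Sx Sy seenI[of z w "H v" c] z by (auto simp: insert_commute)
    qed
    have 3: "card (S v c w) = 3" using miss_card_4[OF c e d] by simp
    then obtain p where p: "p \<in> S v c w" by fastforce
    obtain a h where P: "S v c w = {p, a, h}" "p \<noteq> a" "p \<noteq> h" "a \<noteq> h"
      using card_three_elements[OF 3 p] .
    obtain z z' where z: "{w, z} \<in> H v" "c {w, z} = p" "{w, z'} \<in> H v" "c {w, z'} = a"
      using seenE[OF graph, of p c w] seenE[OF graph, of a c w] P by (metis insertI1 insertI2)
    have "z \<noteq> z'" using z P by auto
    obtain c' where c': "col (H v) c'" "\<And>u. u \<in> {x, y, w} \<Longrightarrow> S v c' u = S v c u"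
      "\<And>i j. i \<notin> {p, a} \<Longrightarrow> j \<notin> {p, a} \<Longrightarrow> bic (H v) c' i j = bic (H v) c i j"
      "\<And>r. r \<in> miss v c w \<Longrightarrow> p \<notin> S v c x \<Longrightarrow> chain (H v) c p r x w \<Longrightarrow> \<not> chain (H v) c' p r x w"
      using swap_full[OF t c d z(1,3) \<open>z \<noteq> z'\<close> full(1)[OF z(1)] full(1)[OF z(3)]] full(2,3) z
      by metis
    interpret c': coloring "H v" "M + 2" c' by fact
    have "\<not> chain (H v) c' p r x w" using c'(4)[OF r _ ch[OF p]] Sx p by auto
    then have "chain (H v) c' h r y w"
      using key_dichotomy[OF t c'(1) d, of r] c'(2)[of x] c'(2)[of y] c'(2)[of w] Sx Sy r P by auto
    moreover have "chain (H v) c' h r x w"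
      using ch[of h] P r chain_cong[OF c'(3)[of h r]] by auto
    ultimately show False
      using c'.chain_ends[of h r w x y] three_neq[OF t] c'(2)[of x] c'(2)[of y] c'(2)[of w] Sx Sy P r
      by (auto dest: chain_sym)
  qed
  note * = this
  have "card (miss v c w) \<noteq> 0" using miss_card_4[OF c e d] by linarith
  then have "miss v c w \<noteq> {}" by (metis card.empty)
  then obtain r where r: "r \<in> miss v c w" by auto
  show False
    using key_dichotomy[OF t c d Sx Sy r] *[OF t Sx Sy r] *[OF three_swap[OF t] Sy Sx r] by blast
qed

text \<open>The partner of \<open>p\<close> is replaced by a color \<open>q'\<close> missing at
  \<open>w\<close>; then \<open>key_one\<close> handles every \<open>r\<close> other than
  \<open>q'\<close>. For \<open>q'\<close> itself a different partner is used: another color missing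
  at \<open>w\<close> and \<open>y\<close>, or, if there is none, a color of \<open>S v c w\<close>
  that \<open>y\<close> misses because it sees too few colors.\<close>

lemma full_chain:
  assumes t: "three v x y w" and c: "col (H v) c" and d: "degree E w = 4"
    and Sx: "S v c x = miss v c w" and q: "q \<in> miss v c w - S v c y"
    and p: "p \<in> S v c w" and o: "ok v c x y p p'" and r: "r \<in> miss v c w"
  shows "chain (H v) c p r x w"
proof -
  interpret coloring "H v" "M + 2" c by fact
  have e: "{v, w} \<in> E" "{v, y} \<in> E" using three_edges[OF t] by simp_all
  have pk: "p < M + 2" "p \<notin> S v c x" using p seen_less Sx by auto
  have neq: "y \<noteq> w" using three_neq[OF t] by simp
  have "\<exists>q'. q' \<notin> S v c w \<and> ok v c x y p q'"
  proof (cases "p' \<in> S v c w")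
    case True
    have "\<not> chain (H v) c p' q y w"
      using chain_isolated[of p' "H v" c y q w] o q neq by (auto simp: ok_def)
    then have "chain (H v) c p q x w"
      using key3[OF t c o, of q] q p True by auto
    then have "ok v c x y p q" using ok_end[OF t c] pk q p by auto
    then show ?thesis using q by auto
  qed (use o in auto)
  then obtain q' where q': "q' \<notin> S v c w" "ok v c x y p q'" by blast
  then have q'N: "q' \<in> miss v c w" "q' \<notin> S v c y" by (auto simp: ok_def)
  show ?thesis
  proof (cases "r = q'")
    case False
    then show ?thesis using key_one(1)[OF t c q'(2,1)] r p by auto
  next
    case r: True
    show ?thesis
    proof (cases "\<exists>s\<in>miss v c w. s \<notin> S v c y \<and> s \<noteq> q'")
      case True
      then obtain s where s: "s \<in> miss v c w" "s \<notin> S v c y" "s \<noteq> q'" by blast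
      have "chain (H v) c p s x w" using key_one(1)[OF t c q'(2,1)] s p by auto
      then have "ok v c x y p s" using ok_end[OF t c] pk s p by auto
      then show ?thesis using key_one(1)[OF t c, of p s q'] s p q'N r by auto
    next
      case False
      then have sub: "miss v c w - {q'} \<subseteq> S v c y" by auto
      have 3: "card (S v c w) = 3" using miss_card_4[OF c e(1) d] by simp
      obtain a b where P: "S v c w = {p, a, b}" "p \<noteq> a" "p \<noteq> b" "a \<noteq> b"
        using card_three_elements[OF 3 p] .
      have "\<not> {a, b} \<subseteq> S v c y"
      proof
        assume "{a, b} \<subseteq> S v c y"
        with sub have "(miss v c w - {q'}) \<union> {a, b} \<subseteq> S v c y" by auto
        then have "card (miss v c w - {q'}) + card {a, b} \<le> card (S v c y)"
          using P by (intro card_add_le) auto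
        moreover have "Suc (card (miss v c w - {q'})) = card (miss v c w)"
          using q'N by (intro card_Suc_Diff1) auto
        ultimately show False
          using miss_card_4[OF c e(1) d] card_S_less[OF c e(2)] P by simp
      qed
      then obtain p'' where p'': "p'' \<in> S v c w" "p'' \<noteq> p" "p'' \<notin> S v c y"
        using P by auto
      then have "ok v c x y p p''"
        using ok_isolated[OF t, of p c p''] pk seen_less Sx by auto
      then have "chain (H v) c p q' x w \<or> chain (H v) c p'' q' y w"
        using key3[OF t c, of p p'' q'] q'N p p'' by auto
      then show ?thesis
        using chain_isolated[of p'' "H v" c y q' w] p'' q'N neq r by auto
    qed
  qed
qed

text \<open>If \<open>x\<close> missed \<open>q\<close>, it would also miss a second color
  \<open>p'\<close> of \<open>S v c w\<close> for lack of edges, and \<open>p'\<close> could replace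
  \<open>p\<close>. Then \<open>one_common\<close> for both makes \<open>y\<close> see
  \<open>M\<close> colors. Equality follows since \<open>x\<close> sees at most \<open>M - 1\<close>
  colors.\<close>

lemma core_Sx:
  assumes t: "three v x y w" and c: "col (H v) c" and d: "degree E w = 4"
    and o: "ok v c x y p q" and p: "p \<in> S v c w" and q: "q \<in> miss v c w"
  shows "S v c x = miss v c w"
proof -
  interpret coloring "H v" "M + 2" c by fact
  have e: "{v, w} \<in> E" "{v, y} \<in> E" "{v, x} \<in> E" using three_edges[OF t] by simp_all
  note N = miss_card_4[OF c e(1) d]
  have sub: "miss v c w - {q} \<subseteq> S v c x"
    using key_one(2)[OF t c o] p q by auto
  have cardq: "Suc (card (miss v c w - {q})) = card (miss v c w)"
    using q by (intro card_Suc_Diff1) auto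
  have "q \<in> S v c x"
  proof (rule ccontr)
    assume qx: "q \<notin> S v c x"
    have 3: "card (S v c w) = 3" using N by simp
    obtain a b where P: "S v c w = {p, a, b}" "p \<noteq> a" "p \<noteq> b" "a \<noteq> b"
      using card_three_elements[OF 3 p] .
    have "\<not> {a, b} \<subseteq> S v c x"
    proof
      assume "{a, b} \<subseteq> S v c x"
      with sub have "(miss v c w - {q}) \<union> {a, b} \<subseteq> S v c x" by auto
      then have "card (miss v c w - {q}) + card {a, b} \<le> card (S v c x)"
        using P by (intro card_add_le) auto
      then show False using N cardq card_S_less[OF c e(3)] P by simp
    qed
    then obtain p' where p': "p' \<in> S v c w" "p' \<noteq> p" "p' \<notin> S v c x" using P by auto
    have o': "ok v c x y p' q"
      using ok_isolated[OF t, of p' c q] p' qx o seen_less q by (auto simp: ok_def)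
    have 2: "2 \<le> card (miss v c w)" using N by simp
    note oc = one_common[OF t c o p q qx 2]
    have "insert p (insert p' (miss v c w - {q})) \<subseteq> S v c y"
      using oc one_common(2)[OF t c o' p'(1) q qx 2] by auto
    then have "card (insert p (insert p' (miss v c w - {q}))) \<le> card (S v c y)"
      by (intro card_mono finite_S)
    then show False using p p' N cardq card_S_less[OF c e(2)] by (simp add: card_insert_if)
  qed
  with sub have sub: "miss v c w \<subseteq> S v c x" by auto
  have "card (miss v c w) = card (S v c x)"
    using N card_S_less[OF c e(3)] card_mono[OF finite_S sub] by simp
  then show ?thesis using card_subset_eq[OF finite_S sub] by simp
qed

text \<open>Among the colors at \<open>w\<close> only \<open>p\<close> can be used on
  \<open>v x\<close> in a pair. With a second one, the neighbors of \<open>w\<close> along both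
  colors would see everything that \<open>w\<close> misses, and \<open>swap_full\<close> would
  destroy a chain that \<open>key_one\<close> enforces. The last two conclusions express this
  exclusion.\<close>

lemma core:
  assumes t: "three v x y w" and c: "col (H v) c" and d: "degree E w = 4"
    and o: "ok v c x y p q" and p: "p \<in> S v c w" and q: "q \<in> miss v c w"
  shows "S v c x = miss v c w" "\<And>r. r \<in> miss v c w \<Longrightarrow> chain (H v) c p r x w"
    "S v c w \<subseteq> S v c y"
    "\<And>p' r. p' \<in> S v c w \<Longrightarrow> p' \<noteq> p \<Longrightarrow> r \<in> miss v c w - S v c y \<Longrightarrow> chain (H v) c p' r x y"
proof -
  interpret coloring "H v" "M + 2" c by fact
  have e: "{v, w} \<in> E" "{v, y} \<in> E" "{v, x} \<in> E" using three_edges[OF t] by simp_all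
  have neq: "x \<noteq> w" "x \<noteq> y" using three_neq[OF t] by auto
  note N = miss_card_4[OF c e(1) d]
  show Sx: "S v c x = miss v c w" by (rule core_Sx[OF assms])
  have q': "q \<in> miss v c w - S v c y" using q o by (auto simp: ok_def)
  note full = full_chain[OF t c d Sx q']
  show ch: "chain (H v) c p r x w" if "r \<in> miss v c w" for r
    by (rule full[OF p o that])
  have no: "\<not> ok v c x y p' s" if p': "p' \<in> S v c w" "p' \<noteq> p" for p' s
  proof
    assume o': "ok v c x y p' s"
    obtain z where z: "{w, z} \<in> H v" "c {w, z} = p" using seenE[OF graph p] by metis
    obtain z' where z': "{w, z'} \<in> H v" "c {w, z'} = p'" using seenE[OF graph p'(1)] by metis
    have "z \<noteq> z'" using z z' p' by auto
    have sees: "r \<in> S v c z" "r \<in> S v c z'" "z \<noteq> x" "z' \<noteq> x" if "r \<in> miss v c w" for r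
      using chain_nbr_at(1,2)[OF ch[OF that] neq(1) _ _ z]
        chain_nbr_at(1,2)[OF full[OF p'(1) o' that] neq(1) _ _ z'] that Sx p p' by auto
    then have "z \<noteq> y" "z' \<noteq> y" "z \<noteq> x" "z' \<noteq> x" using q' by auto
    note sw = swap_full[OF t c d z(1) z'(1) \<open>z \<noteq> z'\<close>, unfolded z(2) z'(2)]
    obtain c' where c': "col (H v) c'" "\<And>u. u \<in> {x, y, w} \<Longrightarrow> S v c' u = S v c u"
      "\<And>r. r \<in> miss v c w \<Longrightarrow> p \<notin> S v c x \<Longrightarrow> chain (H v) c p r x w \<Longrightarrow> \<not> chain (H v) c' p r x w"
      "\<And>r. r \<in> miss v c w \<Longrightarrow> p \<notin> S v c x \<Longrightarrow> r \<notin> S v c y \<Longrightarrow> chain (H v) c p r x w \<Longrightarrow>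
        \<not> chain (H v) c' p r x y"
      by (rule sw) (use sees \<open>z \<noteq> y\<close> \<open>z' \<noteq> y\<close> \<open>z \<noteq> x\<close> \<open>z' \<noteq> x\<close> in auto)
    have px: "p \<notin> S v c x" using Sx p by simp
    have o2: "ok v c' x y p q"
      using c'(4)[OF q px _ ch[OF q]] o c'(2)[of x] c'(2)[of y] by (auto simp: ok_def)
    have "\<not> miss v c w \<subseteq> {q}"
      using card_mono[of "{q}" "miss v c w"] N by auto
    then obtain r where r: "r \<in> miss v c w" "r \<noteq> q" by auto
    have "chain (H v) c' p r x w"
      using key_one(1)[OF t c'(1) o2, of r] r p q c'(2)[of w] by auto
    then show False using c'(3)[OF r(1) px ch[OF r(1)]] by simp
  qed
  have 3: "card (S v c w) = 3" using N by simp
  obtain a b where P: "S v c w = {p, a, b}" "p \<noteq> a" "p \<noteq> b" "a \<noteq> b"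
    using card_three_elements[OF 3 p] .
  have "s \<in> S v c y" if "p' \<in> S v c w" "p' \<noteq> p" "s \<in> S v c w" "s \<noteq> p'" for p' s
  proof (rule ccontr)
    assume "s \<notin> S v c y"
    then have "ok v c x y p' s"
      using ok_isolated[OF t, of p' c s] that Sx seen_less by auto
    then show False using no that by blast
  qed
  from this[of a p] this[of a b] this[of b a] show "S v c w \<subseteq> S v c y" using P by auto
  fix p' r assume p': "p' \<in> S v c w" "p' \<noteq> p" and r: "r \<in> miss v c w - S v c y"
  show "chain (H v) c p' r x y"
    using no[OF p', of r] p' r Sx seen_less by (auto simp: ok_def)
qed

lemma exists_core:
  assumes t: "three v x y w" and d: "degree E w = 4"
  obtains c p q where "col (H v) c" "ok v c x y p q" "p \<in> S v c w" "q \<in> miss v c w"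
  | c p q where "col (H v) c" "ok v c y x p q" "p \<in> S v c w" "q \<in> miss v c w"
proof (rule exists_mixed[OF t])
  have e: "{v, w} \<in> E" "{v, y} \<in> E" "{v, x} \<in> E" using three_edges[OF t] by simp_all
  fix c assume c: "col (H v) c"
  note N = miss_card_4[OF c e(1) d]
  show "3 \<le> card (miss v c w)" using N by simp
  show "\<not> (miss v c w \<subseteq> S v c x \<and> miss v c w \<subseteq> S v c y)"
  proof
    assume sub: "miss v c w \<subseteq> S v c x \<and> miss v c w \<subseteq> S v c y"
    have "S v c u = miss v c w" if u: "u \<in> {x, y}" for u
    proof -
      have "{v, u} \<in> E" "miss v c w \<subseteq> S v c u" using u e sub by auto
      then have "card (miss v c w) = card (S v c u)"
        using N card_S_less[OF c] card_mono[OF finite_S, of "miss v c w" v c u] by fastforce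
      then show ?thesis using card_subset_eq[OF finite_S \<open>miss v c w \<subseteq> S v c u\<close>] by simp
    qed
    then show False using not_both_full[OF t c d] by simp
  qed
qed (use that in blast)+

lemma core_miss:
  assumes "S v c w \<subseteq> S v c y"
  shows "miss v c w - S v c y = miss v c y"
  using assms by auto

text \<open>If \<open>y\<close> had degree four, it would see exactly the colors seen at
  \<open>w\<close>, and \<open>core\<close> would apply with \<open>y\<close> and \<open>w\<close>
  exchanged too. One chain from \<open>x\<close> would then end at both.\<close>

lemma core_degree:
  assumes t: "three v x y w" and c: "col (H v) c" and d: "degree E w = 4"
    and o: "ok v c x y p q" and p: "p \<in> S v c w" and q: "q \<in> miss v c w"
  shows "5 \<le> degree E y" "degree E x = M"
proof -
  interpret coloring "H v" "M + 2" c by fact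
  have e: "{v, w} \<in> E" "{v, y} \<in> E" "{v, x} \<in> E" using three_edges[OF t] by simp_all
  note core_c = core[OF assms]
  note N = miss_card_4[OF c e(1) d]
  have neq: "x \<noteq> w" "x \<noteq> y" "y \<noteq> w" using three_neq[OF t] by auto
  show "degree E x = M" using card_S[OF c e(3)] core_c(1) N by simp
  have le: "3 \<le> card (S v c y)" using card_mono[OF finite_S core_c(3)] N by simp
  have "degree E y \<noteq> 4"
  proof
    assume d': "degree E y = 4"
    then have "card (S v c w) = card (S v c y)" using card_S[OF c e(2)] N by simp
    then have Sy: "S v c y = S v c w" using card_subset_eq[OF finite_S core_c(3)] by simp
    have 3: "card (S v c w) = 3" using N by simp
    obtain a b where P: "S v c w = {p, a, b}" "p \<noteq> a" "p \<noteq> b" "a \<noteq> b"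
      using card_three_elements[OF 3 p] .
    have ch: "chain (H v) c a q x y" "chain (H v) c b q x y"
      using core_c(4)[of a q] core_c(4)[of b q] P q Sy by auto
    have t': "three v x w y" by (rule three_rot[OF t])
    \<comment> \<open>\<open>y\<close> and \<open>w\<close> exchange their roles\<close>
    have o': "ok v c x w a q"
      using ok_end[OF t' c ch(1)] core_c(1) P q Sy seen_less[of a w] by auto
    have "chain (H v) c b q x w"
      using core(4)[OF t' c d' o', of b q] P q Sy by auto
    then show False
      using chain_ends[OF ch(2)] neq core_c(1) P q Sy by auto
  qed
  with le card_S[OF c e(2)] show "5 \<le> degree E y" by simp
qed

text \<open>Take a color missing at \<open>y\<close>, of which there are at least three, and the
  edge \<open>x r\<close> of this color. Together with any color of \<open>S v c w\<close> it forms
  a chain ending at \<open>x\<close>, which misses the latter color, so the chain comes through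
  \<open>r\<close>. Hence \<open>r\<close> sees the three colors of \<open>S v c w\<close> and that
  of \<open>x r\<close>.\<close>

lemma core_big_x:
  assumes t: "three v x y w" and c: "col (H v) c" and d: "degree E w = 4"
    and o: "ok v c x y p q" and p: "p \<in> S v c w" and q: "q \<in> miss v c w"
  shows "3 \<le> card (big x)"
proof -
  interpret coloring "H v" "M + 2" c by fact
  have e: "{v, w} \<in> E" "{v, y} \<in> E" "{v, x} \<in> E" using three_edges[OF t] by simp_all
  note core = core[OF assms]
  note N = miss_card_4[OF c e(1) d]
  have neq: "x \<noteq> w" "x \<noteq> y" "y \<noteq> w" using three_neq[OF t] by auto
  have "miss v c y \<subseteq> (\<lambda>r. c {x, r}) ` big x"
  proof
    fix s assume s: "s \<in> miss v c y"
    then have sw: "s \<in> miss v c w" "s \<in> S v c x" using core(1,3) by auto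
    then obtain r where r: "{x, r} \<in> H v" "c {x, r} = s" using seenE[OF graph, of s c x] by metis
    have "i \<in> S v c r" if i: "i \<in> S v c w" for i
    proof (cases "i = p")
      case True
      have "chain (H v) c s p w x" by (rule chain_flip[OF core(2)[OF sw(1)]])
      then show ?thesis
        using chain_nbr_at(2)[of s p w x r] neq core(1) sw p r True by auto
    next
      case False
      have "chain (H v) c s i y x"
        by (rule chain_flip[OF core(4)[OF i False]]) (use s sw in auto)
      then show ?thesis
        using chain_nbr_at(2)[of s i y x r] neq core(1) sw s i r by auto
    qed
    moreover have "s \<in> S v c r" using r seenI[of r x "H v" c] by (simp add: insert_commute)
    ultimately have "insert s (S v c w) \<subseteq> S v c r" by auto
    moreover have "card (insert s (S v c w)) = 4" using sw N finite_S by (simp add: card_insert_if)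
    ultimately have "4 \<le> degree E r" using card_le_degree[OF c del_subset] by metis
    then have "r \<in> big x" using r by (auto simp: big_def del_def)
    then show "s \<in> (\<lambda>r. c {x, r}) ` big x" using r by auto
  qed
  then have "card (miss v c y) \<le> card (big x)"
    using finite_big surj_card_le by metis
  then show ?thesis using card_miss[OF c e(2)] degree_le[of y] by simp
qed

text \<open>The chains in \<open>a\<close> from \<open>x\<close> to \<open>y\<close> enter
  \<open>y\<close> by its edge of color \<open>a\<close>, so the other end of this edge sees every
  color missing at \<open>y\<close>, at least three, and \<open>a\<close>.\<close>

lemma core_big_y:
  assumes t: "three v x y w" and c: "col (H v) c" and d: "degree E w = 4"
    and o: "ok v c x y p q" and p: "p \<in> S v c w" and q: "q \<in> miss v c w"
  shows "S v c w - {p} \<subseteq> (\<lambda>r. c {y, r}) ` big y" "2 \<le> card (big y)"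
    "\<And>a r. a \<in> S v c w \<Longrightarrow> a \<noteq> p \<Longrightarrow> {y, r} \<in> H v \<Longrightarrow> c {y, r} = a \<Longrightarrow> miss v c y \<subseteq> S v c r"
proof -
  interpret coloring "H v" "M + 2" c by fact
  have e: "{v, w} \<in> E" "{v, y} \<in> E" "{v, x} \<in> E" using three_edges[OF t] by simp_all
  note core = core[OF assms]
  note N = miss_card_4[OF c e(1) d]
  have neq: "x \<noteq> w" "x \<noteq> y" "y \<noteq> w" using three_neq[OF t] by auto
  show sees: "miss v c y \<subseteq> S v c r"
    if a: "a \<in> S v c w" "a \<noteq> p" and r: "{y, r} \<in> H v" "c {y, r} = a" for a r
  proof
    fix s assume s: "s \<in> miss v c y"
    then have "chain (H v) c a s x y" using core(4)[OF a] core_miss[OF core(3)] by auto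
    then show "s \<in> S v c r"
      using chain_nbr_at(2)[of a s x y r] neq core(1) s a r by auto
  qed
  show sub: "S v c w - {p} \<subseteq> (\<lambda>r. c {y, r}) ` big y"
  proof
    fix a assume a: "a \<in> S v c w - {p}"
    then have "a \<in> S v c y" using core(3) by auto
    then obtain r where r: "{y, r} \<in> H v" "c {y, r} = a" using seenE[OF graph, of a c y] by metis
    have "a \<in> S v c r" using r seenI[of r y "H v" c] by (simp add: insert_commute)
    then have "insert a (miss v c y) \<subseteq> S v c r" using sees[of a r] a r by auto
    moreover have "card (insert a (miss v c y)) = Suc (card (miss v c y))"
      using \<open>a \<in> S v c y\<close> by simp
    ultimately have "Suc (card (miss v c y)) \<le> degree E r"
      using card_le_degree[OF c del_subset] by metis
    then have "r \<in> big y" using card_miss[OF c e(2)] degree_le[of y] r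
      by (auto simp: big_def del_def)
    then show "a \<in> (\<lambda>r. c {y, r}) ` big y" using r by auto
  qed
  have "card (S v c w - {p}) = 2" using N p by simp
  moreover have "card (S v c w - {p}) \<le> card (big y)"
    using finite_big sub surj_card_le by metis
  ultimately show "2 \<le> card (big y)" by simp
qed

text \<open>Otherwise only the neighbors of \<open>y\<close> along the two colors of
  \<open>S v c w\<close> other than \<open>p\<close> are big, so the neighbors along
  \<open>p\<close> and along the fourth color \<open>z\<close> see at most three colors. Recolorings
  at \<open>y\<close> that keep a pair with \<open>p\<close> on \<open>v x\<close> determine the
  colors at three neighbors of \<open>y\<close>. A final exchange of \<open>p\<close> and
  \<open>a\<close> makes \<open>core\<close> demand a color that \<open>y1\<close> misses.\<close>

lemma core_degree_5:
  assumes t: "three v x y w" and c: "col (H v) c" and d: "degree E w = 4"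
    and o: "ok v c x y p q" and p: "p \<in> S v c w" and q: "q \<in> miss v c w"
    and dy: "degree E y = 5"
  shows "3 \<le> card (big y)"
proof (rule ccontr)
  assume small: "\<not> 3 \<le> card (big y)"
  interpret coloring "H v" "M + 2" c by fact
  have e: "{v, w} \<in> E" "{v, y} \<in> E" "{v, x} \<in> E" using three_edges[OF t] by simp_all
  note core_c = core[OF t c d o p q]
  note big = core_big_y[OF t c d o p q]
  note N = miss_card_4[OF c e(1) d]
  have neq: "x \<noteq> w" "x \<noteq> y" "y \<noteq> w" using three_neq[OF t] by auto
  have M: "5 \<le> M" using dy degree_le[of y] by simp
  let ?Q = "miss v c y"
  have cardQ: "card ?Q + 2 = M" using card_miss[OF c e(2)] dy by simp
  have px: "p \<notin> S v c x" using core_c(1) p by simp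
  have pk: "p < M + 2" using p seen_less by auto
  have 3: "card (S v c w) = 3" using N by simp
  obtain a b where P: "S v c w = {p, a, b}" "p \<noteq> a" "p \<noteq> b" "a \<noteq> b"
    using card_three_elements[OF 3 p] .
  have "card (S v c y - S v c w) = 1"
    using card_Diff_subset[OF finite_S core_c(3)] card_S[OF c e(2)] dy N by simp
  then obtain z where z: "S v c y - S v c w = {z}" by (auto simp: card_1_singleton_iff)
  then have Sy: "S v c y = {p, a, b, z}" "z \<notin> {p, a, b}" using core_c(3) P by auto
  have Sx: "S v c x = insert z ?Q"
    using core_c(1) Sy P seen_less[of z y] by auto
  obtain y1 where y1: "{y, y1} \<in> H v" "c {y, y1} = p" using seenE[OF graph, of p c y] Sy by blast
  obtain yz where yz: "{y, yz} \<in> H v" "c {y, yz} = z" using seenE[OF graph, of z c y] Sy by blast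
  obtain ya where ya: "{y, ya} \<in> H v" "c {y, ya} = a" using seenE[OF graph, of a c y] Sy by blast
  have ysz: "y1 \<noteq> yz" "y1 \<noteq> ya" "yz \<noteq> ya" using y1 yz ya Sy P by auto
  have ny: "u \<noteq> y" if "{y, u} \<in> H v" for u using that no_loop by auto
  have low: "degree E r \<le> 3" if r: "{y, r} \<in> H v" "c {y, r} \<in> {p, z}" for r
  proof (rule ccontr)
    assume "\<not> degree E r \<le> 3"
    then have "r \<in> big y" using r by (auto simp: big_def del_def)
    then have "insert (c {y, r}) (S v c w - {p}) \<subseteq> (\<lambda>r. c {y, r}) ` big y" using big(1) by auto
    then have "card (insert (c {y, r}) (S v c w - {p})) \<le> card (big y)"
      using finite_big surj_card_le by metis
    moreover have "c {y, r} \<notin> {a, b}" using r Sy P by auto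
    ultimately show False using small P by (simp add: card_insert_if insert_Diff_if)
  qed
  have low1: "card (S v c y1) \<le> 3" "card (S v c yz) \<le> 3"
    using low[of y1] low[of yz] y1 yz degree_seen_le[OF c del_subset, of y1]
      degree_seen_le[OF c del_subset, of yz] by auto
  have dx: "degree E x = M" using core_degree[OF t c d o p q] by simp
  have ne1: "y1 \<noteq> x" "y1 \<noteq> w" "yz \<noteq> x" "yz \<noteq> w"
    using low[of y1] low[of yz] y1 yz d dx M by auto
  \<comment> \<open>Otherwise \<open>y y1\<close> can be recolored with \<open>r\<close>: the chains
    in \<open>a\<close> or \<open>b\<close> and \<open>r\<close> that end at \<open>y\<close>
    already have their other end at \<open>x\<close>, and a chain in \<open>z\<close> and
    \<open>r\<close> to \<open>yz\<close> lacks a color at one end. Then \<open>y\<close> misses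
    \<open>p\<close>, against \<open>core\<close>.\<close>
  have ry1: "z \<in> S v c y1 \<and> r \<in> S v c yz" if r: "r \<in> ?Q" "r \<notin> S v c y1" for r
  proof (rule ccontr)
    assume bad: "\<not> (z \<in> S v c y1 \<and> r \<in> S v c yz)"
    let ?c = "c({y, y1} := r)"
    have c': "col (H v) ?c"
    proof (rule coloring_recolor[OF c y1(1)])
      fix u assume u: "{y, u} \<in> H v" "u \<noteq> y1"
      have cu: "c {y, u} \<in> S v c y" using u seenI by metis
      have "c {y, u} \<noteq> p" using nbr_eq[OF u(1) y1(1)] u(2) y1(2) by auto
      have du: "c {y, u} \<notin> seen (del (H v) y) c u" by (rule vertex_iff(1)[OF u(1)])
      have sub: "seen (del (H v) y) c s \<subseteq> S v c s" for s by (rule seen_mono[OF del_subset])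
      show "\<not> chain (del (H v) y) c r (c {y, u}) y1 u"
      proof
        assume ch: "chain (del (H v) y) c r (c {y, u}) y1 u"
        show False
        proof (cases "c {y, u} = z")
          case True
          then have "u = yz" using nbr_eq[OF u(1) yz(1)] yz by simp
          moreover have "z \<in> seen (del (H v) y) c y1"
            using chain_seen(1)[OF ch] u True r sub by auto
          moreover have "r \<in> seen (del (H v) y) c u"
            using chain_seen(2)[OF chain_sym[OF ch]] u du by auto
          ultimately show False using bad sub by auto
        next
          case False
          then have ab: "c {y, u} \<in> S v c w" "c {y, u} \<noteq> p"
            using cu Sy P \<open>c {y, u} \<noteq> p\<close> by auto
          have "chain (H v) c r (c {y, u}) y1 y"
            by (rule chain_trans[OF chain_subset[OF ch del_subset]])
              (rule chain_edge, use u in \<open>auto simp: insert_commute\<close>)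
          then have 1: "chain (H v) c (c {y, u}) r y y1" by (rule chain_flip)
          have 2: "chain (H v) c (c {y, u}) r y x"
            by (rule chain_sym[OF core_c(4)[OF ab]]) (use r core_miss[OF core_c(3)] in auto)
          show False using chain_ends[OF 1 2] ny[OF y1(1)] neq ne1 r core_c(1) ab by auto
        qed
      qed
    qed (use r in auto)
    have S': "S v ?c x = S v c x" "S v ?c w = S v c w"
      using neq ne1 by (auto intro!: seen_cong)
    have Sy': "s \<notin> S v ?c y" if "s \<noteq> r" "s = p \<or> s \<notin> S v c y" for s
      using seen_recolor[OF y1(1) that(1)] that(2) y1(2) by auto
    have "card {r} < card ?Q" using cardQ M by simp
    then have "\<not> ?Q \<subseteq> {r}" using card_mono[of "{r}" ?Q] by auto
    then obtain s where s: "s \<in> ?Q" "s \<noteq> r" by auto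
    have sw: "s \<in> miss v c w" using s core_c(3) by auto
    have "\<not> chain (H v) ?c p s x y"
    proof
      assume "chain (H v) ?c p s x y"
      then have "chain (H v) c p s x y"
        by (rule chain_mono) (use s r p Sy y1 in \<open>auto simp: bic_def split: if_splits\<close>)
      then show False using chain_ends[OF core_c(2)[OF sw]] neq px s sw by auto
    qed
    then have "ok v ?c x y p s"
      using S' px s sw p pk Sy'[of s] by (auto simp: ok_def)
    then have "p \<in> S v ?c y"
      using core(3)[OF t c' d, of p s] S' p sw by auto
    then show False using Sy'[of p] r Sy by auto
  qed
  have pz: "p \<in> S v c y1" "z \<in> S v c yz" "a \<in> S v c ya"
    using y1 yz ya seenI[of y1 y "H v" c] seenI[of yz y "H v" c] seenI[of ya y "H v" c]
    by (auto simp: insert_commute)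
  have QP: "p \<notin> ?Q" "z \<notin> ?Q" "a \<notin> ?Q" "b \<notin> ?Q" using Sy by auto
  have ne: "?Q - S v c y1 \<noteq> {}"
  proof
    assume "?Q - S v c y1 = {}"
    then have "insert p ?Q \<subseteq> S v c y1" using pz by auto
    then have "card (insert p ?Q) \<le> card (S v c y1)" by (intro card_mono finite_S)
    then show False using QP cardQ M low1 by simp
  qed
  then have z1: "z \<in> S v c y1" using ry1 by auto
  have "insert p (insert z (?Q \<inter> S v c y1)) \<subseteq> S v c y1" using pz z1 by auto
  then have A1: "card (insert p (insert z (?Q \<inter> S v c y1))) \<le> card (S v c y1)"
    by (intro card_mono finite_S)
  have A2: "card (insert p (insert z (?Q \<inter> S v c y1))) = 2 + card (?Q \<inter> S v c y1)"
    using QP Sy by simp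
  have sub_yz: "insert z (?Q - S v c y1) \<subseteq> S v c yz" using pz ry1 by auto
  then have "card (insert z (?Q - S v c y1)) \<le> card (S v c yz)" by (intro card_mono finite_S)
  moreover have A3: "card (insert z (?Q - S v c y1)) = Suc (card (?Q - S v c y1))" using QP by simp
  moreover have "card ?Q = card (?Q \<inter> S v c y1) + card (?Q - S v c y1)"
    using card_Int_Diff[of ?Q] by simp
  \<comment> \<open>\<open>?Q\<close> has at least three colors; \<open>y1\<close> has room for one
    of them besides \<open>p\<close> and \<open>z\<close>, and \<open>yz\<close> for two besides
    \<open>z\<close>.\<close>
  ultimately have eqs: "card (?Q \<inter> S v c y1) = 1" "card (?Q - S v c y1) = 2"
    "card (S v c y1) = 3" "card (S v c yz) = 3"
    using A1 A2 low1 cardQ M by auto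
  obtain s where s: "?Q \<inter> S v c y1 = {s}" using eqs(1) by (auto simp: card_1_singleton_iff)
  then have sQ: "s \<in> ?Q" "s \<in> S v c y1" by auto
  have Sy1: "S v c y1 = {p, z, s}"
    using card_subset_eq[OF finite_S \<open>insert p (insert z (?Q \<inter> S v c y1)) \<subseteq> S v c y1\<close>] A2 eqs s
    by simp
  have Syz: "S v c yz = insert z (?Q - S v c y1)"
    using card_subset_eq[OF finite_S sub_yz] A3 eqs by simp
  then have yz_miss: "p \<notin> S v c yz" "a \<notin> S v c yz" "b \<notin> S v c yz" "s \<notin> S v c yz"
    using QP Sy sQ by auto
  have y1_miss: "a \<notin> S v c y1" "b \<notin> S v c y1" using Sy1 P Sy sQ QP by auto
  obtain r where r: "r \<in> ?Q" "r \<notin> S v c y1" using ne by auto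
  have rs: "r \<noteq> s" using r sQ by auto
  have rw: "r \<in> miss v c w" using r core_c(3) by auto
  have sub: "seen (del (H v) y) c u \<subseteq> S v c u" for u by (rule seen_mono[OF del_subset])
  have cu: "c {y, u} \<in> {p, a, b, z}" if "{y, u} \<in> H v" for u using seenI[OF that, of c] Sy by auto
  have uniq: "c {y, u} = c {y, u'} \<longleftrightarrow> u = u'" if "{y, u} \<in> H v" "{y, u'} \<in> H v" for u u'
    using nbr_eq[OF that] by auto
  \<comment> \<open>The edge \<open>y yz\<close> can be recolored with \<open>s\<close>, since
    \<open>yz\<close> misses \<open>p\<close>, \<open>a\<close>, \<open>b\<close> and
    \<open>s\<close>. Then \<open>y\<close> misses \<open>z\<close>, and the chain in
    \<open>a\<close> and \<open>z\<close> required by \<open>core\<close> reaches \<open>y\<close>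
    through \<open>ya\<close>.\<close>
  have "z \<in> S v c ya"
  proof -
    let ?c = "c({y, yz} := s)"
    have c': "col (H v) ?c"
    proof (rule coloring_recolor[OF c yz(1)])
      fix u assume u: "{y, u} \<in> H v" "u \<noteq> yz"
      have "c {y, u} \<notin> S v c yz" using cu[OF u(1)] uniq[OF u(1) yz(1)] u yz yz_miss by auto
      then show "\<not> chain (del (H v) y) c s (c {y, u}) yz u"
        using yz_miss sub u by (intro chain_isolated) auto
    qed (use sQ yz_miss in auto)
    have S': "S v ?c x = S v c x" "S v ?c w = S v c w"
      using neq ne1 by (auto intro!: seen_cong)
    have Sy': "i \<notin> S v ?c y" if "i \<noteq> s" "i = z \<or> i \<notin> S v c y" for i
      using seen_recolor[OF yz(1) that(1)] that(2) yz(2) by auto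
    have bic: "bic (H v) ?c p r = bic (H v) c p r"
      using yz rs r Sy sQ by (auto simp: bic_def)
    have "\<not> chain (H v) c p r x y"
      using chain_ends[OF core_c(2)[OF rw]] neq px r rw by auto
    then have "ok v ?c x y p r"
      using S' px r rw p pk Sy'[of r] rs by (auto simp: ok_def chain_cong[OF bic])
    then have "chain (H v) ?c a z x y"
      using core(4)[OF t c' d, of p r a z] S' p rw P Sy sQ Sy'[of z] seen_less[of z y] by auto
    moreover have "?c {y, ya} = a" using ya ysz by (auto simp: doubleton_eq_iff)
    moreover have "z \<notin> S v ?c y" using Sy'[of z] sQ Sy by auto
    moreover have "a \<notin> S v ?c x" using S' core_c(1) P by simp
    ultimately have "z \<in> S v ?c ya"
      using coloring.chain_nbr_at(2)[OF c' _ neq(2) _ _ ya(1)] by metis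
    then obtain u where u: "{ya, u} \<in> H v" "?c {ya, u} = z"
      using seenE[OF graph, of z ?c ya] by metis
    then have "c {ya, u} = z" using sQ Sy by (auto split: if_splits)
    then show ?thesis using u seenI by metis
  qed
  moreover have "?Q \<subseteq> S v c ya" using big(3)[of a ya] P ya by auto
  ultimately have sub_ya: "insert a (insert z ?Q) \<subseteq> S v c ya" using pz by auto
  have card_ya: "card (insert a (insert z ?Q)) = M" using QP Sy cardQ by simp
  have "card (S v c ya) \<le> M" using degree_seen_le[OF c del_subset, of ya] degree_le[of ya] by simp
  then have "card (insert a (insert z ?Q)) = card (S v c ya)"
    using card_ya card_mono[OF finite_S sub_ya] by simp
  then have Sya: "S v c ya = insert a (insert z ?Q)"
    using card_subset_eq[OF finite_S sub_ya] by simp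
  then have ya_miss: "p \<notin> S v c ya" "b \<notin> S v c ya" using QP Sy P by auto
  have ne2: "ya \<noteq> x" "ya \<noteq> w" using pz(3) core_c(1) P Sya rw r by auto
  \<comment> \<open>\<open>ya\<close> misses \<open>p\<close> and \<open>y1\<close> misses
    \<open>a\<close>, so their edges to \<open>y\<close> can exchange colors. Afterwards chains
    along \<open>a\<close> enter \<open>y\<close> through \<open>y1\<close>.\<close>
  let ?c = "c({y, y1} := c {y, ya}, {y, ya} := c {y, y1})"
  have c': "col (H v) ?c"
  proof (rule coloring_swap[OF c y1(1) ya(1) ysz(2)])
    show "c {y, ya} \<notin> S v c y1" "c {y, y1} \<notin> S v c ya" using ya y1 y1_miss ya_miss by auto
    fix u assume u: "{y, u} \<in> H v" "u \<noteq> y1" "u \<noteq> ya"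
    have du: "c {y, u} \<notin> seen (del (H v) y) c u" by (rule vertex_iff(1)[OF u(1)])
    consider "c {y, u} = b" | "c {y, u} = z" "u = yz"
      using cu[OF u(1)] uniq[OF u(1) y1(1)] uniq[OF u(1) ya(1)] uniq[OF u(1) yz(1)] u y1 ya yz by auto
    then have "\<not> chain (del (H v) y) c a (c {y, u}) y1 u \<and> \<not> chain (del (H v) y) c p (c {y, u}) ya u"
    proof cases
      case 1
      then have "\<not> chain (del (H v) y) c a b y1 u" "\<not> chain (del (H v) y) c p b ya u"
        using y1_miss ya_miss sub u by (intro chain_isolated; auto)+
      then show ?thesis using 1 by simp
    next
      case 2
      then have "\<not> chain (del (H v) y) c a z y1 u" "\<not> chain (del (H v) y) c p z ya u"
        using yz_miss sub du ysz by (intro chain_isolated'; auto)+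
      then show ?thesis using 2 by simp
    qed
    then show "\<not> chain (del (H v) y) c (c {y, ya}) (c {y, u}) y1 u"
      "\<not> chain (del (H v) y) c (c {y, y1}) (c {y, u}) ya u" using y1 ya by auto
  qed
  have at: "?c {y, u} = (if u = y1 then a else if u = ya then p else c {y, u})" for u
    using y1 ya ysz by (auto simp: doubleton_eq_iff)
  have S': "S v ?c x = S v c x" "S v ?c w = S v c w"
    using neq ne1 ne2 by (auto intro!: seen_cong)
  have Sy': "i \<notin> S v ?c y" if i: "i \<in> ?Q" for i
  proof
    assume "i \<in> S v ?c y"
    then obtain u where u: "{y, u} \<in> H v" "?c {y, u} = i" using seenE[OF graph, of i ?c y] by metis
    show False using u(2) cu[OF u(1)] i QP unfolding at by (auto simp: Sy split: if_splits)
  qed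
  have "\<not> chain (H v) ?c p r x y"
  proof
    assume ch: "chain (H v) ?c p r x y"
    have "chain (del (H v) y) c p r x w"
      using chain_del[OF core_c(2)[OF rw]] neq px r rw by auto
    then have "chain (H v) ?c p r x w"
      by (rule chain_mono) (auto simp: bic_def del_def)
    then show False
      using coloring.chain_ends[OF c' ch] neq px S' rw Sy'[OF r(1)] by auto
  qed
  then have o': "ok v ?c x y p r" using S' px r rw p pk Sy'[of r] by (auto simp: ok_def)
  have "chain (H v) ?c a r x y"
    using core(4)[OF t c' d o', of a r] S' p rw P Sy'[of r] r by auto
  moreover have "?c {y, y1} = a" unfolding at by simp
  ultimately have "r \<in> S v ?c y1"
    using coloring.chain_nbr_at(2)[OF c' _ neq(2) _ _ y1(1)] S' core_c(1) P Sy'[OF r(1)] by auto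
  then obtain u where u: "{y1, u} \<in> H v" "?c {y1, u} = r" using seenE[OF graph, of r ?c y1] by metis
  have "c {y1, u} = r"
  proof (cases "u = y")
    case True
    then show ?thesis using u(2) at[of y1] r QP by (auto simp: insert_commute)
  next
    case False
    then show ?thesis using u(2) ny[OF y1(1)] by (auto simp: doubleton_eq_iff split: if_splits)
  qed
  then show False using r(2) u(1) seenI by metis
qed

text \<open>\<open>exists_core\<close> leaves open which of \<open>x\<close> and \<open>y\<close>
  plays which role, so the bounds are those valid in both. In the first role \<open>x\<close> has
  degree \<open>M\<close>, hence at least that of \<open>y\<close>, and three big neighbors.\<close>

lemma four_nbr:
  assumes t: "three v x y w" and d: "degree E w = 4"
  shows "5 \<le> degree E x \<and> 2 \<le> card (big x) \<and> (degree E x = 5 \<longrightarrow> 3 \<le> card (big x))"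
proof (rule exists_core[OF t d])
  fix c p q
  assume *: "col (H v) c" "ok v c x y p q" "p \<in> S v c w" "q \<in> miss v c w"
  have "degree E x = M" "5 \<le> degree E y" "3 \<le> card (big x)"
    using core_degree[OF t *(1) d *(2-)] core_big_x[OF t *(1) d *(2-)] by auto
  then show ?thesis using degree_le[of y] by simp
next
  fix c p q
  assume *: "col (H v) c" "ok v c y x p q" "p \<in> S v c w" "q \<in> miss v c w"
  note a = three_swap[OF t] *(1) d *(2-)
  show ?thesis
    using core_degree[OF a] core_big_y[OF a] core_degree_5[OF a] by auto
qed

section \<open>Vertices of degree five\<close>

text \<open>At least four of the five neighbors have degree three. Saying that any two exceptions
  coincide carries over directly to colors.\<close>

definition five :: "'a \<Rightarrow> bool" where
  "five w \<longleftrightarrow> degree E w = 5 \<and> (\<forall>r r'. {w, r} \<in> E \<longrightarrow> {w, r'} \<in> E \<longrightarrow>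
    degree E r \<noteq> 3 \<longrightarrow> degree E r' \<noteq> 3 \<longrightarrow> r = r')"

lemma miss_card_5:
  assumes "col (H v) c" "{v, w} \<in> E" "five w"
  shows "card (miss v c w) + 2 = M" "card (S v c w) = 4" "5 \<le> M"
  using card_miss[OF assms(1,2)] card_S[OF assms(1,2)] assms(3) degree_le[of w]
  by (simp_all add: five_def)

text \<open>Colors leading from \<open>w\<close> to vertices of degree three other than
  \<open>v\<close>. Such a vertex sees at most three colors, so few different chains can pass
  through it.\<close>

definition low :: "'a \<Rightarrow> 'a \<Rightarrow> ('a set \<Rightarrow> nat) \<Rightarrow> nat \<Rightarrow> bool" where
  "low v w c p \<longleftrightarrow> (\<exists>z. {w, z} \<in> H v \<and> c {w, z} = p \<and> degree E z = 3)"

lemma low_unique: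
  assumes "five w" "p \<in> S v c w" "p' \<in> S v c w" "\<not> low v w c p" "\<not> low v w c p'"
  shows "p = p'"
proof -
  obtain z z' where z: "{w, z} \<in> H v" "c {w, z} = p" "{w, z'} \<in> H v" "c {w, z'} = p'"
    using seenE[OF graph_del[OF graph]] assms(2,3) by metis
  then have "{w, z} \<in> E" "{w, z'} \<in> E" "degree E z \<noteq> 3" "degree E z' \<noteq> 3"
    using assms(4,5) subsetD[OF del_subset] by (auto simp: low_def)
  then have "z = z'" using assms(1) by (auto simp: five_def)
  then show ?thesis using z by simp
qed

lemma lowE:
  assumes t: "three v x y w" and c: "col (H v) c" and l: "low v w c p"
  obtains z where "{w, z} \<in> H v" "c {w, z} = p" "z \<noteq> x" "z \<noteq> y" "z \<noteq> w" "card (S v c z) \<le> 3"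
    "p \<in> S v c z" "degree E z = 3"
proof -
  obtain z where z: "{w, z} \<in> H v" "c {w, z} = p" "degree E z = 3" using l by (auto simp: low_def)
  have "4 \<le> degree E y" "4 \<le> degree E x"
    using three_nbr_ge_4[OF three_rot[OF t]] three_nbr_ge_4[OF three_rot[OF three_swap[OF t]]] by auto
  moreover have "card (S v c z) \<le> 3" using degree_seen_le[OF c del_subset, of z] z by simp
  moreover have "z \<noteq> w" using z coloring.no_loop[OF c] by auto
  moreover have "p \<in> S v c z" using z seenI[of z w "H v" c] by (simp add: insert_commute)
  ultimately show ?thesis using that z by fastforce
qed

lemma hit:
  assumes t: "three v x y w" and c: "col (H v) c" and "chain (H v) c p r x w" "p \<notin> S v c x"
    and "r \<in> miss v c w" "{w, z} \<in> H v" "c {w, z} = p"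
  shows "r \<in> S v c z"
  using coloring.chain_nbr_at(2)[OF c assms(3)] three_neq[OF t] assms(4-) by auto

text \<open>The chains from \<open>x\<close> to \<open>w\<close> in \<open>p\<close> and the colors
  of \<open>miss v c w - {q}\<close> pass through \<open>z\<close>, which thus sees
  \<open>M - 3\<close> colors and \<open>p\<close>, but at most three in all. As \<open>M\<close> is
  at least five, there is no slack. If \<open>y\<close> missed one of these colors, it could replace
  \<open>q\<close>, and \<open>z\<close> would have to see \<open>q\<close> too.\<close>

lemma low_mixed_structure:
  assumes t: "three v x y w" and f: "five w" and c: "col (H v) c" and o: "ok v c x y p q"
    and p: "p \<in> S v c w" and q: "q \<in> miss v c w" and z: "{w, z} \<in> H v" "c {w, z} = p" "degree E z = 3"
  shows "M = 5" "S v c z = insert p (miss v c w - {q})" "miss v c w - {q} \<subseteq> S v c x \<inter> S v c y"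
    "card (miss v c w - {q}) = 2"
proof -
  interpret coloring "H v" "M + 2" c by fact
  have e: "{v, w} \<in> E" using three_edges[OF t] by simp
  let ?N = "miss v c w - {q}"
  note N = miss_card_5[OF c e f]
  have po: "p < M + 2" "p \<notin> S v c x" "p \<noteq> q" using o by (auto simp: ok_def)
  have ch: "chain (H v) c p r x w" "r \<in> S v c x" "r \<in> S v c z" if "r \<in> ?N" for r
  proof -
    show *: "chain (H v) c p r x w" "r \<in> S v c x" using key_one[OF t c o] that p q by auto
    show "r \<in> S v c z" using hit[OF t c *(1) po(2) _ z(1,2)] that by auto
  qed
  have "p \<in> S v c z" using z seenI[of z w "H v" c] by (simp add: insert_commute)
  then have sub: "insert p ?N \<subseteq> S v c z" using ch by auto
  then have "card (insert p ?N) \<le> card (S v c z)" by (intro card_mono finite_S)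
  moreover have "card (insert p ?N) = Suc (card ?N)" using p by simp
  moreover have "Suc (card ?N) = card (miss v c w)" using q by (intro card_Suc_Diff1) auto
  moreover have "card (S v c z) \<le> 3" using degree_seen_le[OF c del_subset, of z] z by simp
  ultimately have *: "M = 5" "card ?N = 2" "card (insert p ?N) = card (S v c z)" using N by auto
  then show "M = 5" "card ?N = 2" by auto
  show Sz: "S v c z = insert p ?N" using card_subset_eq[OF finite_S sub *(3)] by simp
  have "r \<in> S v c y" if r: "r \<in> ?N" for r
  proof (rule ccontr)
    assume ry: "r \<notin> S v c y"
    then have "ok v c x y p r" using ok_end[OF t c ch(1)[OF r]] po r p by auto
    then have "chain (H v) c p q x w" using key_one[OF t c, of p r q] r q p by auto
    then have "q \<in> S v c z" using hit[OF t c _ po(2) q z(1,2)] by blast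
    then show False using Sz po by auto
  qed
  then show "?N \<subseteq> S v c x \<inter> S v c y" using ch by auto
qed

text \<open>If \<open>u\<close> were low, its vertex \<open>z'\<close> would be as full as
  \<open>z\<close>, and \<open>p\<close> and \<open>u\<close> could be exchanged at
  \<open>w\<close>. A chain from \<open>x\<close> would then reach \<open>z\<close> before and
  \<open>z'\<close> after the exchange; outside \<open>w\<close> these two and \<open>x\<close> all
  miss \<open>p\<close>.\<close>

lemma low_mixed_other:
  assumes t: "three v x y w" and f: "five w" and c: "col (H v) c" and o: "ok v c x y p q"
    and p: "p \<in> S v c w" and q: "q \<in> miss v c w" and z: "{w, z} \<in> H v" "c {w, z} = p" "degree E z = 3"
    and u: "u \<in> S v c w" "u \<noteq> p" and o': "ok v c x y u q \<or> ok v c x y q u"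
  shows "\<not> low v w c u"
proof
  assume "low v w c u"
  then obtain z' where z': "{w, z'} \<in> H v" "c {w, z'} = u" "z' \<noteq> x" "z' \<noteq> y" "z' \<noteq> w"
    "card (S v c z') \<le> 3" "u \<in> S v c z'" "degree E z' = 3" using lowE[OF t c] by metis
  interpret coloring "H v" "M + 2" c by fact
  have e: "{v, w} \<in> E" using three_edges[OF t] by simp
  let ?N = "miss v c w - {q}"
  note N = miss_card_5[OF c e f]
  note st = low_mixed_structure[OF t f c o p q z]
  have neq: "x \<noteq> w" "x \<noteq> y" "y \<noteq> w" using three_neq[OF t] by auto
  have po: "p < M + 2" "p \<notin> S v c x" "p \<noteq> q" "q \<notin> S v c y" using o by (auto simp: ok_def)
  have "r \<in> S v c z'" if r: "r \<in> ?N" for r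
    using o'
  proof
    assume o': "ok v c x y u q"
    have "chain (H v) c u r x w" using key_one[OF t c o', of r] r u q by auto
    then show ?thesis using hit[OF t c _ _ _ z'(1,2)] o' r by (auto simp: ok_def)
  next
    assume "ok v c x y q u"
    then have o': "ok v c y x u q" by (rule ok_sym)
    have "chain (H v) c u r y w" using key_one[OF three_swap[OF t] c o', of r] r u q by auto
    then show ?thesis using hit[OF three_swap[OF t] c _ _ _ z'(1,2)] o' r by (auto simp: ok_def)
  qed
  then have sub: "insert u ?N \<subseteq> S v c z'" using z' by auto
  have "card (insert u ?N) = 3" using u st(4) by simp
  then have "card (insert u ?N) = card (S v c z')"
    using card_mono[OF finite_S sub] z' by simp
  then have Sz': "S v c z' = insert u ?N" using card_subset_eq[OF finite_S sub] by simp
  have zz: "z \<noteq> z'" using z z' u by auto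
  have zx: "z \<noteq> x" "z \<noteq> y"
    using lowE[OF t c, of p] z nbr_eq[OF z(1)] unfolding low_def by metis+
  let ?c = "c({w, z} := c {w, z'}, {w, z'} := c {w, z})"
  have sub: "seen (del (H v) w) c s \<subseteq> S v c s" for s by (rule seen_mono[OF del_subset])
  have c': "col (H v) ?c"
  proof (rule coloring_swap[OF c z(1) z'(1) zz])
    show "c {w, z'} \<notin> S v c z" "c {w, z} \<notin> S v c z'" using z z' st(2) Sz' u p by auto
    fix s assume s: "{w, s} \<in> H v" "s \<noteq> z" "s \<noteq> z'"
    have "c {w, s} \<in> S v c w" "c {w, s} \<noteq> p" "c {w, s} \<noteq> u"
      using s seenI[of w s "H v" c] nbr_eq[OF s(1) z(1)] nbr_eq[OF s(1) z'(1)] z z' by auto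
    then have "c {w, s} \<notin> S v c z" "c {w, s} \<notin> S v c z'" using st(2) Sz' by auto
    moreover have "u \<notin> S v c z" "p \<notin> S v c z'" using st(2) Sz' u p by auto
    ultimately show "\<not> chain (del (H v) w) c (c {w, z'}) (c {w, s}) z s"
      "\<not> chain (del (H v) w) c (c {w, z}) (c {w, s}) z' s"
      using sub s z z' by (intro chain_isolated; auto)+
  qed
  have at: "?c {w, s} = (if s = z then u else if s = z' then p else c {w, s})" for s
    using z z' zz by (auto simp: doubleton_eq_iff)
  have S': "S v ?c x = S v c x" "S v ?c y = S v c y"
    using neq z' zx by (auto intro!: seen_cong)
  have "?c ` {e \<in> H v. w \<in> e} = c ` {e \<in> H v. w \<in> e}"
    using z(1,2) z'(1,2) zz by (auto simp: image_iff doubleton_eq_iff)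
  then have Sw': "S v ?c w = S v c w" by (simp add: seen_def)
  have bicd: "bic (del (H v) w) ?c i j = bic (del (H v) w) c i j" for i j
    by (auto simp: bic_def del_def)
  interpret c': coloring "H v" "M + 2" ?c by fact
  have "\<not> chain (H v) ?c p q x y"
  proof
    assume "chain (H v) ?c p q x y"
    then have "chain (del (H v) w) ?c p q x y"
      using c'.chain_del[of p q x y w] neq S' Sw' po q by auto
    then have "chain (H v) c p q x y"
      using chain_cong[OF bicd] chain_subset[OF _ del_subset] by metis
    then show False using o by (simp add: ok_def)
  qed
  then have o2: "ok v ?c x y p q" using o S' by (simp add: ok_def)
  have "card ?N \<noteq> 0" using st(4) by linarith
  then obtain r where r: "r \<in> ?N" by (metis card.empty ex_in_conv)
  have ch: "chain (H v) c p r x w" using key_one[OF t c o] r p q by auto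
  have ch': "chain (H v) ?c p r x w" using key_one[OF t c' o2] r p q Sw' by auto
  have "chain (del (H v) w) ?c p r x z'"
    using c'.chain_nbr_at(3)[OF ch' neq(1) _ _ z'(1)] at[of z'] zz S' Sw' po r by auto
  then have 1: "chain (del (H v) w) c p r x z'" using chain_cong[OF bicd] by metis
  have 2: "chain (del (H v) w) c p r x z"
    using chain_nbr_at(3)[OF ch neq(1) _ _ z(1,2)] po r by auto
  have "p \<notin> S v c z'" using Sz' u p by auto
  moreover have "p \<notin> seen (del (H v) w) c z" using vertex_iff(1)[OF z(1)] z by simp
  ultimately show False
    using coloring.chain_ends[OF coloring_del 1 2] z' zx zz sub po by auto
qed

text \<open>Otherwise \<open>y\<close> sees \<open>p\<close>, the two colors of
  \<open>miss v c w - {q}\<close> and at least two further low colors at \<open>w\<close>, in all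
  \<open>M = 5\<close> colors.\<close>

lemma low_mixed_seen:
  assumes t: "three v x y w" and f: "five w" and c: "col (H v) c" and o: "ok v c x y p q"
    and p: "p \<in> S v c w" and q: "q \<in> miss v c w" and z: "{w, z} \<in> H v" "c {w, z} = p" "degree E z = 3"
  shows "q \<in> S v c x"
proof (rule ccontr)
  assume qx: "q \<notin> S v c x"
  interpret coloring "H v" "M + 2" c by fact
  have e: "{v, w} \<in> E" "{v, y} \<in> E" using three_edges[OF t] by simp_all
  let ?N = "miss v c w - {q}"
  note N = miss_card_5[OF c e(1) f]
  note st = low_mixed_structure[OF t f c o p q z]
  note other = low_mixed_other[OF t f c o p q z]
  have po: "p < M + 2" "p \<notin> S v c x" "p \<noteq> q" "q \<notin> S v c y" "q < M + 2" using o by (auto simp: ok_def)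
  have "p \<in> S v c y" using one_common(2)[OF t c o p q qx] N by simp
  have both: "u \<in> S v c y" if u: "u \<in> S v c w" "u \<noteq> p" "low v w c u" for u
  proof (rule ccontr)
    assume uy: "u \<notin> S v c y"
    have "u < M + 2" "u \<noteq> q" using u q seen_less by auto
    then have "ok v c y x u q" using ok_isolated[OF three_swap[OF t], of u c q] uy po qx by auto
    then show False using other[OF u(1,2)] u(3) ok_sym by blast
  qed
  let ?L = "{u \<in> S v c w - {p}. low v w c u}"
  have "card (S v c w - {p} - ?L) \<le> 1"
    using low_unique[OF f] finite_S by (subst card_le_Suc0_iff_eq[folded One_nat_def]) auto
  moreover have "card (S v c w - {p} - ?L) = card (S v c w - {p}) - card ?L"
    using finite_S by (intro card_Diff_subset) auto
  ultimately have "2 \<le> card ?L" using N p by simp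
  moreover have "insert p (?N \<union> ?L) \<subseteq> S v c y" using both st(3) \<open>p \<in> S v c y\<close> by auto
  then have "card (insert p (?N \<union> ?L)) \<le> card (S v c y)" by (intro card_mono finite_S)
  moreover have "card (insert p (?N \<union> ?L)) = Suc (card (?N \<union> ?L))"
    using p finite_S by (intro card_insert_disjoint) auto
  moreover have "card (?N \<union> ?L) = card ?N + card ?L"
    using finite_S by (intro card_Un_disjoint) auto
  ultimately show False using st(1,4) card_S_less[OF c e(2)] by simp
qed

text \<open>Among the three colors at \<open>w\<close> other than \<open>p\<close>, each of
  \<open>x\<close> and \<open>y\<close> has room for at most one. So some color \<open>g\<close> is
  missing at both, which makes it the one that is not low, and one of the two low colors,
  \<open>h\<close>, is seen by \<open>y\<close> but not by \<open>x\<close>. Then the chain in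
  \<open>h\<close> and \<open>q\<close> from \<open>x\<close> has to end at \<open>y\<close> and
  also at \<open>w\<close>.\<close>

lemma not_low_mixed:
  assumes t: "three v x y w" and f: "five w" and c: "col (H v) c" and o: "ok v c x y p q"
    and p: "p \<in> S v c w" and q: "q \<in> miss v c w"
  shows "\<not> low v w c p"
proof
  assume "low v w c p"
  then obtain z where z: "{w, z} \<in> H v" "c {w, z} = p" "degree E z = 3"
    and zz: "z \<noteq> x" "z \<noteq> y" "z \<noteq> w" using lowE[OF t c] by metis
  interpret coloring "H v" "M + 2" c by fact
  have e: "{v, w} \<in> E" "{v, y} \<in> E" "{v, x} \<in> E" using three_edges[OF t] by simp_all
  have neq: "x \<noteq> w" "x \<noteq> y" "y \<noteq> w" using three_neq[OF t] by auto
  let ?N = "miss v c w - {q}"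
  note N = miss_card_5[OF c e(1) f]
  note st = low_mixed_structure[OF t f c o p q z]
  note other = low_mixed_other[OF t f c o p q z]
  have po: "p < M + 2" "p \<notin> S v c x" "p \<noteq> q" "q \<notin> S v c y" "q < M + 2" using o by (auto simp: ok_def)
  have qz: "q \<notin> S v c z" using st(2) po by auto
  have sub: "seen (del (H v) w) c s \<subseteq> S v c s" for s by (rule seen_mono[OF del_subset])
  have qx: "q \<in> S v c x" by (rule low_mixed_seen[OF t f c o p q z])
  have py: "p \<in> S v c y"
  proof -
    \<comment> \<open>after this recoloring \<open>p\<close>, \<open>q\<close> and \<open>x\<close>, \<open>y\<close> exchange their roles\<close>
    let ?c = "c({w, z} := q)"
    have c': "col (H v) ?c"
    proof (rule coloring_recolor[OF c z(1)])
      fix s assume s: "{w, s} \<in> H v" "s \<noteq> z"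
      have "c {w, s} \<in> S v c w" "c {w, s} \<noteq> p"
        using s seenI[of w s "H v" c] nbr_eq[OF s(1) z(1)] z by auto
      then have "c {w, s} \<notin> S v c z" using st(2) by auto
      then show "\<not> chain (del (H v) w) c q (c {w, s}) z s"
        using qz sub s by (intro chain_isolated) auto
    qed (use q qz in auto)
    have S': "S v ?c x = S v c x" "S v ?c y = S v c y"
      using neq zz by (auto intro!: seen_cong)
    have bic: "bic (H v) ?c p q = bic (H v) c p q" using z by (auto simp: bic_def)
    have o': "ok v ?c y x q p"
      using ok_sym[of v ?c x y p q] o S' by (simp add: ok_def chain_cong[OF bic])
    have qw: "q \<in> S v ?c w" using seenI[of w z "H v" ?c q] z by simp
    have pw: "p \<notin> S v ?c w"
      by (rule seen_recolor[OF z(1)]) (use po z in auto)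
    have "p \<in> S v ?c y"
      by (rule low_mixed_seen[OF three_swap[OF t] f c' o' qw _ z(1) _ z(3)]) (use pw po in auto)
    then show ?thesis using S' by simp
  qed
  have cardx: "card (S v c x) \<le> 4" "card (S v c y) \<le> 4"
    using card_S_less[OF c e(3)] card_S_less[OF c e(2)] st(1) by auto
  have one: "card (S v c u \<inter> (S v c w - {p})) \<le> 1"
    if u: "insert s ?N \<subseteq> S v c u" "s \<in> {p, q}" "card (S v c u) \<le> 4" for u s
  proof -
    have "insert s ?N \<union> (S v c u \<inter> (S v c w - {p})) \<subseteq> S v c u" using u by auto
    then have "card (insert s ?N) + card (S v c u \<inter> (S v c w - {p})) \<le> card (S v c u)"
      using u q by (intro card_add_le) auto
    moreover have "s \<notin> ?N" using u(2) p by blast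
    then have "card (insert s ?N) = 3" using card_insert_disjoint[of ?N s] st(4) by simp
    ultimately show ?thesis using u by simp
  qed
  have onex: "card (S v c x \<inter> (S v c w - {p})) \<le> 1" using one[of q x] st(3) qx cardx by auto
  have oney: "card (S v c y \<inter> (S v c w - {p})) \<le> 1" using one[of p y] st(3) py cardx by auto
  have cardP: "card (S v c w - {p}) = 3" using N p by simp
  have out: "\<not> low v w c u" if u: "u \<in> S v c w" "u \<noteq> p" "u \<notin> S v c x" "u \<notin> S v c y" for u
  proof -
    have "u < M + 2" "u \<noteq> q" using u q seen_less by auto
    then have "ok v c x y u q"
      using u po chain_isolated'[of u "H v" c y q x] neq by (auto simp: ok_def)
    then show ?thesis using other[OF u(1,2)] by blast
  qed
  obtain g where g: "g \<in> S v c w" "g \<noteq> p" "g \<notin> S v c x" "g \<notin> S v c y"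
  proof -
    have "\<not> S v c w - {p} \<subseteq> (S v c x \<inter> (S v c w - {p})) \<union> (S v c y \<inter> (S v c w - {p}))"
    proof
      assume "S v c w - {p} \<subseteq> (S v c x \<inter> (S v c w - {p})) \<union> (S v c y \<inter> (S v c w - {p}))"
      then have "card (S v c w - {p}) \<le>
        card ((S v c x \<inter> (S v c w - {p})) \<union> (S v c y \<inter> (S v c w - {p})))"
        using finite_S by (intro card_mono) auto
      also have "\<dots> \<le> card (S v c x \<inter> (S v c w - {p})) + card (S v c y \<inter> (S v c w - {p}))"
        by (rule card_Un_le)
      finally show False using onex oney cardP by simp
    qed
    then show ?thesis using that by blast
  qed
  obtain a b where ab: "S v c w - {p} = {g, a, b}" "g \<noteq> a" "g \<noteq> b" "a \<noteq> b"
    using card_three_elements[OF cardP, of g] g by auto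
  have lows: "low v w c a" "low v w c b"
    using low_unique[OF f g(1) _ out[OF g]] ab by auto
  have "a \<in> S v c x \<or> a \<in> S v c y" "b \<in> S v c x \<or> b \<in> S v c y"
    using out[of a] out[of b] lows ab by auto
  moreover have "\<not> (a \<in> S v c x \<and> b \<in> S v c x)" "\<not> (a \<in> S v c y \<and> b \<in> S v c y)"
    using onex oney ab card_mono[of "S v c x \<inter> (S v c w - {p})" "{a, b}"]
      card_mono[of "S v c y \<inter> (S v c w - {p})" "{a, b}"] finite_S by fastforce+
  ultimately obtain h where h: "h \<in> {a, b}" "h \<notin> S v c x" "h \<in> S v c y" by auto
  have hw: "h \<in> S v c w" "h \<noteq> p" "h \<noteq> g" "h \<noteq> q" "low v w c h" "h < M + 2" "g \<noteq> q" "g < M + 2"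
    using h ab lows q g seen_less by auto
  have "\<not> ok v c x y h q" using other[OF hw(1,2)] hw by blast
  then have ch: "chain (H v) c h q x y" using h hw po by (auto simp: ok_def)
  have "ok v c x y h g" using ok_isolated[OF t, of h c g] h g hw by auto
  then have "chain (H v) c h q x w"
    using key3[OF t c, of h g q] chain_isolated[of g "H v" c y q w] po hw q g neq by auto
  then show False using chain_ends[OF ch] neq h po q by auto
qed

text \<open>Each of \<open>x\<close> and \<open>y\<close> would have room for only one color of
  \<open>S v c w\<close>, so two of these colors are missing at both. One of the two is low, and
  whether its chains come from \<open>x\<close> or from \<open>y\<close>, they pass through the same
  vertex of degree three, which would see at least four colors.\<close>

lemma five_both:
  assumes t: "three v x y w" and f: "five w" and c: "col (H v) c"
  shows "\<not> (miss v c w \<subseteq> S v c x \<and> miss v c w \<subseteq> S v c y)"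
proof
  let ?N = "miss v c w" and ?P = "S v c w"
  assume sub: "?N \<subseteq> S v c x \<and> ?N \<subseteq> S v c y"
  interpret coloring "H v" "M + 2" c by fact
  have e: "{v, w} \<in> E" "{v, y} \<in> E" "{v, x} \<in> E" using three_edges[OF t] by simp_all
  have neq: "x \<noteq> w" "x \<noteq> y" "y \<noteq> w" using three_neq[OF t] by auto
  note N = miss_card_5[OF c e(1) f]
  have one: "card (S v c u \<inter> ?P) \<le> 1" if u: "?N \<subseteq> S v c u" "{v, u} \<in> E" for u
  proof -
    have "?N \<union> (S v c u \<inter> ?P) \<subseteq> S v c u" using u by auto
    then have "card ?N + card (S v c u \<inter> ?P) \<le> card (S v c u)"
      by (intro card_add_le) auto
    then show ?thesis using N card_S_less[OF c u(2)] by simp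
  qed
  have "card (S v c x \<inter> ?P \<union> S v c y \<inter> ?P) \<le> 2"
    using card_Un_le[of "S v c x \<inter> ?P" "S v c y \<inter> ?P"] one[of x] one[of y] sub e by simp
  moreover have "card (?P - (S v c x \<inter> ?P \<union> S v c y \<inter> ?P)) =
    card ?P - card (S v c x \<inter> ?P \<union> S v c y \<inter> ?P)"
    using finite_S by (intro card_Diff_subset) auto
  ultimately have "2 \<le> card (?P - (S v c x \<inter> ?P \<union> S v c y \<inter> ?P))" using N by simp
  then obtain u r where ur: "u \<in> ?P" "r \<in> ?P" "u \<noteq> r" "u \<notin> S v c x" "u \<notin> S v c y"
    "r \<notin> S v c x" "r \<notin> S v c y"
    using card_le_Suc0_iff_eq[of "?P - (S v c x \<inter> ?P \<union> S v c y \<inter> ?P)"] finite_S by fastforce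
  have no: False if ur: "u \<in> ?P" "r \<in> ?P" "u \<noteq> r" "u \<notin> S v c x" "u \<notin> S v c y"
    "r \<notin> S v c x" "r \<notin> S v c y" "low v w c u" for u r
  proof -
    obtain z where z: "{w, z} \<in> H v" "c {w, z} = u" "card (S v c z) \<le> 3" "u \<in> S v c z"
      using lowE[OF t c ur(8)] by metis
    have o: "ok v c x y u r" "ok v c x y r u"
      using ok_isolated[OF t, of u c r] ok_isolated[OF t, of r c u] ur seen_less by auto
    have "s \<in> S v c z" if s: "s \<in> ?N" for s
    proof -
      have "\<not> (chain (H v) c r s x w \<and> chain (H v) c r s y w)"
        using chain_ends[of r s w x y] neq ur s by (auto dest: chain_sym)
      then have "chain (H v) c u s x w \<or> chain (H v) c u s y w"
        using key3[OF t c o(1), of s] key3[OF t c o(2), of s] s ur by auto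
      then show ?thesis
        using hit[OF t c _ ur(4) s z(1,2)] hit[OF three_swap[OF t] c _ ur(5) s z(1,2)] by auto
    qed
    then have "insert u ?N \<subseteq> S v c z" using z by auto
    then have "card (insert u ?N) \<le> card (S v c z)" by (intro card_mono finite_S)
    moreover have "card (insert u ?N) = Suc (card ?N)" using ur by simp
    ultimately show False using N z by simp
  qed
  show False using no[of u r] no[of r u] ur low_unique[OF f ur(1,2)] by auto
qed

text \<open>As \<open>p\<close> is not low, it is the single exception and all other colors at
  \<open>w\<close> are low; by \<open>not_low_mixed\<close> none of them can take its place. If
  \<open>x\<close> missed \<open>q\<close>, it would have to see all of them, which is too
  many.\<close>

lemma five_mixed:
  assumes t: "three v x y w" and f: "five w" and c: "col (H v) c" and o: "ok v c x y p q"
    and p: "p \<in> S v c w" and q: "q \<in> miss v c w"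
  shows "miss v c w \<subseteq> S v c x"
    "\<And>u s. u \<in> S v c w \<Longrightarrow> u \<noteq> p \<Longrightarrow> \<not> ok v c x y u s"
    "\<And>u. u \<in> S v c w \<Longrightarrow> u \<noteq> p \<Longrightarrow> low v w c u"
proof -
  interpret coloring "H v" "M + 2" c by fact
  have e: "{v, w} \<in> E" "{v, y} \<in> E" "{v, x} \<in> E" using three_edges[OF t] by simp_all
  have neq: "x \<noteq> w" "x \<noteq> y" "y \<noteq> w" using three_neq[OF t] by auto
  note N = miss_card_5[OF c e(1) f]
  have po: "p < M + 2" "p \<notin> S v c x" "p \<noteq> q" "q \<notin> S v c y" "q < M + 2" using o by (auto simp: ok_def)
  show low: "low v w c u" if "u \<in> S v c w" "u \<noteq> p" for u
    using low_unique[OF f that(1) p] not_low_mixed[OF t f c o p q] that by auto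
  show no: "\<not> ok v c x y u s" if u: "u \<in> S v c w" "u \<noteq> p" for u s
  proof
    assume o': "ok v c x y u s"
    have no: False if "ok v c x y u i" "i \<in> miss v c w" for i
      using not_low_mixed[OF t f c that(1) u(1) that(2)] low[OF u] by simp
    show False
    proof (cases "s \<in> S v c w")
      case False
      then show ?thesis using no[OF o'] o' by (auto simp: ok_def)
    next
      case True
      have ou: "u < M + 2" "u \<notin> S v c x" "s \<notin> S v c y" using o' by (auto simp: ok_def)
      have "chain (H v) c u q x w"
        using key3[OF t c o', of q] q True u chain_isolated[of s "H v" c y q w] ou po neq by auto
      then have "ok v c x y u q" using ok_end[OF t c] ou q po u by auto
      then show ?thesis using no q by blast
    qed
  qed
  have sub: "miss v c w - {q} \<subseteq> S v c x" using key_one(2)[OF t c o] p q by auto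
  have "q \<in> S v c x"
  proof (rule ccontr)
    assume qx: "q \<notin> S v c x"
    have "u \<in> S v c x" if u: "u \<in> S v c w" "u \<noteq> p" for u
    proof (rule ccontr)
      assume "u \<notin> S v c x"
      then have "ok v c x y u q"
        using ok_isolated[OF t, of u c q] qx po u seen_less[of u w] q by auto
      then show False using no[OF u] by blast
    qed
    with sub have "(miss v c w - {q}) \<union> (S v c w - {p}) \<subseteq> S v c x" by auto
    then have "card (miss v c w - {q}) + card (S v c w - {p}) \<le> card (S v c x)"
      by (intro card_add_le) auto
    moreover have "Suc (card (miss v c w - {q})) = card (miss v c w)"
      using q by (intro card_Suc_Diff1) auto
    ultimately show False using N p card_S_less[OF c e(3)] by simp
  qed
  with sub show "miss v c w \<subseteq> S v c x" by auto
qed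

text \<open>Two low colors \<open>a\<close> and \<open>b\<close> are missing at \<open>x\<close>.
  Recoloring their edges at \<open>w\<close> with colors missing at \<open>w\<close> must fail, and
  what makes it fail uses up colors at the two ends of degree three. Together these see at most two
  of the at least three colors missing at \<open>w\<close>, yet each such color must be seen at one
  of them.\<close>

lemma not_five_mixed:
  assumes t: "three v x y w" and f: "five w" and c: "col (H v) c" and o: "ok v c x y p q"
    and p: "p \<in> S v c w" and q: "q \<in> miss v c w"
  shows False
proof -
  interpret coloring "H v" "M + 2" c by fact
  have e: "{v, w} \<in> E" "{v, y} \<in> E" "{v, x} \<in> E" using three_edges[OF t] by simp_all
  have neq: "x \<noteq> w" "x \<noteq> y" "y \<noteq> w" using three_neq[OF t] by auto
  let ?N = "miss v c w" and ?P = "S v c w"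
  note N = miss_card_5[OF c e(1) f]
  note fm = five_mixed[OF t f c o p q]
  have po: "p < M + 2" "p \<notin> S v c x" "p \<noteq> q" "q \<notin> S v c y" "q < M + 2" using o by (auto simp: ok_def)
  have "?N \<union> (S v c x \<inter> ?P) \<subseteq> S v c x" using fm(1) by auto
  then have "card ?N + card (S v c x \<inter> ?P) \<le> card (S v c x)"
    by (intro card_add_le) auto
  then have Px: "card (S v c x \<inter> ?P) \<le> 1" using N card_S_less[OF c e(3)] by simp
  have "card (?P - {p} - (S v c x \<inter> ?P)) = card (?P - {p}) - card (S v c x \<inter> ?P)"
    using finite_S po by (intro card_Diff_subset) auto
  then have "2 \<le> card (?P - {p} - (S v c x \<inter> ?P))" using Px N p by simp
  then obtain a b where "a \<in> ?P - {p} - (S v c x \<inter> ?P)" "b \<in> ?P - {p} - (S v c x \<inter> ?P)" "a \<noteq> b"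
    using card_le_Suc0_iff_eq[of "?P - {p} - (S v c x \<inter> ?P)"] finite_S by fastforce
  then have ab: "a \<in> ?P" "b \<in> ?P" "a \<noteq> p" "b \<noteq> p" "a \<notin> S v c x" "b \<notin> S v c x" "a \<noteq> b" by auto
  have inY: "s \<in> S v c y" if "u \<in> ?P" "u \<noteq> p" "u \<notin> S v c x" "s \<in> ?P" "s \<notin> S v c x" "s \<noteq> u" for u s
  proof (rule ccontr)
    assume "s \<notin> S v c y"
    then have "ok v c x y u s" using ok_isolated[OF t, of u c s] that seen_less by auto
    then show False using fm(2) that by blast
  qed
  have Sy: "a \<in> S v c y" "b \<in> S v c y" "p \<in> S v c y"
    using inY[of b a] inY[of a b] inY[of a p] ab p po by auto
  have "insert p (insert a (insert b (?N \<inter> S v c y))) \<subseteq> S v c y" using Sy by auto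
  then have "card (insert p (insert a (insert b (?N \<inter> S v c y)))) \<le> card (S v c y)"
    by (intro card_mono finite_S)
  moreover have "card (insert p (insert a (insert b (?N \<inter> S v c y)))) = 3 + card (?N \<inter> S v c y)"
    using ab p by simp
  moreover have "card ?N = card (?N \<inter> S v c y) + card (?N - S v c y)"
    using card_Int_Diff[of ?N] by simp
  ultimately have 2: "2 \<le> card (?N - S v c y)" using N card_S_less[OF c e(2)] by simp
  have another: "\<exists>s\<in>?N - S v c y. s \<noteq> r" for r
  proof -
    have "\<not> ?N - S v c y \<subseteq> {r}" using 2 card_mono[of "{r}" "?N - S v c y"] by auto
    then show ?thesis by auto
  qed
  have ch: "chain (H v) c p r x w" if r: "r \<in> ?N" for r
  proof (cases "r = q")
    case False
    then show ?thesis using key_one(1)[OF t c o] r p q by auto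
  next
    case True
    obtain s where s: "s \<in> ?N - S v c y" "s \<noteq> q" using another by blast
    have "chain (H v) c p s x w" using key_one(1)[OF t c o] s p q by auto
    then have "ok v c x y p s" using ok_end[OF t c] po s p by auto
    then show ?thesis using key_one(1)[OF t c, of p s q] s p q True by auto
  qed
  have sub: "seen (del (H v) w) c s \<subseteq> S v c s" for s by (rule seen_mono[OF del_subset])
  \<comment> \<open>If \<open>w z\<close> could be recolored with \<open>r\<close>, then
    \<open>w\<close> would miss \<open>i\<close>, and \<open>five_mixed\<close> would make
    \<open>x\<close> see \<open>i\<close>. The chain in \<open>p\<close> and \<open>r\<close> is no
    obstacle, since it already joins \<open>x\<close> to \<open>w\<close>.\<close>
  have blocked: "\<exists>u. {w, u} \<in> H v \<and> c {w, u} \<noteq> p \<and> u \<noteq> z \<and> c {w, u} \<in> S v c z \<and> r \<in> S v c u \<and>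
      chain (H v) c r (c {w, u}) z w"
    if z: "{w, z} \<in> H v" "c {w, z} = i" "z \<noteq> x" "z \<noteq> y" and i: "i \<noteq> p" "i \<notin> S v c x"
      and r: "r \<in> ?N" "r \<notin> S v c z" for z i r
  proof (rule ccontr)
    assume nb: "\<nexists>u. {w, u} \<in> H v \<and> c {w, u} \<noteq> p \<and> u \<noteq> z \<and> c {w, u} \<in> S v c z \<and> r \<in> S v c u \<and>
      chain (H v) c r (c {w, u}) z w"
    let ?c = "c({w, z} := r)"
    have wz: "w \<noteq> z" using z no_loop by auto
    have c': "col (H v) ?c"
    proof (rule coloring_recolor[OF c z(1)])
      fix u assume u: "{w, u} \<in> H v" "u \<noteq> z"
      have du: "c {w, u} \<notin> seen (del (H v) w) c u" by (rule vertex_iff(1)[OF u(1)])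
      show "\<not> chain (del (H v) w) c r (c {w, u}) z u"
      proof
        assume ch': "chain (del (H v) w) c r (c {w, u}) z u"
        have zw: "chain (H v) c r (c {w, u}) z w"
          by (rule chain_trans[OF chain_subset[OF ch' del_subset]])
            (rule chain_edge, use u in \<open>auto simp: insert_commute\<close>)
        have "c {w, u} \<in> seen (del (H v) w) c z"
          using chain_seen(1)[OF ch'] u r sub by auto
        then have s1: "c {w, u} \<in> S v c z" using sub by auto
        have "r \<in> seen (del (H v) w) c u"
          using chain_seen(2)[OF chain_sym[OF ch']] u du by auto
        then have s2: "r \<in> S v c u" using sub by auto
        have "c {w, u} = p" using nb u s1 s2 zw by blast
        then have "chain (H v) c p r w z" using chain_flip[OF zw] by simp
        then show False
          using chain_ends[OF _ chain_sym[OF ch[OF r(1)]]] neq z wz r po by auto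
      qed
    qed (use r in auto)
    have S': "S v ?c x = S v c x" "S v ?c y = S v c y"
      using neq z by (auto intro!: seen_cong)
    have Sw': "s \<notin> S v ?c w" if "s \<noteq> r" "s = i \<or> s \<notin> S v c w" for s
      using seen_recolor[OF z(1) that(1)] that(2) z(2) by auto
    have iw: "i \<in> S v c w" using z seenI[of w z "H v" c] by auto
    obtain s where s: "s \<in> ?N" "s \<notin> S v c y" "s \<noteq> r" using another[of r] by blast
    have bic: "bic (H v) ?c p s = bic (H v) c p s"
      using z s i iw r p by (auto simp: bic_def)
    have "\<not> chain (H v) c p s x y" using chain_ends[OF ch[OF s(1)]] neq po s by auto
    then have o': "ok v ?c x y p s" using S' po s p by (auto simp: ok_def chain_cong[OF bic])
    obtain zp where zp: "{w, zp} \<in> H v" "c {w, zp} = p" using seenE[OF graph, of p c w] p by metis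
    have "zp \<noteq> z" using zp z i by auto
    then have "?c {w, zp} = p" using zp by (auto simp: doubleton_eq_iff)
    with zp(1) have "p \<in> S v ?c w" by (rule seenI)
    then have "miss v ?c w \<subseteq> S v ?c x"
      using five_mixed(1)[OF t f c' o'] s Sw'[of s] by auto
    moreover have "i \<in> miss v ?c w" using Sw'[of i] iw r seen_less[of i w] by auto
    ultimately show False using S' i by auto
  qed
  obtain za where za: "{w, za} \<in> H v" "c {w, za} = a" "za \<noteq> x" "za \<noteq> y" "za \<noteq> w"
    "card (S v c za) \<le> 3" "a \<in> S v c za" using lowE[OF t c fm(3)[OF ab(1,3)]] by metis
  obtain zb where zb: "{w, zb} \<in> H v" "c {w, zb} = b" "zb \<noteq> x" "zb \<noteq> y" "zb \<noteq> w"
    "card (S v c zb) \<le> 3" "b \<in> S v c zb" using lowE[OF t c fm(3)[OF ab(2,4)]] by metis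
  have zab: "za \<noteq> zb" using za zb ab by auto
  \<comment> \<open>With \<open>i\<close> and two colors of \<open>?N\<close> the vertex
    \<open>z\<close> is full and sees no other color of \<open>w\<close>, so \<open>blocked\<close>
    has no obstacle to offer.\<close>
  have few: "card (?N \<inter> S v c z) \<le> 1"
    if z: "{w, z} \<in> H v" "c {w, z} = i" "z \<noteq> x" "z \<noteq> y" "card (S v c z) \<le> 3" "i \<in> S v c z"
      and i: "i \<in> ?P" "i \<noteq> p" "i \<notin> S v c x" for z i
  proof (rule ccontr)
    assume "\<not> card (?N \<inter> S v c z) \<le> 1"
    then have "3 \<le> card (insert i (?N \<inter> S v c z))" using i by simp
    moreover have sz: "insert i (?N \<inter> S v c z) \<subseteq> S v c z" using z by auto
    ultimately have *: "card (insert i (?N \<inter> S v c z)) = card (S v c z)"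
      using z card_mono[OF finite_S sz] by simp
    then have Sz: "S v c z = insert i (?N \<inter> S v c z)" using card_subset_eq[OF finite_S sz] by simp
    have "\<not> ?N \<subseteq> S v c z"
    proof
      assume "?N \<subseteq> S v c z"
      then have "insert i ?N \<subseteq> S v c z" using z by auto
      then have "card (insert i ?N) \<le> card (S v c z)" by (intro card_mono finite_S)
      then show False using i N z by simp
    qed
    then obtain r where r: "r \<in> ?N" "r \<notin> S v c z" by auto
    obtain u where u: "{w, u} \<in> H v" "c {w, u} \<in> S v c z" "u \<noteq> z"
      using blocked[OF z(1-4) i(2,3) r] by blast
    have "c {w, u} \<in> ?P" using u seenI[of w u "H v" c] by auto
    then have "c {w, u} = i" using Sz u by auto
    then show False using nbr_eq[OF u(1) z(1)] u z by simp
  qed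
  \<comment> \<open>Both obstacles would use the one color at \<open>w\<close> besides
    \<open>p\<close>, \<open>a\<close> and \<open>b\<close>, so a single chain would join
    \<open>w\<close>, \<open>za\<close> and \<open>zb\<close>, which all miss
    \<open>r\<close>.\<close>
  have "r \<in> S v c za \<union> S v c zb" if r: "r \<in> ?N" for r
  proof (rule ccontr)
    assume nr: "r \<notin> S v c za \<union> S v c zb"
    obtain u where u: "{w, u} \<in> H v" "c {w, u} \<noteq> p" "u \<noteq> za" "r \<in> S v c u"
      "chain (H v) c r (c {w, u}) za w"
      using blocked[OF za(1-4) ab(3,5) r] nr by blast
    obtain u' where u': "{w, u'} \<in> H v" "c {w, u'} \<noteq> p" "u' \<noteq> zb" "r \<in> S v c u'"
      "chain (H v) c r (c {w, u'}) zb w"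
      using blocked[OF zb(1-4) ab(4,6) r] nr by blast
    have "u \<noteq> zb" "u' \<noteq> za" using u u' nr by auto
    have "c {w, s} \<in> ?P - {p, a, b}"
      if s: "{w, s} \<in> H v" "c {w, s} \<noteq> p" "s \<noteq> za" "s \<noteq> zb" for s
    proof -
      have "c {w, s} \<in> ?P" using s(1) by (rule seenI) simp
      moreover have "c {w, s} \<noteq> a" using nbr_eq[OF s(1) za(1)] s(3) za(2) by auto
      moreover have "c {w, s} \<noteq> b" using nbr_eq[OF s(1) zb(1)] s(4) zb(2) by auto
      ultimately show ?thesis using s(2) by blast
    qed
    then have in1: "c {w, u} \<in> ?P - {p, a, b}" "c {w, u'} \<in> ?P - {p, a, b}"
      using u(1-3) u'(1-3) \<open>u \<noteq> zb\<close> \<open>u' \<noteq> za\<close> by blast+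
    have "card (?P - {p, a, b}) = card ?P - card {p, a, b}"
      by (rule card_Diff_subset) (use p ab in auto)
    moreover have "card {p, a, b} = 3" using ab by simp
    ultimately have "card (?P - {p, a, b}) = 1" using N by simp
    then obtain s where "?P - {p, a, b} = {s}" by (rule card_1_singletonE)
    then have "c {w, u} = c {w, u'}" using in1 by (metis singletonD)
    then have "chain (H v) c r (c {w, u}) w zb" using chain_sym[OF u'(5)] by simp
    then show False
      using chain_ends[OF chain_sym[OF u(5)], of zb] za(5) zb(5) zab nr r by blast
  qed
  then have "?N = (?N \<inter> S v c za) \<union> (?N \<inter> S v c zb)" by auto
  then have "card ?N \<le> card (?N \<inter> S v c za) + card (?N \<inter> S v c zb)"
    using card_Un_le by metis
  then show False using few[OF za(1-4,6,7) ab(1,3,5)] few[OF zb(1-4,6,7) ab(2,4,6)] N by simp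
qed

lemma not_five:
  assumes t: "three v x y w"
  shows "\<not> five w"
proof
  assume f: "five w"
  have e: "{v, w} \<in> E" using three_edges[OF t] by simp
  show False
  proof (rule exists_mixed[OF t])
    fix c assume c: "col (H v) c"
    show "3 \<le> card (miss v c w)" using miss_card_5[OF c e f] by simp
  qed (use five_both[OF t f] not_five_mixed[OF t f] not_five_mixed[OF three_swap[OF t] f] in blast)+
qed

section \<open>Vertices with a neighbor of degree two\<close>

text \<open>The vertex \<open>u\<close> comes on top of the at least three elements of
  \<open>big x\<close>, as its own degree is two.\<close>

lemma two_nbr_degree:
  assumes nb: "{s. {u, s} \<in> E} = {w, x}" and "w \<noteq> x"
  shows "4 \<le> degree E x" "4 \<le> degree E w" "degree E u = 2"
proof -
  show u: "degree E u = 2" using nb \<open>w \<noteq> x\<close> by (simp add: degree_eq_nbrs[OF graph])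
  have *: "4 \<le> degree E x" if nb: "{s. {u, s} \<in> E} = {w, x}" and "w \<noteq> x" for w x
  proof -
    have "{u, x} \<in> E" using nb by auto
    then have "insert u (big x) \<subseteq> {s. {x, s} \<in> E}" by (auto simp: big_def insert_commute)
    then have "card (insert u (big x)) \<le> degree E x"
      using card_mono[OF finite_nbrs[OF graph]] by (simp add: degree_eq_nbrs[OF graph])
    moreover have "u \<notin> big x" using u by (simp add: big_def)
    ultimately show ?thesis using card_big_two_nbr[OF that] finite_big by simp
  qed
  show "4 \<le> degree E x" by (rule *[OF assms])
  show "4 \<le> degree E w" by (rule *[of x w]) (use assms in auto)
qed

lemma degree_2_nbrs:
  assumes "{v, u} \<in> E" "degree E u = 2"
  obtains y where "{s. {u, s} \<in> E} = {y, v}" "y \<noteq> v"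
proof -
  have "card {s. {u, s} \<in> E} = 2" "v \<in> {s. {u, s} \<in> E}"
    using assms by (auto simp: degree_eq_nbrs[OF graph] insert_commute)
  then obtain a b where "{s. {u, s} \<in> E} = {a, b}" "a \<noteq> b" "v \<in> {a, b}" by (auto simp: card_2_iff)
  then show ?thesis using that[of a] that[of b] by (auto simp: insert_commute)
qed

end

section \<open>A vertex with a neighbor of degree two and few neighbors of larger degree\<close>

locale few_big = critical +
  fixes v u0 w
  assumes nb: "{s. {u0, s} \<in> E} = {w, v}" and wv: "w \<noteq> v"
    and card_big_le: "card (big v) \<le> 3"
    and few_three: "card {r. {v, r} \<in> E \<and> degree E r = 3} \<le> 1"
begin

definition U :: "'a set" where
  "U = {u. {v, u} \<in> E \<and> degree E u = 2}"

definition A :: "('a set \<Rightarrow> nat) \<Rightarrow> nat set" where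
  "A c = (\<lambda>r. c {v, r}) ` big v"

lemma edges: "{u0, w} \<in> E" "{u0, v} \<in> E"
  using nb by auto

lemma degrees: "4 \<le> degree E v" "4 \<le> degree E w" "degree E u0 = 2"
  using two_nbr_degree[OF nb wv] by auto

lemma u0: "u0 \<in> U"
  using edges degrees by (auto simp: U_def insert_commute)

lemma Ue: "u \<in> U \<Longrightarrow> {v, u} \<in> E" "u \<in> U \<Longrightarrow> degree E u = 2"
  by (auto simp: U_def)

lemma U_neq: "u \<in> U \<Longrightarrow> u \<noteq> v" "u \<in> U \<Longrightarrow> u \<noteq> w" "u \<in> U \<Longrightarrow> u \<notin> big v"
  using degrees by (auto simp: U_def big_def)

lemma U_nbrs:
  assumes "u \<in> U"
  obtains y where "{s. {u, s} \<in> E} = {y, v}" "y \<noteq> v" "4 \<le> degree E y"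
  using degree_2_nbrs[of v u] assms two_nbr_degree by (metis Ue)

lemma card_big: "card (big v) = 3"
  using card_big_two_nbr[OF nb wv] card_big_le by simp

lemma three_unique: "{v, r} \<in> E \<Longrightarrow> degree E r = 3 \<Longrightarrow> {v, r'} \<in> E \<Longrightarrow> degree E r' = 3 \<Longrightarrow> r = r'"
  using few_three card_le_Suc0_iff_eq[of "{r. {v, r} \<in> E \<and> degree E r = 3}"]
    finite_subset[OF _ finite_nbrs[OF graph, of v], of "{r. {v, r} \<in> E \<and> degree E r = 3}"]
  by auto

lemma nbr_cases:
  assumes "{v, r} \<in> E"
  obtains "r \<in> big v" | "r \<in> U" | "degree E r = 3"
proof -
  have "2 \<le> degree E r" using degree_ge_2[of r v] assms by (simp add: insert_commute)
  then show ?thesis using that assms by (fastforce simp: big_def U_def)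
qed

text \<open>\<open>two_nbr_big\<close> gives one inclusion; \<open>y\<close> misses at least three
  colors, while \<open>v\<close> has only three big neighbors. So in every such coloring the colors
  missing at \<open>y\<close> are forced.\<close>

lemma miss_eq_A:
  assumes "u \<in> U" "{s. {u, s} \<in> E} = {y, v}" "y \<noteq> v" "col (H u) c"
  shows "miss u c y = A c"
proof -
  have e: "{u, y} \<in> E" using assms by auto
  have "miss u c y \<subseteq> A c"
    using two_nbr_big[OF assms(2-4)] by (auto simp: A_def)
  moreover have "3 \<le> card (miss u c y)" using card_miss[OF assms(4) e] degree_le[of y] by simp
  moreover have "card (A c) \<le> 3" unfolding A_def using card_image_le[OF finite_big] card_big by metis
  moreover have "finite (A c)" using finite_big by (simp add: A_def)
  ultimately show ?thesis by (intro card_seteq) auto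
qed

lemma A_facts:
  assumes c: "col (H u0) c"
  shows "miss u0 c w = A c" "card (A c) = 3" "A c \<subseteq> S u0 c v"
    "\<And>r. r \<in> big v \<Longrightarrow> {v, r} \<in> H u0" "w \<notin> big v"
proof -
  show *: "miss u0 c w = A c" by (rule miss_eq_A[OF u0 nb wv c])
  have "3 \<le> card (miss u0 c w)" using card_miss[OF c edges(1)] degree_le[of w] by simp
  moreover have "card (A c) \<le> 3" unfolding A_def using card_image_le[OF finite_big] card_big by metis
  ultimately show "card (A c) = 3" using * by simp
  show e: "{v, r} \<in> H u0" if "r \<in> big v" for r
    using that U_neq(1,3)[OF u0] by (auto simp: big_def del_def)
  then show "A c \<subseteq> S u0 c v" by (auto simp: A_def intro: seenI)
  show "w \<notin> big v"
  proof
    assume w: "w \<in> big v"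
    then have "c {w, v} \<in> S u0 c w" 
      using e[OF w] seenI[of w v "H u0" c] by (simp add: insert_commute)
    moreover have "c {w, v} \<in> A c" using w by (auto simp: A_def insert_commute)
    ultimately show False using * by auto
  qed
qed

lemma inj_A:
  assumes c: "col (H u0) c" and "r \<in> big v" "{v, s} \<in> H u0" "c {v, s} = c {v, r}"
  shows "s = r"
  using coloring.nbr_eq[OF c assms(3) A_facts(4)[OF c assms(2)] assms(4)] .

lemma chain_free:
  assumes c: "col (H u0) c" and "p \<in> A c" "q \<in> miss u0 c v"
  shows "chain (H u0) c p q w v"
proof (rule key2[OF nb wv c])
  have "p \<in> miss u0 c w" using assms A_facts(1)[OF c] by simp
  then show "p < M + 2" "p \<notin> S u0 c w" by auto
  show "p \<noteq> q" using assms A_facts(3)[OF c] by auto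
qed (use assms in auto)

text \<open>Otherwise the color of \<open>v u\<close> can be moved to \<open>v u0\<close>, with
  \<open>p\<close> on \<open>u0 w\<close>, and \<open>u\<close> becomes the uncolored vertex. The
  chain that then must join its other neighbor \<open>y\<close> to \<open>v\<close> conflicts with
  the one from \<open>w\<close>.\<close>

lemma chain_two:
  assumes c: "col (H u0) c" and p: "p \<in> A c" and u: "u \<in> U" "u \<noteq> u0"
  shows "chain (del (H u0) u) c p (c {v, u}) w v"
proof (rule ccontr)
  assume not: "\<not> chain (del (H u0) u) c p (c {v, u}) w v"
  define l where "l = c {v, u}"
  interpret coloring "H u0" "M + 2" c by fact
  note Af = A_facts[OF c]
  obtain y where y: "{s. {u, s} \<in> E} = {y, v}" "y \<noteq> v" "4 \<le> degree E y" using U_nbrs[OF u(1)] .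
  have uyE: "{u, y} \<in> E" using y(1) by blast
  have yu0: "y \<noteq> u0" using y(3) degrees by auto
  have ue: "{v, u} \<in> H u0" "{u, v} \<in> H u0" "{u, y} \<in> H u0"
    using Ue(1)[OF u(1)] uyE u(2) yu0 U_neq(1)[OF u0] by (simp_all add: del_def insert_commute)
  have pw: "p \<notin> S u0 c w" "p < M + 2" using Af(1) p by auto
  have lv: "l \<in> S u0 c v" using ue by (auto simp: l_def intro: seenI)
  have lA: "l \<notin> A c"
  proof
    assume "l \<in> A c"
    then obtain r where r: "r \<in> big v" "c {v, u} = c {v, r}" by (auto simp: A_def l_def)
    then have "u = r" using inj_A[OF c r(1) ue(1)] by simp
    then show False using r U_neq(3)[OF u(1)] by simp
  qed
  have dd: "del (H u) u0 = del (H u0) u" by (auto simp: del_def)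
  define f where "f = (\<lambda>s. if s = w then p else l)"
  let ?c = "paint c u0 f"
  have nbu0: "s = w \<or> s = v" if "{u0, s} \<in> H u" for s using that nb by (auto simp: del_def)
  have c': "col (H u) ?c"
  proof (rule coloring_paint[OF graph_del[OF critical.graph[OF critical_axioms]]])
    show "col (del (H u) u0) c" unfolding dd by (rule coloring_del)
    fix s assume s: "{u0, s} \<in> H u"
    show "f s < M + 2" using seen_less[OF lv] pw by (simp add: f_def)
    have "p \<notin> seen (del (H u0) u) c w" using pw seen_mono[OF del_subset] by fast
    moreover have "l \<notin> seen (del (H u0) u) c v"
      using seen_del[of u v] ue U_neq(1)[OF u(1)] by (simp add: l_def insert_commute)
    ultimately show "f s \<notin> seen (del (H u) u0) c s" using nbu0[OF s] wv by (auto simp: f_def dd)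
    fix s' assume s': "{u0, s'} \<in> H u" "s \<noteq> s'"
    show "f s \<noteq> f s'" using nbu0[OF s] nbu0[OF s'(1)] s'(2) wv p lA by (auto simp: f_def)
    show "\<not> chain (del (H u) u0) c (f s) (f s') s s'"
      using nbu0[OF s] nbu0[OF s'(1)] s'(2) wv not
      by (auto simp: f_def dd l_def dest: chain_flip)
  qed
  have "?c {v, r} = c {v, r}" if "r \<in> big v" for r
    using that U_neq[OF u0] by (intro paint_off) auto
  then have Aeq: "A ?c = A c" by (auto simp: A_def)
  have my: "miss u ?c y = A c" using miss_eq_A[OF u(1) y(1,2) c'] Aeq by simp
  have yw: "y \<noteq> w"
  proof
    assume "y = w"
    have "{w, u0} \<in> H u" using edges u U_neq(2)[OF u(1)] by (auto simp: del_def insert_commute)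
    moreover have "?c {w, u0} = p" by (simp add: insert_commute[of w] f_def)
    ultimately have "p \<in> S u ?c w" by (rule seenI)
    then show False using my p \<open>y = w\<close> by auto
  qed
  \<comment> \<open>The color \<open>i\<close> avoids \<open>p\<close> to keep the chain clear of
    the edges at \<open>u0\<close>, and \<open>c {u, y}\<close> so that \<open>y\<close> misses
    \<open>i\<close> in \<open>H u0\<close> as well.\<close>
  have "\<not> A c \<subseteq> {p, c {u, y}}"
  proof
    assume "A c \<subseteq> {p, c {u, y}}"
    then have "card (A c) \<le> card {p, c {u, y}}" by (intro card_mono) auto
    also have "\<dots> \<le> 2" by (cases "p = c {u, y}") auto
    finally show False using Af(2) by simp
  qed
  then obtain i where i: "i \<in> A c" "i \<noteq> p" "i \<noteq> c {u, y}" by auto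
  have "card (miss u0 c v) \<noteq> 0" using card_miss[OF c edges(2)] degree_le[of v] by linarith
  then obtain r where r: "r \<in> miss u0 c v" by (metis card.empty ex_in_conv)
  have rv: "r \<notin> S u ?c v"
  proof
    assume "r \<in> S u ?c v"
    then obtain s where s: "{v, s} \<in> H u" "?c {v, s} = r"
      using seenE[OF graph_del[OF critical.graph[OF critical_axioms]], of r u ?c v] by metis
    show False
    proof (cases "s = u0")
      case True
      then have "r = l" using s wv by (simp add: insert_commute f_def)
      then show False using lv r by simp
    next
      case False
      then have "{v, s} \<in> H u0" "c {v, s} = r"
        using s U_neq(1)[OF u0] by (auto simp: del_def)
      then show False using r seenI[of v s "H u0" c r] by auto
    qed
  qed
  have ri: "r \<noteq> i" "r \<noteq> p" "r \<noteq> l" using r i p Af(3) lv by auto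
  have "chain (H u) ?c i r y v"
    by (rule key2[OF y(1,2) c']) (use i my rv r ri in auto)
  then have 1: "chain (H u0) c i r y v"
  proof (rule chain_mono)
    show "bic (H u) ?c i r \<subseteq> bic (H u0) c i r"
    proof
      fix e assume e: "e \<in> bic (H u) ?c i r"
      have "u0 \<notin> e"
      proof
        assume "u0 \<in> e"
        then obtain s where "e = {u0, s}" using graph_edge[OF critical.graph[OF critical_axioms], of e u0] e
          by (auto simp: bic_def del_def)
        then show False using e nbu0[of s] i ri lA by (auto simp: bic_def f_def split: if_splits)
      qed
      then show "e \<in> bic (H u0) c i r" using e by (auto simp: bic_def del_def)
    qed
  qed
  have iy: "i \<notin> S u0 c y"
  proof
    assume "i \<in> S u0 c y"
    then obtain s where s: "{y, s} \<in> H u0" "c {y, s} = i" using seenE[OF graph] by metis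
    have "s \<noteq> u" using s i by (auto simp: insert_commute)
    moreover have "y \<noteq> u" using y(3) Ue(2)[OF u(1)] by auto
    ultimately have "{y, s} \<in> H u" "?c {y, s} = i" using s by (auto simp: del_def)
    then have "i \<in> S u ?c y" by (rule seenI)
    then show False using my i by auto
  qed
  have "chain (H u0) c i r w v" by (rule chain_free[OF c i(1) r])
  then show False
    using chain_ends[OF chain_sym[OF 1] chain_sym] y yw wv i iy r Af(1) by auto
qed

text \<open>The edge \<open>v s\<close> can be recolored with one of the at least three colors
  missing at \<open>v\<close>, since the at most two other colors at \<open>s\<close> rule out at
  most one each. Then \<open>v\<close> misses the old color, \<open>key2\<close> provides the chain,
  and deleting \<open>v\<close> removes the recolored edge.\<close>

lemma chain_three:
  assumes c: "col (H u0) c" and r: "r \<in> big v" and s: "{v, s} \<in> E" "degree E s = 3"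
  shows "chain (del (H u0) v) c (c {v, r}) (c {v, s}) w r"
proof -
  interpret coloring "H u0" "M + 2" c by fact
  note Af = A_facts[OF c]
  define l where "l = c {v, s}"
  have su0: "s \<noteq> u0" using s degrees by auto
  have se: "{v, s} \<in> H u0" using s su0 U_neq(1)[OF u0] by (auto simp: del_def)
  have sw: "s \<noteq> w" "s \<noteq> v" using s degrees by auto
  have sr: "s \<noteq> r'" if "r' \<in> big v" for r' using s that by (auto simp: big_def)
  have lv: "l \<in> S u0 c v" "l \<in> S u0 c s"
    using se by (auto simp: l_def insert_commute[of v] intro: seenI)
  let ?C = "miss u0 c v"
  \<comment> \<open>\<open>g i\<close> has at most one element, the color that the color \<open>i\<close> at \<open>s\<close> rules out for \<open>v s\<close>\<close>
  define g where "g = (\<lambda>i. if i \<in> ?C then {i} else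
    {q. \<exists>t. {v, t} \<in> H u0 \<and> c {v, t} = i \<and> t \<in> U \<and> q \<in> seen (del (H u0) v) c t})"
  have g: "finite (g i) \<and> card (g i) \<le> 1" for i
  proof (cases "i \<in> ?C \<or> \<not> (\<exists>t. {v, t} \<in> H u0 \<and> c {v, t} = i \<and> t \<in> U)")
    case True
    show ?thesis
    proof (cases "i \<in> ?C")
      case False
      then have "g i = {}" using True unfolding g_def by auto
      then show ?thesis by simp
    qed (simp add: g_def)
  next
    case False
    then obtain t where t: "{v, t} \<in> H u0" "c {v, t} = i" "t \<in> U" by blast
    have "t' = t" if "{v, t'} \<in> H u0" "c {v, t'} = i" for t'
      using nbr_eq[OF that(1) t(1)] that t by simp
    then have "{q. \<exists>t. {v, t} \<in> H u0 \<and> c {v, t} = i \<and> t \<in> U \<and> q \<in> seen (del (H u0) v) c t} =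
      seen (del (H u0) v) c t" using t by blast
    then have gi: "g i = seen (del (H u0) v) c t" using False unfolding g_def by presburger
    have "i \<in> S u0 c t" using t by (auto simp: insert_commute[of v] intro: seenI)
    then have "seen (del (H u0) v) c t = S u0 c t - {i}" "card (S u0 c t - {i}) = card (S u0 c t) - 1"
      using seen_del[of v t] t U_neq(1)[OF t(3)] by auto
    moreover have "card (S u0 c t) \<le> 2" using degree_seen_le[OF c del_subset, of t] Ue(2)[OF t(3)] by simp
    ultimately show ?thesis using gi finite_S by simp
  qed
  have "card (\<Union>i\<in>S u0 c s - {l}. g i) \<le> (\<Sum>i\<in>S u0 c s - {l}. card (g i))"
    using finite_S by (intro card_UN_le) auto
  also have "\<dots> \<le> (\<Sum>i\<in>S u0 c s - {l}. 1)" using g by (intro sum_mono) auto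
  also have "\<dots> = card (S u0 c s) - 1" using lv finite_S by simp
  also have "\<dots> \<le> 2" using degree_seen_le[OF c del_subset, of s] s by simp
  finally have "card (\<Union>i\<in>S u0 c s - {l}. g i) \<le> 2" .
  moreover have "3 \<le> card ?C" using card_miss[OF c edges(2)] degree_le[of v] by simp
  ultimately have "\<not> ?C \<subseteq> (\<Union>i\<in>S u0 c s - {l}. g i)"
    using card_mono[of "\<Union>i\<in>S u0 c s - {l}. g i" ?C] g finite_S by fastforce
  then obtain q where q: "q \<in> ?C" "\<And>i. i \<in> S u0 c s - {l} \<Longrightarrow> q \<notin> g i" by blast
  have ql: "q \<noteq> l" using q lv by auto
  have qs: "q \<notin> S u0 c s"
  proof
    assume "q \<in> S u0 c s"
    then show False using q(2)[of q] q(1) ql by (simp add: g_def)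
  qed
  have sub: "seen (del (H u0) v) c t \<subseteq> S u0 c t" for t by (rule seen_mono[OF del_subset])
  let ?c = "c({v, s} := q)"
  have c': "col (H u0) ?c"
  proof (rule coloring_recolor[OF c se])
    fix t assume t: "{v, t} \<in> H u0" "t \<noteq> s"
    define i where "i = c {v, t}"
    have il: "i \<noteq> l" using nbr_eq[OF t(1) se] t(2) by (auto simp: i_def l_def)
    show "\<not> chain (del (H u0) v) c q (c {v, t}) s t"
    proof
      assume "chain (del (H u0) v) c q (c {v, t}) s t"
      then have ch: "chain (del (H u0) v) c q i s t" by (simp add: i_def)
      have iS: "i \<in> S u0 c s" using chain_seen(1)[OF ch] t(2) qs sub by auto
      have "{v, t} \<in> E" using t del_subset by fast
      then show False
      proof (cases rule: nbr_cases)
        \<comment> \<open>The chain in \<open>i\<close> and \<open>q\<close> that ends at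
          \<open>v\<close> already has its other end at \<open>w\<close>.\<close>
        case 1
        have "chain (H u0) c q i s v"
          by (rule chain_trans[OF chain_subset[OF ch del_subset]])
            (rule chain_edge, use t in \<open>auto simp: insert_commute i_def\<close>)
        then have a: "chain (H u0) c i q v s" by (rule chain_flip)
        have "i \<in> A c" using 1 by (auto simp: A_def i_def)
        then have b: "chain (H u0) c i q w v" using chain_free[OF c _ q(1)] by simp
        show False
          using chain_ends[OF a chain_sym[OF b]] sw wv q qs Af(1) \<open>i \<in> A c\<close> by auto
      next
        case 2
        have "i \<notin> seen (del (H u0) v) c t" using vertex_iff(1)[OF t(1)] by (simp add: i_def)
        then have "q \<in> seen (del (H u0) v) c t"
          using chain_seen(2)[OF chain_sym[OF ch]] t(2) by auto
        moreover have "i \<notin> ?C" using t by (auto simp: i_def intro: seenI)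
        ultimately have "q \<in> g i" using t 2 by (auto simp: g_def i_def)
        then show False using q(2)[of i] iS il by auto
      next
        case 3
        then show False using three_unique[OF s \<open>{v, t} \<in> E\<close>] t(2) by simp
      qed
    qed
  qed (use q qs in auto)
  have at: "?c {v, t} = (if t = s then q else c {v, t})" for t by (auto simp: doubleton_eq_iff)
  have Sw: "S u0 ?c w = S u0 c w" using sw wv by (auto intro!: seen_cong)
  have lv': "l \<notin> S u0 ?c v"
    by (rule seen_recolor[OF se]) (use ql in \<open>auto simp: l_def\<close>)
  define p where "p = c {v, r}"
  have p: "p \<in> A c" using r by (auto simp: p_def A_def)
  then have pw: "p \<notin> S u0 c w" "p < M + 2" using Af(1) by auto
  have pl: "p \<noteq> l" using inj_A[OF c r se] sr[OF r] by (auto simp: p_def l_def)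
  have re: "{v, r} \<in> H u0" by (rule Af(4)[OF r])
  have "chain (H u0) ?c p l w v"
    by (rule key2[OF nb wv c']) (use pw Sw lv' pl seen_less[OF lv(1)] in auto)
  then have "chain (del (H u0) v) ?c p l w r"
    using coloring.chain_nbr_at(3)[OF c' _ wv lv' _ re] pw Sw at[of r] sr[OF r] by (auto simp: p_def)
  moreover have "bic (del (H u0) v) ?c p l = bic (del (H u0) v) c p l"
    by (auto simp: bic_def del_def)
  ultimately show ?thesis using chain_cong by (metis p_def l_def)
qed

text \<open>A color outside \<open>A c\<close> is missing at \<open>v\<close> or lies on an edge
  from \<open>v\<close> to a vertex of degree two or three; \<open>chain_free\<close>,
  \<open>chain_two\<close> and \<open>chain_three\<close> cover these cases.\<close>

lemma chain_all:
  assumes c: "col (H u0) c" and r: "r \<in> big v" and q: "q < M + 2" "q \<notin> A c"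
  shows "chain (del (H u0) v) c (c {v, r}) q w r"
proof -
  interpret coloring "H u0" "M + 2" c by fact
  note Af = A_facts[OF c]
  define p where "p = c {v, r}"
  have p: "p \<in> A c" using r by (auto simp: p_def A_def)
  then have pw: "p \<notin> S u0 c w" "p < M + 2" using Af(1) by auto
  have re: "{v, r} \<in> H u0" by (rule Af(4)[OF r])
  have "chain (del (H u0) v) c p q w r"
  proof (cases "q \<in> S u0 c v")
    case False
    then have "chain (H u0) c p q w v" using chain_free[OF c p] q by simp
    then show ?thesis using chain_nbr_at(3)[OF _ wv _ _ re] False pw by (simp add: p_def)
  next
    case True
    then obtain s where s: "{v, s} \<in> H u0" "c {v, s} = q" using seenE[OF graph] by metis
    then have "{v, s} \<in> E" using del_subset by fast
    then show ?thesis
    proof (cases rule: nbr_cases)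
      case 1
      then show ?thesis using s q by (auto simp: A_def)
    next
      case 2
      have su0: "s \<noteq> u0" using s by (auto simp: del_def)
      have sv: "s \<noteq> v" "s \<noteq> r" using U_neq[OF 2] r by auto
      have ch: "chain (del (H u0) s) c p q w v" using chain_two[OF c p 2 su0] s by simp
      have "q \<notin> seen (del (H u0) s) c v" using seen_del[of s v] s sv by (simp add: insert_commute)
      moreover have "p \<notin> seen (del (H u0) s) c w" using pw seen_mono[OF del_subset] by fast
      moreover have "{v, r} \<in> del (H u0) s" using re sv by (auto simp: del_def)
      ultimately have "chain (del (del (H u0) s) v) c p q w r"
        using coloring.chain_nbr_at(3)[OF coloring_del ch wv] by (simp add: p_def)
      then show ?thesis by (rule chain_subset) (auto simp: del_def)
    next
      case 3
      then show ?thesis using chain_three[OF c r \<open>{v, s} \<in> E\<close>] s by (simp add: p_def)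
    qed
  qed
  then show ?thesis by (simp add: p_def)
qed

text \<open>By \<open>chain_all\<close>, \<open>r\<close> sees all \<open>M - 1\<close> colors
  outside \<open>A c\<close>. With the color of \<open>v r\<close> these are \<open>M\<close>
  colors, as many as the degree bound allows.\<close>

lemma seen_big:
  assumes c: "col (H u0) c" and r: "r \<in> big v"
  shows "S u0 c r = insert (c {v, r}) ({..<M + 2} - A c)"
proof -
  interpret coloring "H u0" "M + 2" c by fact
  note Af = A_facts[OF c]
  let ?F = "{..<M + 2} - A c"
  have re: "{v, r} \<in> H u0" by (rule Af(4)[OF r])
  have "A c \<subseteq> {..<M + 2}" using Af(1) by auto
  then have cF: "Suc (card ?F) = M"
    using missing_card[of "A c" "M + 2"] Af(2) degree_le[of v] degrees by simp
  have rw: "w \<noteq> r" using Af(5) r by auto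
  have "q \<in> S u0 c r" if q: "q \<in> ?F" for q
  proof -
    have "q \<in> seen (del (H u0) v) c r"
      using chain_seen(1)[OF chain_sym[OF chain_all[OF c r, of q]]] q rw vertex_iff(1)[OF re] by auto
    then show ?thesis using seen_mono[OF del_subset] by fast
  qed
  moreover have "c {v, r} \<in> S u0 c r" using re by (auto simp: insert_commute[of v] intro: seenI)
  ultimately have sub: "insert (c {v, r}) ?F \<subseteq> S u0 c r" by auto
  have "card (insert (c {v, r}) ?F) = M" using cF r by (simp add: A_def)
  then have "card (insert (c {v, r}) ?F) = card (S u0 c r)"
    using card_mono[OF finite_S sub] degree_seen_le[OF c del_subset, of r] degree_le[of r] by simp
  then show ?thesis using card_subset_eq[OF finite_S sub] by simp
qed

section \<open>Exchanging two of the three forced colors\<close>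

definition avoid :: "'a set \<Rightarrow> 'a set set" where
  "avoid W = {e \<in> E. e \<inter> W = {}}"

lemma avoid_subset: "avoid W \<subseteq> E"
  by (auto simp: avoid_def)

lemma graph_avoid: "graph (avoid W)"
  by (rule graph_subset[OF graph avoid_subset])

lemma del_avoid: "del (avoid (W - {u})) u = avoid (insert u W)"
  by (auto simp: avoid_def del_def)

lemma avoid_U_subset: "avoid U \<subseteq> H u0"
  using u0 by (auto simp: avoid_def del_def)

lemma big_avoid:
  assumes "r \<in> big v" "W \<subseteq> U"
  shows "{v, r} \<in> avoid W"
  using assms U_neq by (fastforce simp: avoid_def big_def)

text \<open>Once \<open>v\<close> is deleted, a vertex of \<open>U\<close> keeps at most one edge
  and misses one of the two colors. It could only be an end of the chain, but the ends are
  \<open>w\<close> and \<open>r\<close>. So the chain survives when all of \<open>U\<close> is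
  uncolored.\<close>

lemma chain_avoid:
  assumes c: "col (H u0) c" and r: "r \<in> big v" and q: "q < M + 2" "q \<notin> A c"
  shows "chain (del (avoid U) v) c (c {v, r}) q w r"
proof -
  define p where "p = c {v, r}"
  interpret coloring "H u0" "M + 2" c by fact
  interpret d: coloring "del (H u0) v" "M + 2" c by (rule coloring_del)
  note Af = A_facts[OF c]
  have ch: "chain (del (H u0) v) c p q w r" using chain_all[OF assms] by (simp add: p_def)
  have pw: "p \<notin> seen (del (H u0) v) c w"
    using Af(1) r seen_mono[of "del (H u0) v" "H u0" c w, OF del_subset] by (auto simp: A_def p_def)
  have pr: "p \<notin> seen (del (H u0) v) c r" using vertex_iff(1)[OF Af(4)[OF r]] by (simp add: p_def)
  have pq: "p \<noteq> q" using q r by (auto simp: A_def p_def)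
  have "chain (del (avoid U) v) c p q w r"
  proof (rule chain_restrict[OF ch])
    show "del (avoid U) v \<subseteq> del (H u0) v" using avoid_U_subset by (auto simp: del_def)
    fix e assume e: "e \<in> del (H u0) v" "e \<notin> del (avoid U) v"
    then obtain u where u: "u \<in> e" "u \<in> U" by (auto simp: avoid_def del_def)
    obtain y where y: "{s. {u, s} \<in> E} = {y, v}" "y \<noteq> v" using U_nbrs[OF u(2)] by metis
    have "seen (del (H u0) v) c u \<subseteq> {c {u, y}}"
    proof
      fix i assume "i \<in> seen (del (H u0) v) c u"
      then obtain s where "{u, s} \<in> del (H u0) v" "c {u, s} = i" using seenE[OF d.graph] by metis
      then show "i \<in> {c {u, y}}" using y by (auto simp: del_def)
    qed
    then have "p \<notin> seen (del (H u0) v) c u \<or> q \<notin> seen (del (H u0) v) c u" using pq by auto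
    then have "\<not> chain (del (H u0) v) c p q w u"
      using d.chain_ends[OF ch, of u] pw pr U_neq[OF u(2)] r Af(5) by metis
    then show "\<exists>u\<in>e. \<not> chain (del (H u0) v) c p q w u" using u by auto
  qed
  then show ?thesis by (simp add: p_def)
qed

text \<open>Outside \<open>v\<close> the neighbor \<open>s\<close> of degree three sees at most two
  colors, and the chain of each leads to at most one wrong target. So at most two ordered pairs are
  bad, and one of the three unordered pairs is good.\<close>

lemma good_pair:
  assumes c: "col (H u0) c"
  obtains a b h where "big v = {a, b, h}" "a \<noteq> b" "a \<noteq> h" "b \<noteq> h"
    "\<And>s. {v, s} \<in> E \<Longrightarrow> degree E s = 3 \<Longrightarrow>
      \<not> chain (del (avoid U) v) c (c {v, a}) (c {v, s}) b s \<and>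
      \<not> chain (del (avoid U) v) c (c {v, b}) (c {v, s}) a s"
proof (cases "\<exists>s. {v, s} \<in> E \<and> degree E s = 3")
  case False
  obtain a where "a \<in> big v" using card_big by fastforce
  then obtain b h where "big v = {a, b, h}" "a \<noteq> b" "a \<noteq> h" "b \<noteq> h"
    using card_three_elements[OF card_big] by metis
  then show ?thesis using that[of a b h] False by blast
next
  case True
  then obtain s where s: "{v, s} \<in> E" "degree E s = 3" by blast
  interpret coloring "H u0" "M + 2" c by fact
  note Af = A_facts[OF c]
  have suniq: "t = s" if "{v, t} \<in> E" "degree E t = 3" for t using three_unique that s by blast
  have sv: "v \<noteq> s" using s degrees by auto
  have se: "{v, s} \<in> H u0" using s degrees U_neq(1)[OF u0] by (auto simp: del_def)
  let ?D = "del (avoid U) v"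
  define l where "l = c {v, s}"
  have sub: "?D \<subseteq> del (H u0) v" using avoid_U_subset by (auto simp: del_def)
  interpret d: coloring ?D "M + 2" c
    by (rule coloring.coloring_subset[OF coloring_del[of v] sub])
  have seen_sub: "seen ?D c t \<subseteq> S u0 c t" for t
    by (rule seen_mono[OF order_trans[OF sub del_subset]])
  have ls: "l \<notin> seen ?D c s" using vertex_iff(1)[OF se] seen_mono[OF sub] by (auto simp: l_def)
  \<comment> \<open>\<open>bad a b\<close>: giving the color of \<open>v a\<close> to \<open>v b\<close> closes a cycle through \<open>s\<close>\<close>
  define bad where "bad = (\<lambda>a b. chain ?D c (c {v, a}) l b s)"
  have sb: "s \<noteq> r" if "r \<in> big v" for r using that s by (auto simp: big_def)
  have source: "c {v, a} \<in> seen ?D c s" if "bad a b" "b \<in> big v" for a b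
    using chain_seen(2)[OF chain_sym[of ?D c "c {v, a}" l b s]] that sb ls by (auto simp: bad_def)
  have missing: "c {v, a} \<notin> seen ?D c b" if "a \<in> big v" "b \<in> big v" "a \<noteq> b" for a b
  proof -
    have "c {v, a} \<noteq> c {v, b}" using inj_A[OF c that(2) Af(4)[OF that(1)]] that(3) by auto
    then have "c {v, a} \<notin> S u0 c b" using seen_big[OF c that(2)] that(1) by (auto simp: A_def)
    then show ?thesis using seen_sub by fast
  qed
  have target: "\<not> (bad a b \<and> bad a b')"
    if "a \<in> big v" "b \<in> big v" "b' \<in> big v" "a \<noteq> b" "a \<noteq> b'" "b \<noteq> b'" for a b b'
    using d.chain_ends[of "c {v, a}" l s b b'] that sb ls missing
    by (auto simp: bad_def dest: chain_sym)
  have card_s: "card (seen ?D c s) \<le> 2"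
  proof -
    have "seen ?D c s \<subseteq> S u0 c s - {l}" using seen_sub ls by auto
    then have "card (seen ?D c s) \<le> card (S u0 c s - {l})" using finite_S by (intro card_mono) auto
    also have "\<dots> = card (S u0 c s) - 1"
      using se by (intro card_Diff_singleton) (auto simp: l_def insert_commute[of v] intro: seenI)
    also have "\<dots> \<le> 2" using degree_seen_le[OF c del_subset, of s] s by simp
    finally show ?thesis .
  qed
  obtain a where a: "a \<in> big v" using card_big by fastforce
  obtain b h where R: "big v = {a, b, h}" "a \<noteq> b" "a \<noteq> h" "b \<noteq> h"
    using card_three_elements[OF card_big a] .
  have inR: "a \<in> big v" "b \<in> big v" "h \<in> big v" using R by auto
  have "\<not> (c {v, a} \<in> seen ?D c s \<and> c {v, b} \<in> seen ?D c s \<and> c {v, h} \<in> seen ?D c s)"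
  proof
    assume "c {v, a} \<in> seen ?D c s \<and> c {v, b} \<in> seen ?D c s \<and> c {v, h} \<in> seen ?D c s"
    then have "A c \<subseteq> seen ?D c s" using R by (auto simp: A_def)
    then have "card (A c) \<le> card (seen ?D c s)" using finite_seen[OF d.graph] by (intro card_mono)
    then show False using card_s Af(2) by simp
  qed
  then have "(\<not> bad a b \<and> \<not> bad b a) \<or> (\<not> bad a h \<and> \<not> bad h a) \<or> (\<not> bad b h \<and> \<not> bad h b)"
    using source[of a b] source[of b a] source[of a h] source[of h a] source[of b h] source[of h b]
      target[of a b h] target[of b a h] target[of h a b] inR R by blast
  then consider "\<not> bad a b" "\<not> bad b a" | "\<not> bad a h" "\<not> bad h a" | "\<not> bad b h" "\<not> bad h b"
    by blast
  then show ?thesis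
  proof cases
    case 1
    show ?thesis by (rule that[of a b h]) (use 1 R suniq in \<open>auto simp: bad_def l_def\<close>)
  next
    case 2
    show ?thesis by (rule that[of a h b]) (use 2 R suniq in \<open>auto simp: bad_def l_def\<close>)
  next
    case 3
    show ?thesis by (rule that[of b h a]) (use 3 R suniq in \<open>auto simp: bad_def l_def\<close>)
  qed
qed

text \<open>With \<open>U\<close> uncolored, only the neighbor of degree three could obstruct the
  exchange on \<open>v a\<close> and \<open>v b\<close>, since the big neighbors miss each other's
  colors. The chain from \<open>w\<close> through \<open>a\<close> then no longer reaches
  \<open>v\<close>, so \<open>u0\<close> can be colored, and \<open>w\<close> sees a color of
  \<open>A c\<close>.\<close>

lemma swap_big:
  obtains c c' a b h where "col (H u0) c" "big v = {a, b, h}" "a \<noteq> b" "a \<noteq> h" "b \<noteq> h"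
    "col (avoid (U - {u0})) c'" "\<And>e. e \<in> del (avoid U) v \<Longrightarrow> c' e = c e"
    "c' {v, h} = c {v, h}" "c' {v, a} = c {v, b}" "c' {v, b} = c {v, a}" "c' {u0, w} = c {v, a}"
proof -
  have "H u0 \<subset> E" using edges by (auto simp: del_def)
  then obtain c where c: "col (H u0) c" using subcolorable by blast
  interpret coloring "H u0" "M + 2" c by fact
  note Af = A_facts[OF c]
  obtain a b h where R: "big v = {a, b, h}" "a \<noteq> b" "a \<noteq> h" "b \<noteq> h"
    and good: "\<And>s. {v, s} \<in> E \<Longrightarrow> degree E s = 3 \<Longrightarrow>
      \<not> chain (del (avoid U) v) c (c {v, a}) (c {v, s}) b s \<and>
      \<not> chain (del (avoid U) v) c (c {v, b}) (c {v, s}) a s"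
    by (rule good_pair[OF c]) blast
  have inR: "a \<in> big v" "b \<in> big v" "h \<in> big v" using R by auto
  let ?E = "avoid U" and ?D = "del (avoid U) v"
  have c0: "col ?E c" by (rule coloring_subset[OF avoid_U_subset])
  interpret e: coloring ?E "M + 2" c by (rule c0)
  have sub: "?D \<subseteq> H u0" using avoid_U_subset by (auto simp: del_def)
  have seen_sub: "seen ?D c t \<subseteq> S u0 c t" "seen ?E c t \<subseteq> S u0 c t" for t
    by (rule seen_mono[OF sub], rule seen_mono[OF avoid_U_subset])
  have eR: "{v, r} \<in> ?E" if "r \<in> big v" for r using big_avoid that by auto
  have missing: "c {v, r} \<notin> S u0 c r'" if "r \<in> big v" "r' \<in> big v" "r \<noteq> r'" for r r'
  proof -
    have "c {v, r} \<noteq> c {v, r'}" using inj_A[OF c that(2) Af(4)[OF that(1)]] that(3) by auto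
    then show ?thesis using seen_big[OF c that(2)] that(1) by (auto simp: A_def)
  qed
  let ?c1 = "c({v, a} := c {v, b}, {v, b} := c {v, a})"
  have c1: "col ?E ?c1"
  proof (rule coloring_swap[OF c0 eR eR])
    show "c {v, b} \<notin> seen ?E c a" "c {v, a} \<notin> seen ?E c b"
      using missing[of b a] missing[of a b] inR R seen_sub(2)[of a] seen_sub(2)[of b] by auto
    fix s assume s: "{v, s} \<in> ?E" "s \<noteq> a" "s \<noteq> b"
    then have sE: "{v, s} \<in> E" using avoid_subset by fast
    then have "\<not> chain ?D c (c {v, b}) (c {v, s}) a s \<and> \<not> chain ?D c (c {v, a}) (c {v, s}) b s"
    proof (cases rule: nbr_cases)
      case 1
      then show ?thesis
        using missing[of b a] missing[of a b] missing[of s a] missing[of s b] inR R s seen_sub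
          chain_isolated[of "c {v, b}" ?D c a "c {v, s}" s]
          chain_isolated[of "c {v, a}" ?D c b "c {v, s}" s] by blast
    next
      case 2
      then show ?thesis using s by (auto simp: avoid_def)
    next
      case 3
      then show ?thesis using good[OF sE] by simp
    qed
    then show "\<not> chain ?D c (c {v, b}) (c {v, s}) a s" "\<not> chain ?D c (c {v, a}) (c {v, s}) b s"
      by auto
  qed (use inR R in auto)
  have at: "?c1 {v, s} = (if s = a then c {v, b} else if s = b then c {v, a} else c {v, s})" for s
    using R by (auto simp: doubleton_eq_iff)
  have off: "?c1 e = c e" if "v \<notin> e" for e using that by auto
  have S1w: "seen ?E ?c1 w = seen ?E c w"
    using Af(5) inR wv by (intro seen_cong) auto
  have S1v: "seen ?E ?c1 v \<subseteq> S u0 c v"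
  proof
    fix i assume "i \<in> seen ?E ?c1 v"
    then obtain s where s: "{v, s} \<in> ?E" "?c1 {v, s} = i" using seenE[OF e.graph, of i ?c1 v] by metis
    have "c {v, a} \<in> seen ?E c v" "c {v, b} \<in> seen ?E c v" "c {v, s} \<in> seen ?E c v"
      using eR inR s by (auto intro: seenI)
    then have "i \<in> seen ?E c v" using s(2) unfolding at by (auto split: if_splits)
    then show "i \<in> S u0 c v" using seen_sub by fast
  qed
  define i where "i = c {v, a}"
  have i: "i \<in> A c" using inR by (auto simp: A_def i_def)
  then have iw: "i \<notin> S u0 c w" "i < M + 2" using Af(1) by auto
  have "card (miss u0 c v) \<noteq> 0" using card_miss[OF c edges(2)] degree_le[of v] by linarith
  then obtain q where q: "q \<in> miss u0 c v" by (metis card.empty ex_in_conv)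
  have qi: "q \<noteq> i" "q \<notin> A c" using q i Af(3) by auto
  have bicD: "bic ?D ?c1 i q = bic ?D c i q" by (auto simp: bic_def del_def)
  \<comment> \<open>The edge of color \<open>i\<close> at \<open>v\<close> now leads to
    \<open>b\<close>, whereas the chain from \<open>w\<close> ends at \<open>a\<close>.\<close>
  have nch: "\<not> chain ?E ?c1 i q w v"
  proof
    assume ch: "chain ?E ?c1 i q w v"
    have "q \<notin> seen ?E ?c1 v" "i \<notin> seen ?E ?c1 w"
      using S1v q S1w iw seen_sub(2)[of w] by auto
    moreover have "?c1 {v, b} = i" unfolding at i_def using R by simp
    ultimately have "chain ?D ?c1 i q w b"
      by (rule coloring.chain_nbr_at(3)[OF c1 ch wv _ _ eR[OF inR(2)]])
    then have 1: "chain ?D c i q w b" using chain_cong[OF bicD] by metis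
    have 2: "chain ?D c i q w a" using chain_avoid[OF c inR(1), of q] q qi by (simp add: i_def)
    have "i \<notin> seen ?D c w" "i \<notin> seen ?D c b"
      using iw missing[of a b] inR R seen_sub by (auto simp: i_def)
    moreover have "i \<notin> seen ?D c a" using e.vertex_iff(1)[OF eR[OF inR(1)]] by (simp add: i_def)
    ultimately show False
      using coloring.chain_ends[OF e.coloring_del 1 2] Af(5) inR R by auto
  qed
  define f where "f = (\<lambda>s. if s = w then i else q)"
  let ?c2 = "paint ?c1 u0 f"
  let ?E1 = "avoid (U - {u0})"
  have dE: "del ?E1 u0 = ?E" using del_avoid[of U u0] insert_absorb[OF u0] by simp
  have nbu0: "s = w \<or> s = v" if "{u0, s} \<in> ?E1" for s using that nb by (auto simp: avoid_def)
  have c2: "col ?E1 ?c2"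
  proof (rule coloring_paint[OF graph_avoid])
    show "col (del ?E1 u0) ?c1" unfolding dE by (rule c1)
    fix s assume s: "{u0, s} \<in> ?E1"
    show "f s < M + 2" using q iw by (simp add: f_def)
    have "i \<notin> seen ?E ?c1 w" "q \<notin> seen ?E ?c1 v"
      using S1w S1v iw q seen_sub(2)[of w] by auto
    then show "f s \<notin> seen (del ?E1 u0) ?c1 s" unfolding dE using nbu0[OF s] wv by (auto simp: f_def)
    fix s' assume s': "{u0, s'} \<in> ?E1" "s \<noteq> s'"
    show "f s \<noteq> f s'" using nbu0[OF s] nbu0[OF s'(1)] s'(2) wv qi by (auto simp: f_def)
    show "\<not> chain (del ?E1 u0) ?c1 (f s) (f s') s s'"
      unfolding dE using nbu0[OF s] nbu0[OF s'(1)] s'(2) wv nch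
      by (auto simp: f_def dest: chain_flip)
  qed
  have at2: "?c2 {v, r} = ?c1 {v, r}" if "r \<in> big v" for r
    using that U_neq[OF u0] by (intro paint_off) auto
  show ?thesis
  proof (rule that[OF c R c2])
    fix e assume e: "e \<in> ?D"
    then have "u0 \<notin> e" "v \<notin> e" using u0 by (auto simp: del_def avoid_def)
    then show "?c2 e = c e" using off by simp
  next
    show "?c2 {v, h} = c {v, h}" unfolding at2[OF inR(3)] at using R by simp
    show "?c2 {v, a} = c {v, b}" unfolding at2[OF inR(1)] at using R by simp
    show "?c2 {v, b} = c {v, a}" unfolding at2[OF inR(2)] at using R by simp
    show "?c2 {u0, w} = c {v, a}" by (simp add: f_def i_def)
  qed
qed

text \<open>For an uncolored \<open>u\<close> in \<open>U\<close> that cannot be added, the colors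
  missing at its other neighbor \<open>y\<close> are again \<open>A c\<close>, so \<open>y\<close>
  is not \<open>w\<close>, which now sees the color of \<open>v a\<close>. The color of
  \<open>v h\<close> is unchanged: chains along it end at \<open>h\<close> coming from
  \<open>y\<close> and also coming from \<open>w\<close>.\<close>

lemma impossible: False
proof -
  obtain c c' a b h where c: "col (H u0) c"
    and R: "big v = {a, b, h}" "a \<noteq> b" "a \<noteq> h" "b \<noteq> h"
    and c': "col (avoid (U - {u0})) c'" and agree: "\<And>e. e \<in> del (avoid U) v \<Longrightarrow> c' e = c e"
    and at: "c' {v, h} = c {v, h}" "c' {v, a} = c {v, b}" "c' {v, b} = c {v, a}" "c' {u0, w} = c {v, a}"
    by (rule swap_big) blast
  note Af = A_facts[OF c]
  have inR: "a \<in> big v" "b \<in> big v" "h \<in> big v" using R by auto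
  \<comment> \<open>a maximal extension of \<open>c'\<close> to the remaining neighbors of degree two\<close>
  define ext where "ext = (\<lambda>W. W \<subseteq> U - {u0} \<and>
    (\<exists>d. col (avoid W) d \<and> (\<forall>e\<in>avoid (U - {u0}). d e = c' e)))"
  have "ext (U - {u0})" using c' by (auto simp: ext_def)
  moreover have finU: "finite U"
    using finite_subset[OF _ finite_nbrs[OF graph, of v], of U] by (auto simp: U_def)
  ultimately obtain W where W: "ext W" and min: "\<And>W'. ext W' \<Longrightarrow> card W \<le> card W'"
    using ex_has_least_nat[of ext "U - {u0}" card] by auto
  obtain d where d: "col (avoid W) d" "\<And>e. e \<in> avoid (U - {u0}) \<Longrightarrow> d e = c' e"
    and WU: "W \<subseteq> U - {u0}" using W by (auto simp: ext_def)
  let ?K = "avoid W"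
  interpret d: coloring ?K "M + 2" d by (rule d(1))
  have "W \<noteq> {}"
  proof
    assume "W = {}"
    then have "?K = E" by (auto simp: avoid_def)
    then show False using d(1) uncolorable by simp
  qed
  then obtain u where u: "u \<in> W" "u \<in> U" "u \<noteq> u0" using WU by auto
  obtain y where y: "{s. {u, s} \<in> E} = {y, v}" "y \<noteq> v" "4 \<le> degree E y" using U_nbrs[OF u(2)] .
  have ue: "{u, y} \<in> E" "{u, v} \<in> E" using y by auto
  have finW: "finite W" using WU finU finite_subset by blast
  have chain_u: "chain ?K d p q y v"
    if pq: "p < M + 2" "q < M + 2" "p \<notin> seen ?K d y" "q \<notin> seen ?K d v" "p \<noteq> q" for p q
  proof (rule ccontr)
    assume not: "\<not> chain ?K d p q y v"
    define f where "f = (\<lambda>s. if s = y then p else q)"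
    let ?E1 = "avoid (W - {u})"
    have dE: "del ?E1 u = ?K" using del_avoid[of W u] insert_absorb[OF u(1)] by simp
    have nbu: "s = y \<or> s = v" if "{u, s} \<in> ?E1" for s using that y by (auto simp: avoid_def)
    have "col ?E1 (paint d u f)"
    proof (rule coloring_paint[OF graph_avoid])
      show "col (del ?E1 u) d" unfolding dE by (rule d(1))
      fix s assume s: "{u, s} \<in> ?E1"
      show "f s < M + 2" using pq by (simp add: f_def)
      show "f s \<notin> seen (del ?E1 u) d s" unfolding dE using nbu[OF s] y pq by (auto simp: f_def)
      fix s' assume s': "{u, s'} \<in> ?E1" "s \<noteq> s'"
      show "f s \<noteq> f s'" using nbu[OF s] nbu[OF s'(1)] s'(2) y pq by (auto simp: f_def)
      show "\<not> chain (del ?E1 u) d (f s) (f s') s s'"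
        unfolding dE using nbu[OF s] nbu[OF s'(1)] s'(2) y not
        by (auto simp: f_def dest: chain_flip)
    qed
    moreover have "paint d u f e = c' e" if "e \<in> avoid (U - {u0})" for e
    proof -
      have "u \<notin> e" using that u by (auto simp: avoid_def)
      then show ?thesis using d(2)[OF that] by simp
    qed
    ultimately have "ext (W - {u})" using WU by (auto simp: ext_def)
    then have "card W \<le> card (W - {u})" by (rule min)
    then show False using card_Diff1_less[OF finW u(1)] by linarith
  qed
  have card_K: "3 \<le> card ({..<M + 2} - seen ?K d s)" if s: "{u, s} \<in> E" for s
  proof -
    have "?K \<subseteq> H u" using u by (auto simp: avoid_def del_def)
    then have "degree ?K s \<le> degree (H u) s"
      using degree_mono[of "H u" ?K s] graph_del[OF graph, of u] by (simp add: graph_def)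
    also have "\<dots> < degree E s"
      using degree_del_less[of E u s] s graph by (simp add: graph_def)
    finally have "card (seen ?K d s) < M" using d.card_seen degree_le[of s] by simp
    then show ?thesis using missing_card[OF d.seen_bound, of s] by simp
  qed
  let ?G = "{..<M + 2} - seen ?K d y" and ?D = "{..<M + 2} - seen ?K d v"
  have WU': "W \<subseteq> U" using WU by auto
  have big_d: "d {v, r} = c' {v, r}" "{v, r} \<in> ?K" if "r \<in> big v" for r
    using d(2) big_avoid[OF that] WU' by auto
  \<comment> \<open>The argument of \<open>two_nbr_big\<close>, repeated for \<open>?K\<close>, in
    which several vertices of \<open>U\<close> may still be uncolored.\<close>
  have G_sub: "?G \<subseteq> A c"
  proof
    fix p assume p: "p \<in> ?G"
    have pv: "p \<in> seen ?K d v"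
    proof (rule ccontr)
      assume pv: "p \<notin> seen ?K d v"
      have "\<not> ?D \<subseteq> {p}" using card_K[OF ue(2)] card_mono[of "{p}" ?D] by auto
      then obtain q where q: "q \<in> ?D" "q \<noteq> p" by auto
      show False
        using chain_u[of p q] chain_isolated'[of p ?K d v q y] p pv q y by auto
    qed
    then obtain s where s: "{v, s} \<in> ?K" "d {v, s} = p" using seenE[OF d.graph] by metis
    have "q \<in> seen ?K d s" if q: "q \<in> ?D" for q
    proof (rule d.chain_nbr_at(2)[OF _ y(2) _ _ s])
      have "p \<noteq> q" using q pv by auto
      then show "chain ?K d p q y v" using chain_u[of p q] p q by auto
    qed (use p q in auto)
    moreover have "p \<in> seen ?K d s" using s by (auto simp: insert_commute[of v] intro: seenI)
    ultimately have "insert p ?D \<subseteq> seen ?K d s" by auto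
    then have "card (insert p ?D) \<le> degree E s" using card_le_degree[OF d(1) avoid_subset] by simp
    moreover have "card (insert p ?D) = Suc (card ?D)" using pv by simp
    ultimately have "s \<in> big v" using card_K[OF ue(2)] s(1) avoid_subset by (auto simp: big_def)
    then have "p = c' {v, s}" using big_d s by simp
    then show "p \<in> A c" using \<open>s \<in> big v\<close> R at by (auto simp: A_def)
  qed
  have finA: "finite (A c)" using finite_big by (simp add: A_def)
  have G: "?G = A c"
    using card_seteq[OF finA G_sub] card_K[OF ue(1)] Af(2) by simp
  have wK: "{w, u0} \<in> avoid (U - {u0})"
    using edges U_neq by (auto simp: avoid_def insert_commute)
  then have wK': "{w, u0} \<in> ?K" using WU by (auto simp: avoid_def)
  have "d {w, u0} = c {v, a}" using d(2)[OF wK] at by (simp add: insert_commute)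
  then have aw: "c {v, a} \<in> seen ?K d w" using wK' by (auto intro: seenI)
  have yw: "y \<noteq> w" using aw G inR by (auto simp: A_def)
  define p where "p = c {v, h}"
  have p: "p \<in> A c" "p \<in> ?G" using inR G by (auto simp: p_def A_def)
  have hK: "{v, h} \<in> ?K" "d {v, h} = p" using big_d[OF inR(3)] at by (auto simp: p_def)
  have pv: "p \<in> seen ?K d v" using hK by (rule seenI)
  have "card ?D \<noteq> 0" using card_K[OF ue(2)] by linarith
  then obtain q where q: "q \<in> ?D" by (metis card.empty ex_in_conv)
  have pq: "p \<noteq> q" using q pv by auto
  have ch: "chain ?K d p q y v" using chain_u[of p q] p q pq by auto
  let ?L = "del ?K v"
  have 1: "chain ?L d p q y h"
    using d.chain_nbr_at(3)[OF ch y(2) _ _ hK] p q by auto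
  have "c' {v, r} \<in> seen ?K d v" if "r \<in> big v" for r
    using seenI[OF big_d(2)[OF that], of d] big_d(1)[OF that] by simp
  then have "A c \<subseteq> seen ?K d v" using R at by (force simp: A_def)
  then have qA: "q \<notin> A c" "q < M + 2" using q by auto
  have sub: "del (avoid U) v \<subseteq> ?L" using WU by (auto simp: del_def avoid_def)
  have dc: "d e = c e" if "e \<in> del (avoid U) v" for e
  proof -
    have "e \<in> avoid (U - {u0})" using that by (auto simp: del_def avoid_def)
    then show ?thesis using d(2) agree[OF that] by simp
  qed
  have "chain (del (avoid U) v) c p q w h" using chain_avoid[OF c inR(3) qA(2,1)] by (simp add: p_def)
  then have 2: "chain ?L d p q w h"
    by (rule chain_mono) (use sub dc in \<open>auto simp: bic_def\<close>)
  have hy: "h \<noteq> y"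
  proof
    assume "h = y"
    have "p \<in> seen ?K d h" using hK by (auto simp: insert_commute[of v] intro: seenI)
    then show False using p \<open>h = y\<close> by auto
  qed
  have ph: "p \<notin> seen ?L d h" using d.vertex_iff(1)[OF hK(1)] hK by simp
  have py: "p \<notin> seen ?L d y" using p seen_mono[OF del_subset] by fast
  have hw: "h \<noteq> w" using Af(5) inR by auto
  interpret L: coloring ?L "M + 2" d by (rule d.coloring_del)
  show False
  proof (cases "p \<in> seen ?L d w")
    case False
    then show False using L.chain_ends[OF chain_sym[OF 1] chain_sym[OF 2]] hy hw yw ph py by auto
  next
    case True
    then obtain t where t: "{w, t} \<in> ?L" "d {w, t} = p" using seenE[OF L.graph] by metis
    have tE: "{w, t} \<in> E" "t \<noteq> v" "t \<notin> W" using t(1) by (auto simp: del_def avoid_def)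
    \<comment> \<open>In \<open>c\<close> the color \<open>p\<close> is missing at \<open>w\<close>,
      so this edge was colored together with a vertex of \<open>U\<close>. Outside \<open>v\<close>
      that vertex has no other edge, so the chain ends at \<open>t\<close> instead of
      \<open>w\<close>.\<close>
    have "t \<in> U"
    proof (rule ccontr)
      assume "t \<notin> U"
      then have tD: "{w, t} \<in> del (avoid U) v" using t tE wv U_neq(2) by (auto simp: del_def avoid_def)
      then have "{w, t} \<in> H u0" using avoid_U_subset by (auto simp: del_def)
      moreover have "c {w, t} = p" using dc[OF tD] t by simp
      ultimately have "p \<in> S u0 c w" by (rule seenI)
      then show False using p Af(1) by auto
    qed
    obtain y' where y': "{s. {t, s} \<in> E} = {y', v}" using U_nbrs[OF \<open>t \<in> U\<close>] by metis
    have "w \<in> {y', v}" using tE unfolding y'[symmetric] by (simp add: insert_commute)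
    then have "y' = w" using wv by auto
    have qt: "q \<notin> seen ?L d t"
    proof
      assume "q \<in> seen ?L d t"
      then obtain s where s: "{t, s} \<in> ?L" "d {t, s} = q" using seenE[OF L.graph] by metis
      then have "s \<in> {s. {t, s} \<in> E}" "s \<noteq> v" by (auto simp: del_def avoid_def)
      then have "s = w" unfolding y' using \<open>y' = w\<close> by auto
      then show False using s t pq by (simp add: insert_commute)
    qed
    have "chain ?L d p q t w" by (rule chain_edge) (use t in \<open>auto simp: insert_commute\<close>)
    then have 3: "chain ?L d p q t h" using 2 by (rule chain_trans)
    have "t \<noteq> y" using y(3) Ue(2)[OF \<open>t \<in> U\<close>] by auto
    moreover have "t \<noteq> h" using U_neq(3)[OF \<open>t \<in> U\<close>] inR by auto
    ultimately show False
      using L.chain_ends[OF chain_sym[OF 1] chain_sym[OF 3]] hy ph py qt by auto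
  qed
qed

end

section \<open>Discharging\<close>

context critical
begin

definition nb :: "nat \<Rightarrow> 'a \<Rightarrow> 'a set" where
  "nb k x = {y. {x, y} \<in> E \<and> degree E y = k}"

lemma finite_nb: "finite (nb k x)"
  using finite_subset[OF _ finite_nbrs[OF graph, of x]] by (auto simp: nb_def)

lemma nbrs_eq: "{y. {x, y} \<in> E} = big x \<union> nb 2 x \<union> nb 3 x"
proof -
  have "2 \<le> degree E y" if "{x, y} \<in> E" for y
    using degree_ge_2[of y x] that by (simp add: insert_commute)
  then show ?thesis by (force simp: big_def nb_def)
qed

lemma degree_split: "degree E x = card (big x) + card (nb 2 x) + card (nb 3 x)"
proof -
  have "degree E x = card (big x \<union> nb 2 x \<union> nb 3 x)"
    by (simp add: degree_eq_nbrs[OF graph] nbrs_eq)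
  also have "\<dots> = card (big x \<union> nb 2 x) + card (nb 3 x)"
    by (rule card_Un_disjoint) (auto simp: finite_big finite_nb, auto simp: big_def nb_def)
  also have "card (big x \<union> nb 2 x) = card (big x) + card (nb 2 x)"
    by (rule card_Un_disjoint) (auto simp: finite_big finite_nb, auto simp: big_def nb_def)
  finally show ?thesis .
qed

lemma nb_2_nbrs:
  assumes "y \<in> nb 2 x"
  obtains w where "{s. {y, s} \<in> E} = {w, x}" "w \<noteq> x"
  using degree_2_nbrs[of x y] assms by (auto simp: nb_def)

lemma degree_3_three:
  assumes "y \<in> nb 3 x"
  obtains a b where "three y a b x"
proof -
  have "card {s. {y, s} \<in> E} = 3" "x \<in> {s. {y, s} \<in> E}"
    using assms by (auto simp: nb_def degree_eq_nbrs[OF graph] insert_commute)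
  then obtain a b where "{s. {y, s} \<in> E} = {x, a, b}" "x \<noteq> a" "x \<noteq> b" "a \<noteq> b"
    using card_three_elements by metis
  then show ?thesis using that[of a b] by (auto simp: three_def)
qed

text \<open>There are at least three big neighbors, so the only other possibility is exactly three
  with at most one neighbor of degree three, the situation refuted in
  \<open>few_big\<close>.\<close>

lemma two_nbr_counts:
  assumes "nb 2 x \<noteq> {}"
  shows "4 \<le> card (big x) \<or> card (big x) = 3 \<and> 2 \<le> card (nb 3 x)"
proof (rule ccontr)
  assume not: "\<not> ?thesis"
  obtain y w where y: "{s. {y, s} \<in> E} = {w, x}" "w \<noteq> x"
    using assms nb_2_nbrs by (metis all_not_in_conv)
  have "3 \<le> card (big x)" by (rule card_big_two_nbr[OF y])
  then have "few_big E M x y w"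
    using not y by unfold_locales (auto simp: nb_def)
  then show False by (rule few_big.impossible)
qed

lemma low_nbrs:
  assumes "{x, y} \<in> E" "degree E y \<le> 3"
  shows "4 \<le> degree E x"
proof -
  consider "y \<in> nb 2 x" | "y \<in> nb 3 x"
    using nbrs_eq[of x] assms by (force simp: big_def)
  then show ?thesis
  proof cases
    case 1
    then show ?thesis using nb_2_nbrs two_nbr_degree(1) by metis
  next
    case 2
    then show ?thesis using degree_3_three three_nbr_ge_4 by metis
  qed
qed

text \<open>In units of one sixth: a vertex of degree two lacks 12, a vertex of degree three lacks 6.\<close>

definition give :: "'a \<Rightarrow> 'a \<Rightarrow> int" where
  "give x y = (if degree E y = 2 then 6
    else if degree E y = 3 then
      if nb 4 y = {} then 2 else if degree E x = 4 then 0 else 3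
    else 0)"

lemma give_nonneg: "0 \<le> give x y"
  by (simp add: give_def)

lemma received:
  assumes "degree E y \<in> {2, 3}"
  shows "24 \<le> 6 * int (degree E y) + (\<Sum>x | {y, x} \<in> E. give x y)"
proof (cases "degree E y = 2")
  case True
  then have "(\<Sum>x | {y, x} \<in> E. give x y) = (\<Sum>x | {y, x} \<in> E. 6)" by (simp add: give_def)
  also have "\<dots> = 12" using True by (simp add: degree_eq_nbrs[OF graph])
  finally show ?thesis using True by simp
next
  case False
  then have 3: "degree E y = 3" using assms by simp
  show ?thesis
  proof (cases "nb 4 y = {}")
    case True
    then have "(\<Sum>x | {y, x} \<in> E. give x y) = (\<Sum>x | {y, x} \<in> E. 2)" using 3 by (simp add: give_def)
    also have "\<dots> = 6" using 3 by (simp add: degree_eq_nbrs[OF graph])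
    finally show ?thesis using 3 by simp
  next
    case False
    then obtain w where w: "{y, w} \<in> E" "degree E w = 4" by (auto simp: nb_def)
    then have "y \<in> nb 3 w" using 3 by (simp add: nb_def insert_commute)
    then obtain a b where t: "three y a b w" using degree_3_three by metis
    have "5 \<le> degree E a" "5 \<le> degree E b"
      using four_nbr[OF t w(2)] four_nbr[OF three_swap[OF t] w(2)] by auto
    then have "give a y = 3" "give b y = 3" using 3 False by (auto simp: give_def)
    moreover have "{x. {y, x} \<in> E} = {a, b, w}" using t by (auto simp: three_def)
    moreover have "a \<noteq> b" "a \<noteq> w" "b \<noteq> w" using three_neq[OF t] by auto
    ultimately show ?thesis using 3 give_nonneg[of w y] by simp
  qed
qed

text \<open>With B big neighbors and n2, n3 neighbors of degrees two and three, gifts of 6 and at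
  most 3 are affordable when 6 B + 3 n3 \<ge> 24. This follows from \<open>two_nbr_counts\<close> if
  n2 > 0. If n2 = 0 it reads B + degree \<ge> 8, and \<open>four_nbr\<close> ensures it when some
  neighbor of degree three has a neighbor of degree four.\<close>

lemma given:
  assumes d: "4 \<le> degree E x"
  shows "(\<Sum>y | {x, y} \<in> E. give x y) \<le> 6 * int (degree E x) - 24"
proof -
  have "(\<Sum>y | {x, y} \<in> E. give x y) = (\<Sum>y\<in>big x \<union> nb 2 x. give x y) + (\<Sum>y\<in>nb 3 x. give x y)"
    unfolding nbrs_eq
    by (rule sum.union_disjoint) (auto simp: finite_big finite_nb, auto simp: big_def nb_def)
  also have "(\<Sum>y\<in>big x \<union> nb 2 x. give x y) = (\<Sum>y\<in>big x. give x y) + (\<Sum>y\<in>nb 2 x. give x y)"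
    by (rule sum.union_disjoint) (auto simp: finite_big finite_nb, auto simp: big_def nb_def)
  also have "(\<Sum>y\<in>big x. give x y) = 0" by (intro sum.neutral) (auto simp: give_def big_def)
  also have "(\<Sum>y\<in>nb 2 x. give x y) = 6 * int (card (nb 2 x))" by (simp add: give_def nb_def)
  finally have total: "(\<Sum>y | {x, y} \<in> E. give x y) =
    6 * int (card (nb 2 x)) + (\<Sum>y\<in>nb 3 x. give x y)" by simp
  have bound: "(\<Sum>y\<in>nb 3 x. give x y) \<le> k * int (card (nb 3 x))"
    if "\<And>y. y \<in> nb 3 x \<Longrightarrow> give x y \<le> k" for k
    using sum_bounded_above[of "nb 3 x" "give x" k] that by (simp add: mult.commute)
  have give3: "give x y \<le> 3" if "y \<in> nb 3 x" for y using that by (simp add: give_def nb_def)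
  note split = degree_split[of x]
  show ?thesis
  proof (cases "nb 2 x = {}")
    case False
    then show ?thesis using two_nbr_counts[OF False] total bound[of 3] give3 split by auto
  next
    case n2: True
    then have split: "degree E x = card (big x) + card (nb 3 x)" using split by simp
    have total: "(\<Sum>y | {x, y} \<in> E. give x y) = (\<Sum>y\<in>nb 3 x. give x y)" using total n2 by simp
    show ?thesis
    proof (cases "degree E x = 4")
      case True
      have "give x y = 0" if "y \<in> nb 3 x" for y
      proof -
        have "x \<in> nb 4 y" using that True by (simp add: nb_def insert_commute)
        then show ?thesis using that True by (auto simp: give_def nb_def)
      qed
      then show ?thesis using total True by simp
    next
      case False
      then have d: "5 \<le> degree E x" using d by simp
      show ?thesis
      proof (cases "\<exists>y\<in>nb 3 x. nb 4 y \<noteq> {}")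
        case True
        then obtain y w where y: "y \<in> nb 3 x" "w \<in> nb 4 y" by auto
        have "y \<in> nb 3 w" "degree E w = 4" using y by (auto simp: nb_def insert_commute)
        then obtain a b where t: "three y a b w" using degree_3_three by metis
        have "x = a \<or> x = b"
          using t y \<open>degree E w = 4\<close> False by (auto simp: three_def nb_def insert_commute)
        then have "2 \<le> card (big x) \<and> (degree E x = 5 \<longrightarrow> 3 \<le> card (big x))"
          using four_nbr[OF t \<open>degree E w = 4\<close>] four_nbr[OF three_swap[OF t] \<open>degree E w = 4\<close>] by auto
        then show ?thesis using total bound[of 3] give3 split d by (cases "degree E x = 5") auto
      next
        case none: False
        then have le: "(\<Sum>y\<in>nb 3 x. give x y) \<le> 2 * int (card (nb 3 x))"
          by (intro bound) (auto simp: give_def nb_def)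
        show ?thesis
        proof (cases "degree E x = 5")
          case False
          then show ?thesis using total le split d by simp
        next
          case 5: True
          \<comment> \<open>Degree five means a charge of 6, which pays three gifts of 2.\<close>
          have "card (nb 3 x) \<le> 3"
          proof (rule ccontr)
            assume "\<not> card (nb 3 x) \<le> 3"
            then have 1: "card (big x) \<le> 1" "nb 3 x \<noteq> {}" using split 5 by auto
            then have uniq: "r = r'" if "r \<in> big x" "r' \<in> big x" for r r'
              using that card_le_Suc0_iff_eq[OF finite_big, of x] by auto
            have "r \<in> big x" if "{x, r} \<in> E" "degree E r \<noteq> 3" for r
              using nbrs_eq[of x] n2 that by (auto simp: nb_def)
            then have "five x" using uniq 5 by (auto simp: five_def)
            then show False using 1(2) degree_3_three not_five by (metis all_not_in_conv)
          qed
          then show ?thesis using total le 5 by simp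
        qed
      qed
    qed
  qed
qed

lemma sum_degree: "(\<Sum>x\<in>\<Union>E. degree E x) = 2 * card E"
proof -
  have fin: "finite E" "finite (\<Union>E)"
    using graph finite_Union_edges[OF graph] by (auto simp: graph_def)
  have "(\<Sum>x\<in>\<Union>E. degree E x) = (\<Sum>x\<in>\<Union>E. \<Sum>e\<in>E. if x \<in> e then 1 else 0)"
    using fin by (simp add: degree_def sum.If_cases Int_def)
  also have "\<dots> = (\<Sum>e\<in>E. \<Sum>x\<in>\<Union>E. if x \<in> e then 1 else 0)" by (rule sum.swap)
  also have "\<dots> = (\<Sum>e\<in>E. card e)"
  proof (rule sum.cong)
    fix e assume "e \<in> E"
    then have "\<Union>E \<inter> {x. x \<in> e} = e" by auto
    then show "(\<Sum>x\<in>\<Union>E. if x \<in> e then 1 else 0) = card e" using fin by (simp add: sum.If_cases)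
  qed simp
  also have "\<dots> = 2 * card E" using graph by (simp add: graph_def)
  finally show ?thesis .
qed

text \<open>Gifts cancel in the sum. It runs over \<open>\<Union>E\<close>, the vertices with an
  edge, because an isolated vertex has negative charge and no neighbor to receive from.\<close>

lemma average_degree_ge_4: "2 * card (\<Union>E) \<le> card E"
proof -
  let ?X = "\<Union>E"
  have fin: "finite ?X" by (rule finite_Union_edges[OF graph])
  have restrict: "(\<Sum>y | {x, y} \<in> E. g y) = (\<Sum>y\<in>?X. if {x, y} \<in> E then g y else 0)"
    for x and g :: "'a \<Rightarrow> int"
    unfolding sum.inter_filter[OF fin, symmetric] by (rule sum.cong) auto
  have "(\<Sum>x\<in>?X. \<Sum>y | {x, y} \<in> E. give x y) = (\<Sum>x\<in>?X. \<Sum>y\<in>?X. if {x, y} \<in> E then give x y else 0)"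
    by (simp only: restrict)
  also have "\<dots> = (\<Sum>y\<in>?X. \<Sum>x\<in>?X. if {x, y} \<in> E then give x y else 0)" by (rule sum.swap)
  also have "\<dots> = (\<Sum>y\<in>?X. \<Sum>x\<in>?X. if {y, x} \<in> E then give x y else 0)"
    by (simp only: insert_commute)
  also have "\<dots> = (\<Sum>y\<in>?X. \<Sum>x | {y, x} \<in> E. give x y)" by (simp only: restrict)
  finally have swap: "(\<Sum>x\<in>?X. \<Sum>y | {x, y} \<in> E. give x y) = (\<Sum>x\<in>?X. \<Sum>y | {x, y} \<in> E. give y x)" .
  have "24 \<le> 6 * int (degree E x) + (\<Sum>y | {x, y} \<in> E. give y x) - (\<Sum>y | {x, y} \<in> E. give x y)"
    if x: "x \<in> ?X" for x
  proof (cases "4 \<le> degree E x")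
    case True
    have "0 \<le> (\<Sum>y | {x, y} \<in> E. give y x)" by (intro sum_nonneg give_nonneg)
    then show ?thesis using given[OF True] by simp
  next
    case False
    obtain e where e: "e \<in> E" "x \<in> e" using x by auto
    obtain y where "e = {x, y}" using graph_edge[OF graph e] .
    then have "2 \<le> degree E x" using degree_ge_2 e by simp
    then have d: "degree E x \<in> {2, 3}" using False by auto
    have "4 \<le> degree E y" if "{x, y} \<in> E" for y
      using low_nbrs[of y x] that False by (simp add: insert_commute)
    then have "(\<Sum>y | {x, y} \<in> E. give x y) = 0"
      by (intro sum.neutral) (force simp: give_def)
    then show ?thesis using received[OF d] by simp
  qed
  then have "(\<Sum>x\<in>?X. 24) \<le> (\<Sum>x\<in>?X. 6 * int (degree E x) +
      (\<Sum>y | {x, y} \<in> E. give y x) - (\<Sum>y | {x, y} \<in> E. give x y))"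
    by (rule sum_mono)
  also have "\<dots> = 6 * (\<Sum>x\<in>?X. int (degree E x))"
    using swap by (simp add: sum.distrib sum_subtractf sum_distrib_left)
  also have "(\<Sum>x\<in>?X. int (degree E x)) = int (2 * card E)" by (simp flip: sum_degree)
  finally show ?thesis by simp
qed

end

section \<open>From minimal uncolorable graphs to the bound\<close>

theorem theorem1:
  fixes V :: "'a set" and E :: "'a set set"
  assumes "finite_simple_graph V E"
    and "mad V E < 4"
  shows "acyclic_chromatic_index E \<le> max_degree V E + 2"
proof -
  interpret finite_simple_graph V E by fact
  define M where "M = max_degree V E"
  have gE: "graph E" using finite_edges edges by (auto simp: graph_def)
  have deg: "degree E x \<le> M" for x
  proof (cases "x \<in> V")
    case True
    then show ?thesis by (simp add: M_def degree_le_max_degree)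
  next
    case False
    then have "{e \<in> E. x \<in> e} = {}" using edges by auto
    then show ?thesis unfolding degree_def by (simp only: card.empty)
  qed
  \<comment> \<open>\<open>M\<close> stays the maximum degree of the whole graph for every
    \<open>F\<close>, so a smallest uncolorable \<open>F\<close> is \<open>critical\<close> with
    this \<open>M\<close>.\<close>
  have "\<exists>c. coloring F (M + 2) c" if "F \<subseteq> E" for F
    using that
  proof (induction "card F" arbitrary: F rule: less_induct)
    case less
    have gF: "graph F" using gE less.prems by (rule graph_subset)
    have finF: "finite F" using gF by (simp add: graph_def)
    show ?case
    proof (rule ccontr)
      assume none: "\<nexists>c. coloring F (M + 2) c"
      interpret critical F M
      proof
        show "degree F x \<le> M" for x
          using degree_mono[OF finite_edges less.prems, of x] deg[of x] by simp
        show "\<exists>c. coloring F' (M + 2) c" if "F' \<subset> F" for F'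
          using less.hyps[of F'] psubset_card_mono[OF finF that] that less.prems by auto
      qed (use gF none in auto)
      have "F \<noteq> {}"
      proof
        assume "F = {}"
        moreover have "\<not> is_cycle {} vs" for vs :: "'a list"
          by (cases vs) (auto simp: is_cycle_def)
        ultimately have "coloring F (M + 2) (\<lambda>_. 0)"
          by (simp add: coloring_def graph_def acyclic_edge_coloring_def proper_edge_coloring_def
            forest_def)
        then show False using none by blast
      qed
      moreover have "e \<noteq> {}" if "e \<in> F" for e using gF that by (auto simp: graph_def)
      ultimately have ne: "\<Union>F \<noteq> {}" by auto
      \<comment> \<open>The subgraph without isolated vertices, so that \<open>mad\<close> and
        \<open>average_degree_ge_4\<close> speak of the same vertex set.\<close>
      have "subgraph (\<Union>F) F V E"
        using less.prems edges by (auto simp: subgraph_def)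
      then have "2 * real (card F) / real (card (\<Union>F)) < 4"
        using average_degree_le_mad[of "\<Union>F" F] ne assms(2) by simp
      moreover have "\<Union>F \<subseteq> V" using less.prems edges by auto
      then have "0 < card (\<Union>F)"
        using ne finite_vertices finite_subset by (auto simp: card_gt_0_iff)
      ultimately have "real (card F) < 2 * real (card (\<Union>F))" by (simp add: field_simps)
      then show False using average_degree_ge_4 by simp
    qed
  qed
  then obtain c where "coloring E (M + 2) c" by blast
  then have "acyclic_edge_coloring E (M + 2) c" by (rule coloring.acyclic)
  then show ?thesis
    unfolding acyclic_chromatic_index_def M_def by (intro Least_le) blast
qed

end
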